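(* Let $f\colon\mathbb{N}\to\mathbb{N}$ be a subexponential function (arbitrarily rapid) and let $\omega\colon \mathbb{N}\to \mathbb{N}$ be a non-decreasing, super-polynomial function (arbitrarily slow). Let $F$ be an arbitrary field. Then there exists a finitely generated nil algebra $R$ over $F$, with growth function $g_R$ (with respect to a suitable finite-dimensional generating subspace), such that: (1) $g_R(n)\leq \omega(n)$ for infinitely many $n$; and (2) $g_R(n)\geq f(n)$ for infinitely many $n$.
   Context: $\mathbb{N}=\{1,2,\dots\}$. A non-decreasing function $f\colon\mathbb{N}\to\mathbb{N}$ is subexponential if $\limsup_{n\to\infty}\sqrt[n]{f(n)}=1$. A function $\omega$ is super-polynomial if $\omega(n)/n^d\to\infty$ as $n\to\infty$ for every $d>0$. Algebras are associative and not necessarily unital; an algebra is nil if every element of it is nilpotent. If an algebra $A$ over $F$ is generated by a finite-dimensional subspace $V$, its growth function with respect to $V$ is $g_A(n)=g_{A,V}(n)=\dim_F(F+V+V^2+\cdots+V^n)$ (computed in the unital hull of $A$ if $A$ is non-unital). *)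

theory Defs
  imports
    "Jordan_Normal_Form.Missing_VectorSpace"
    "HOL-Library.Extended_Real"
begin

text \<open>The set of positive integers is modelled by \<^term>\<open>{1::nat..}\<close>; the value at 0 of a
  function on it is unconstrained.\<close>

definition subexponential :: "(nat \<Rightarrow> nat) \<Rightarrow> bool" where
  "subexponential f \<longleftrightarrow>
     f ` {1..} \<subseteq> {1..} \<and> mono_on {1..} f \<and> limsup (\<lambda>n. ereal (root n (real (f n)))) = 1"

definition super_polynomial :: "(nat \<Rightarrow> nat) \<Rightarrow> bool" where
  "super_polynomial w \<longleftrightarrow>
     (\<forall>d::real. d > 0 \<longrightarrow> filterlim (\<lambda>n. real (w n) / real n powr d) at_top sequentially)"

text \<open>The record field \<open>one\<close> of a non-unital algebra is a dummy: no axiom mentions it.\<close>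

locale nonunital_algebra = vectorspace F A
  for F :: "('f, 'm) ring_scheme" (structure) and A :: "('f, 'a, 'n) module_scheme" (structure) +
  assumes mult_closed:
      "\<lbrakk>x \<in> carrier A; y \<in> carrier A\<rbrakk> \<Longrightarrow> x \<otimes>\<^bsub>A\<^esub> y \<in> carrier A"
    and mult_assoc:
      "\<lbrakk>x \<in> carrier A; y \<in> carrier A; z \<in> carrier A\<rbrakk> \<Longrightarrow>
        (x \<otimes>\<^bsub>A\<^esub> y) \<otimes>\<^bsub>A\<^esub> z = x \<otimes>\<^bsub>A\<^esub> (y \<otimes>\<^bsub>A\<^esub> z)"
    and mult_distrib_right:
      "\<lbrakk>x \<in> carrier A; y \<in> carrier A; z \<in> carrier A\<rbrakk> \<Longrightarrow>
        (x \<oplus>\<^bsub>A\<^esub> y) \<otimes>\<^bsub>A\<^esub> z = (x \<otimes>\<^bsub>A\<^esub> z) \<oplus>\<^bsub>A\<^esub> (y \<otimes>\<^bsub>A\<^esub> z)"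
    and mult_distrib_left:
      "\<lbrakk>x \<in> carrier A; y \<in> carrier A; z \<in> carrier A\<rbrakk> \<Longrightarrow>
        z \<otimes>\<^bsub>A\<^esub> (x \<oplus>\<^bsub>A\<^esub> y) = (z \<otimes>\<^bsub>A\<^esub> x) \<oplus>\<^bsub>A\<^esub> (z \<otimes>\<^bsub>A\<^esub> y)"
    and smult_mult_left:
      "\<lbrakk>c \<in> carrier F; x \<in> carrier A; y \<in> carrier A\<rbrakk> \<Longrightarrow>
        (c \<odot>\<^bsub>A\<^esub> x) \<otimes>\<^bsub>A\<^esub> y = c \<odot>\<^bsub>A\<^esub> (x \<otimes>\<^bsub>A\<^esub> y)"
    and smult_mult_right:
      "\<lbrakk>c \<in> carrier F; x \<in> carrier A; y \<in> carrier A\<rbrakk> \<Longrightarrow>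
        x \<otimes>\<^bsub>A\<^esub> (c \<odot>\<^bsub>A\<^esub> y) = c \<odot>\<^bsub>A\<^esub> (x \<otimes>\<^bsub>A\<^esub> y)"

definition subalgebra ::
    "('f, 'm) ring_scheme \<Rightarrow> 'a set \<Rightarrow> ('f, 'a, 'n) module_scheme \<Rightarrow> bool" where
  "subalgebra F B A \<longleftrightarrow> VectorSpace.subspace F B A \<and> (\<forall>x\<in>B. \<forall>y\<in>B. x \<otimes>\<^bsub>A\<^esub> y \<in> B)"

definition generates ::
    "('f, 'm) ring_scheme \<Rightarrow> ('f, 'a, 'n) module_scheme \<Rightarrow> 'a set \<Rightarrow> bool" where
  "generates F A X \<longleftrightarrow> X \<subseteq> carrier A \<and> \<Inter>{B. subalgebra F B A \<and> X \<subseteq> B} = carrier A"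

definition finitely_generated ::
    "('f, 'm) ring_scheme \<Rightarrow> ('f, 'a, 'n) module_scheme \<Rightarrow> bool" where
  "finitely_generated F A \<longleftrightarrow> (\<exists>X. finite X \<and> generates F A X)"

definition generating_subspace ::
    "('f, 'm) ring_scheme \<Rightarrow> ('f, 'a, 'n) module_scheme \<Rightarrow> 'a set \<Rightarrow> bool" where
  "generating_subspace F A V \<longleftrightarrow>
     VectorSpace.subspace F V A \<and> vectorspace.fin_dim F (A\<lparr>carrier := V\<rparr>) \<and> generates F A V"

text \<open>Since there need not be a unit, powers are formed without the zeroth one: the iterate
  below is the power of \<open>x\<close> with exponent \<open>k + 1\<close>.\<close>

definition nil_algebra :: "('f, 'a, 'n) module_scheme \<Rightarrow> bool" where
  "nil_algebra A \<longleftrightarrow> (\<forall>x\<in>carrier A. \<exists>k::nat. ((\<lambda>y. y \<otimes>\<^bsub>A\<^esub> x) ^^ k) x = \<zero>\<^bsub>A\<^esub>)"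

definition unital_hull ::
    "('f, 'm) ring_scheme \<Rightarrow> ('f, 'a, 'n) module_scheme \<Rightarrow> ('f, 'f \<times> 'a) module" where
  "unital_hull F A = \<lparr>
     carrier = carrier F \<times> carrier A,
     mult = (\<lambda>(a, x) (b, y).
       (a \<otimes>\<^bsub>F\<^esub> b, (a \<odot>\<^bsub>A\<^esub> y \<oplus>\<^bsub>A\<^esub> b \<odot>\<^bsub>A\<^esub> x) \<oplus>\<^bsub>A\<^esub> x \<otimes>\<^bsub>A\<^esub> y)),
     one = (\<one>\<^bsub>F\<^esub>, \<zero>\<^bsub>A\<^esub>),
     zero = (\<zero>\<^bsub>F\<^esub>, \<zero>\<^bsub>A\<^esub>),
     add = (\<lambda>(a, x) (b, y). (a \<oplus>\<^bsub>F\<^esub> b, x \<oplus>\<^bsub>A\<^esub> y)),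
     smult = (\<lambda>c (a, x). (c \<otimes>\<^bsub>F\<^esub> a, c \<odot>\<^bsub>A\<^esub> x))\<rparr>"

text \<open>In a unital algebra \<open>B\<close>, \<open>power_space F B V 0\<close> is the line spanned by \<^term>\<open>\<one>\<^bsub>B\<^esub>\<close>, that is,
  the copy of the field \<open>F\<close> in \<open>B\<close>.\<close>

primrec power_space ::
    "('f, 'm) ring_scheme \<Rightarrow> ('f, 'a, 'n) module_scheme \<Rightarrow> 'a set \<Rightarrow> nat \<Rightarrow> 'a set" where
  "power_space F B V 0 = LinearCombinations.module.span F B {\<one>\<^bsub>B\<^esub>}"
| "power_space F B V (Suc n) =
     LinearCombinations.module.span F B {x \<otimes>\<^bsub>B\<^esub> v | x v. x \<in> power_space F B V n \<and> v \<in> V}"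

definition unital_growth ::
    "('f, 'm) ring_scheme \<Rightarrow> ('f, 'a, 'n) module_scheme \<Rightarrow> 'a set \<Rightarrow> nat \<Rightarrow> nat" where
  "unital_growth F B V n =
     vectorspace.dim F (B\<lparr>carrier := LinearCombinations.module.span F B (\<Union>i\<le>n. power_space F B V i)\<rparr>)"

definition is_identity :: "('f, 'a, 'n) module_scheme \<Rightarrow> 'a \<Rightarrow> bool" where
  "is_identity A e \<longleftrightarrow>
     e \<in> carrier A \<and> (\<forall>x\<in>carrier A. e \<otimes>\<^bsub>A\<^esub> x = x \<and> x \<otimes>\<^bsub>A\<^esub> e = x)"

definition growth ::
    "('f, 'm) ring_scheme \<Rightarrow> ('f, 'a, 'n) module_scheme \<Rightarrow> 'a set \<Rightarrow> nat \<Rightarrow> nat" where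
  "growth F A V n =
     (if \<exists>e. is_identity A e
      then unital_growth F (A\<lparr>one := (THE e. is_identity A e)\<rparr>) V n
      else unital_growth F (unital_hull F A) (Pair \<zero>\<^bsub>F\<^esub> ` V) n)"

text \<open>A type large enough to carry every finitely generated algebra up to isomorphism: such an
  algebra is a quotient of the free non-unital algebra on \<open>k\<close> letters, whose elements are
  functions from words over \<^term>\<open>{..<k}\<close> to the field, and the elements of the quotient are
  cosets of an ideal.\<close>

type_synonym 'f free_coset = "(nat list \<Rightarrow> 'f) set"

end

(* All functionals live on words over two letters. A chain of spaces E_k of functions on words of
   length s_k, with s_k dividing s_(k+1), is built so that every aligned block restriction of a member
   of E_(k+1) lies in E_k. The algebra is the free algebra modulo the largest ideal on which all
   translates of members of the E_k vanish. A step from E_k to E_(k+1) first pads: all blocks but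
   the last carry one fixed functional, so that a window not longer than the padded length sees only
   polynomially many functionals, and the growth there is below omega. It then takes a high tensor
   power, of dimension at least 2^m, and imposes the relations that kill the powers of all elements
   of degree at most k. Expanding a power of a generic element, polynomially many relations (in m)
   suffice over any field, so the resulting space, and with it the growth, is still above f. *)

theory Submission
  imports Defs
begin

section \<open>Combinations of words and the quotient algebra\<close>

text \<open>Working with functionals rather than with generators of an ideal turns both growth
  bounds into linear algebra: biorthogonal words bound a dimension from below, and a finite set of
  functionals that determines all others on short words bounds it from above. Over an infinite field
  there are infinitely many elements of each degree, so the relations must not depend on
  coefficients. As coefficients commute, the products in a power can be grouped by the multiset of
  their factors; over the fixed alphabet of words of length at most d, the number of multisets of
  size at most B is polynomial in B. Relations are imposed on aligned blocks only, while products of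
  words ignore block boundaries; hence relations carry short contexts on both sides, for the factors
  that straddle the ends of a block. The order of choices matters: the padding length s is fixed
  against omega before the tensor exponent m is fixed against f. For fixed s a subexponential f
  eventually satisfies f(s m) <= (3/2)^m, so any sparsity caused by padding can be made up for
  afterwards.\<close>

locale word_field = field F for F :: "('f, 'm) ring_scheme" (structure)
begin

definition wfuns :: "(nat list \<Rightarrow> 'f) set" where
  "wfuns = {t. \<forall>w. t w \<in> carrier F}"

text \<open>Lists are not normalised: words may repeat and coefficients may vanish. Combinations are
  compared only through \<open>pair\<close>, so concatenation serves as addition.\<close>

definition wcomb :: "('f \<times> nat list) list \<Rightarrow> bool" where
  "wcomb L \<longleftrightarrow> (\<forall>p\<in>set L. fst p \<in> carrier F)"

primrec pair :: "(nat list \<Rightarrow> 'f) \<Rightarrow> ('f \<times> nat list) list \<Rightarrow> 'f" where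
  "pair t [] = \<zero>"
| "pair t (p # L) = fst p \<otimes> t (snd p) \<oplus> pair t L"

definition smul :: "'f \<Rightarrow> ('f \<times> nat list) list \<Rightarrow> ('f \<times> nat list) list" where
  "smul c L = map (\<lambda>(d, w). (c \<otimes> d, w)) L"

definition mul :: "('f \<times> nat list) list \<Rightarrow> ('f \<times> nat list) list \<Rightarrow> ('f \<times> nat list) list" where
  "mul L K = concat (map (\<lambda>(c, w). map (\<lambda>(d, v). (c \<otimes> d, w @ v)) K) L)"

lemma wcomb_simps [simp]:
  "wcomb []" "wcomb (p # L) \<longleftrightarrow> fst p \<in> carrier F \<and> wcomb L"
  "wcomb (L @ K) \<longleftrightarrow> wcomb L \<and> wcomb K"
  by (auto simp: wcomb_def)

lemma wcomb_smul [simp]: "c \<in> carrier F \<Longrightarrow> wcomb L \<Longrightarrow> wcomb (smul c L)"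
  by (auto simp: wcomb_def smul_def)

lemma wcomb_mul [simp]: "wcomb L \<Longrightarrow> wcomb K \<Longrightarrow> wcomb (mul L K)"
  by (fastforce simp: wcomb_def mul_def)

lemma wfunD [simp]: "t \<in> wfuns \<Longrightarrow> t w \<in> carrier F"
  by (simp add: wfuns_def)

lemma wfunI: "(\<And>w. t w \<in> carrier F) \<Longrightarrow> t \<in> wfuns"
  unfolding wfuns_def by blast

lemma wfun_shift [simp]:
  "t \<in> wfuns \<Longrightarrow> (\<lambda>v. t (u @ v)) \<in> wfuns"
  "t \<in> wfuns \<Longrightarrow> (\<lambda>w. t (w @ u)) \<in> wfuns"
  "t \<in> wfuns \<Longrightarrow> (\<lambda>w. t (u @ w @ v)) \<in> wfuns"
  by (simp_all add: wfunI)

lemma pair_closed [simp]: "t \<in> wfuns \<Longrightarrow> wcomb L \<Longrightarrow> pair t L \<in> carrier F"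
  by (induction L) auto

lemma wfun_pair [simp]: "(\<And>w. s w \<in> wfuns) \<Longrightarrow> wcomb L \<Longrightarrow> (\<lambda>w. pair (s w) L) \<in> wfuns"
  by (simp add: wfunI)

lemma wfun_add [simp]: "t \<in> wfuns \<Longrightarrow> s \<in> wfuns \<Longrightarrow> (\<lambda>w. t w \<oplus> s w) \<in> wfuns"
  by (simp add: wfunI)

lemma wfun_smult [simp]: "c \<in> carrier F \<Longrightarrow> s \<in> wfuns \<Longrightarrow> (\<lambda>w. c \<otimes> s w) \<in> wfuns"
  by (simp add: wfunI)

lemma pair_append:
  "t \<in> wfuns \<Longrightarrow> wcomb L \<Longrightarrow> wcomb K \<Longrightarrow> pair t (L @ K) = pair t L \<oplus> pair t K"
  by (induction L) (auto simp: a_assoc)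

lemma pair_smul:
  "t \<in> wfuns \<Longrightarrow> wcomb L \<Longrightarrow> c \<in> carrier F \<Longrightarrow> pair t (smul c L) = c \<otimes> pair t L"
  by (induction L) (auto simp: smul_def r_distr m_assoc)

lemma pair_cong: "(\<And>p. p \<in> set L \<Longrightarrow> t (snd p) = s (snd p)) \<Longrightarrow> pair t L = pair s L"
  by (induction L) auto

lemma pair_zero: "wcomb L \<Longrightarrow> (\<And>p. p \<in> set L \<Longrightarrow> t (snd p) = \<zero>) \<Longrightarrow> pair t L = \<zero>"
  by (induction L) auto

lemma pair_add_fun:
  "t \<in> wfuns \<Longrightarrow> s \<in> wfuns \<Longrightarrow> wcomb L \<Longrightarrow> pair (\<lambda>w. t w \<oplus> s w) L = pair t L \<oplus> pair s L"
  by (induction L) (auto simp: r_distr a_ac)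

lemma pair_smult_fun:
  "t \<in> wfuns \<Longrightarrow> c \<in> carrier F \<Longrightarrow> wcomb L \<Longrightarrow> pair (\<lambda>w. c \<otimes> t w) L = c \<otimes> pair t L"
  by (induction L) (auto simp: r_distr m_ac)

lemma pair_finsum_fun:
  assumes "finite I" "\<And>i. i \<in> I \<Longrightarrow> t i \<in> wfuns" "c \<in> I \<rightarrow> carrier F" "wcomb L"
  shows "pair (\<lambda>w. \<Oplus>i\<in>I. c i \<otimes> t i w) L = (\<Oplus>i\<in>I. c i \<otimes> pair (t i) L)"
  using assms
proof (induction I rule: finite_induct)
  case empty
  then show ?case by (simp add: pair_zero)
next
  case (insert i I)
  have c: "c i \<in> carrier F" "c \<in> I \<rightarrow> carrier F" and t: "t i \<in> wfuns" "\<And>j. j \<in> I \<Longrightarrow> t j \<in> wfuns"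
    using insert.prems by auto
  have ct: "(\<lambda>j. c j \<otimes> t j w) \<in> I \<rightarrow> carrier F" for w
    using c(2) t(2) by (intro funcsetI m_closed) (auto dest: wfunD)
  have "pair (\<lambda>w. \<Oplus>j\<in>insert i I. c j \<otimes> t j w) L = pair (\<lambda>w. c i \<otimes> t i w \<oplus> (\<Oplus>j\<in>I. c j \<otimes> t j w)) L"
    using insert.hyps c(1) t(1) ct by (intro pair_cong finsum_insert) simp_all
  also have "\<dots> = c i \<otimes> pair (t i) L \<oplus> pair (\<lambda>w. \<Oplus>j\<in>I. c j \<otimes> t j w) L"
    using c t(1) ct insert.prems(3) by (subst pair_add_fun) (simp_all add: pair_smult_fun finsum_closed wfunI)
  also have "\<dots> = c i \<otimes> pair (t i) L \<oplus> (\<Oplus>j\<in>I. c j \<otimes> pair (t j) L)"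
    using insert.IH c(2) t(2) insert.prems(3) by simp
  also have "\<dots> = (\<Oplus>j\<in>insert i I. c j \<otimes> pair (t j) L)"
  proof -
    have "(\<lambda>j. c j \<otimes> pair (t j) L) \<in> I \<rightarrow> carrier F"
      using c(2) t(2) insert.prems(3) by (intro funcsetI m_closed) auto
    then show ?thesis
      using insert.hyps c(1) t(1) insert.prems(3) by simp
  qed
  finally show ?case .
qed

lemma pair_mul:
  assumes "t \<in> wfuns" "wcomb L" "wcomb K"
  shows "pair t (mul L K) = pair (\<lambda>w. pair (\<lambda>v. t (w @ v)) K) L"
  using assms(2)
proof (induction L)
  case (Cons p L)
  have *: "pair t (map (\<lambda>(d, v). (fst p \<otimes> d, snd p @ v)) K) = fst p \<otimes> pair (\<lambda>v. t (snd p @ v)) K"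
    if "fst p \<in> carrier F"
    using assms(1,3) that by (induction K) (auto simp: r_distr m_assoc)
  have "mul (p # L) K = map (\<lambda>(d, v). (fst p \<otimes> d, snd p @ v)) K @ mul L K"
    by (cases p) (simp add: mul_def)
  moreover have "wcomb (map (\<lambda>(d, v). (fst p \<otimes> d, snd p @ v)) K)"
    using Cons.prems assms(3) by (auto simp: wcomb_def)
  ultimately show ?case
    using Cons assms(1,3) * by (simp add: pair_append)
qed (simp add: mul_def)

lemma pair_swap:
  assumes "\<And>w. s w \<in> wfuns" "\<And>v. (\<lambda>w. s w v) \<in> wfuns" "wcomb L" "wcomb K"
  shows "pair (\<lambda>w. pair (\<lambda>v. s w v) K) L = pair (\<lambda>v. pair (\<lambda>w. s w v) L) K"
  using assms(3)
proof (induction L)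
  case Nil
  then show ?case using assms by (simp add: pair_zero)
next
  case (Cons p L)
  then show ?case
    using assms by (simp add: pair_add_fun pair_smult_fun)
qed

text \<open>\<open>pair_mul\<close> evaluates the right factor first, against left translates of
  \<open>t\<close>; here the left factor comes first, against right translates. Replacing one factor
  by an equivalent one uses the matching form.\<close>

lemma pair_mul_swap:
  assumes "t \<in> wfuns" "wcomb L" "wcomb K"
  shows "pair t (mul L K) = pair (\<lambda>v. pair (\<lambda>w. t (w @ v)) L) K"
  using assms by (simp add: pair_mul, subst pair_swap) auto

definition single :: "nat list \<Rightarrow> ('f \<times> nat list) list" where
  "single w = [(\<one>, w)]"

lemma wcomb_single [simp]: "wcomb (single w)"
  by (simp add: single_def)

lemma pair_single [simp]: "t \<in> wfuns \<Longrightarrow> pair t (single w) = t w"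
  by (simp add: single_def)

text \<open>These represent the elements of the free algebra without unit; \<open>wcomb\<close> also
  admits the empty word, as in the zeroth power \<open>lpow L 0\<close>.\<close>

definition vcomb :: "('f \<times> nat list) list \<Rightarrow> bool" where
  "vcomb L \<longleftrightarrow> wcomb L \<and> (\<forall>p\<in>set L. snd p \<noteq> [])"

lemma vcomb_wcomb [simp]: "vcomb L \<Longrightarrow> wcomb L"
  by (simp add: vcomb_def)

lemma vcomb_simps [simp]:
  "vcomb []" "vcomb (L @ K) \<longleftrightarrow> vcomb L \<and> vcomb K"
  "vcomb (single w) \<longleftrightarrow> w \<noteq> []"
  by (auto simp: vcomb_def single_def)

lemma vcomb_smul [simp]: "c \<in> carrier F \<Longrightarrow> vcomb L \<Longrightarrow> vcomb (smul c L)"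
  by (auto simp: vcomb_def wcomb_def smul_def)

lemma vcomb_mul [simp]: "vcomb L \<Longrightarrow> vcomb K \<Longrightarrow> vcomb (mul L K)"
  by (fastforce simp: vcomb_def wcomb_def mul_def)

end

text \<open>A finite linear combination of words is a list of coefficients and words, and \<^term>\<open>T\<close> is a
  translation-invariant set of functions on words. Two combinations are identified when all
  members of \<^term>\<open>T\<close> take the same value on them; the class of \<^term>\<open>L\<close> is represented by the graph of
  \<open>t \<mapsto> pair t L\<close>, a pair of a scalar and a function being encoded as one function by
  \<^const>\<open>case_list\<close>.\<close>

locale translation_system = word_field +
  fixes T :: "(nat list \<Rightarrow> 'a) set"
  assumes T_wfuns: "T \<subseteq> wfuns"
    and T_left: "t \<in> T \<Longrightarrow> (\<lambda>w. t (u @ w)) \<in> T"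
    and T_right: "t \<in> T \<Longrightarrow> (\<lambda>w. t (w @ u)) \<in> T"
    and T_letters: "t \<in> T \<Longrightarrow> t w \<noteq> \<zero> \<Longrightarrow> set w \<subseteq> {0, 1}"
begin

definition cls :: "('a \<times> nat list) list \<Rightarrow> 'a free_coset" where
  "cls L = (\<lambda>t. case_list (pair t L) (\<lambda>_. t)) ` T"

lemma cls_eq_iff: "cls L = cls K \<longleftrightarrow> (\<forall>t\<in>T. pair t L = pair t K)"
proof
  assume eq: "cls L = cls K"
  show "\<forall>t\<in>T. pair t L = pair t K"
  proof
    fix t assume "t \<in> T"
    then have "case_list (pair t L) (\<lambda>_. t) \<in> cls K"
      using eq unfolding cls_def by auto
    then obtain s where s: "s \<in> T" "case_list (pair t L) (\<lambda>_. t) = case_list (pair s K) (\<lambda>_. s)"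
      unfolding cls_def by auto
    \<comment> \<open>\<open>case_list\<close> stores the scalar at the empty list and the
      functional on the tails of nonempty lists; any head, here 0, recovers the functional.\<close>
    have "t w = s w" for w
      using fun_cong[OF s(2), of "0 # w"] by simp
    moreover have "pair t L = pair s K"
      using fun_cong[OF s(2), of "[]"] by simp
    ultimately show "pair t L = pair t K"
      by (metis ext)
  qed
qed (auto simp: cls_def)

definition rep :: "'a free_coset \<Rightarrow> ('a \<times> nat list) list" where
  "rep X = (SOME L. vcomb L \<and> cls L = X)"

lemma rep_cls: "vcomb L \<Longrightarrow> vcomb (rep (cls L)) \<and> cls (rep (cls L)) = cls L"
  unfolding rep_def by (rule someI_ex) auto

lemma vcomb_rep [simp]: "vcomb L \<Longrightarrow> vcomb (rep (cls L))"
  using rep_cls by blast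

lemma pair_rep [simp]: "t \<in> T \<Longrightarrow> vcomb L \<Longrightarrow> pair t (rep (cls L)) = pair t L"
  using rep_cls cls_eq_iff by blast

text \<open>The common kernel of \<open>T\<close> is a two-sided ideal because \<open>T\<close> is
  closed under translates on both sides, so operations on chosen representatives do not depend on
  the choice. The field \<open>one\<close> is a dummy.\<close>

definition quot :: "('a, 'a free_coset) module" where
  "quot = \<lparr>carrier = cls ` {L. vcomb L}, mult = (\<lambda>X Y. cls (mul (rep X) (rep Y))),
     one = cls [], zero = cls [], add = (\<lambda>X Y. cls (rep X @ rep Y)),
     smult = (\<lambda>c X. cls (smul c (rep X)))\<rparr>"

lemma T_wfunsD [simp]: "t \<in> T \<Longrightarrow> t \<in> wfuns"
  using T_wfuns by auto

lemma quot_add: "vcomb L \<Longrightarrow> vcomb K \<Longrightarrow> cls L \<oplus>\<^bsub>quot\<^esub> cls K = cls (L @ K)"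
  by (simp add: quot_def cls_eq_iff pair_append)

lemma quot_smult: "c \<in> carrier F \<Longrightarrow> vcomb L \<Longrightarrow> c \<odot>\<^bsub>quot\<^esub> cls L = cls (smul c L)"
  by (simp add: quot_def cls_eq_iff pair_smul)

lemma quot_mult:
  assumes "vcomb L" "vcomb K"
  shows "cls L \<otimes>\<^bsub>quot\<^esub> cls K = cls (mul L K)"
proof -
  have "pair t (mul (rep (cls L)) (rep (cls K))) = pair t (mul L K)" if t: "t \<in> T" for t
  proof -
    have "pair t (mul (rep (cls L)) (rep (cls K))) = pair t (mul (rep (cls L)) K)"
      using assms t by (simp add: pair_mul T_left)
    also have "\<dots> = pair t (mul L K)"
      using assms t by (simp add: pair_mul_swap T_right)
    finally show ?thesis .
  qed
  then show ?thesis
    by (simp add: quot_def cls_eq_iff)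
qed

lemma quot_zero: "\<zero>\<^bsub>quot\<^esub> = cls []"
  by (simp add: quot_def)

lemma carrier_quot: "carrier quot = cls ` {L. vcomb L}"
  by (simp add: quot_def)

lemma cls_in_quot [simp]: "vcomb L \<Longrightarrow> cls L \<in> carrier quot"
  by (simp add: carrier_quot)

lemma quot_cases: assumes "X \<in> carrier quot" obtains L where "vcomb L" "X = cls L"
  using assms by (auto simp: carrier_quot)

lemma quot_vectorspace: "vectorspace F quot"
proof (intro vs_criteria allI impI ballI; (elim conjE)?)
  show "field F" by (rule field_axioms)
  fix X assume X: "X \<in> carrier quot"
  then obtain L where L: "vcomb L" "X = cls L" by (rule quot_cases)
  show "\<exists>Y\<in>carrier quot. X \<oplus>\<^bsub>quot\<^esub> Y = \<zero>\<^bsub>quot\<^esub>"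
    using L by (intro bexI[of _ "cls (smul (\<ominus> \<one>) L)"])
      (auto simp: quot_add quot_zero cls_eq_iff pair_append pair_smul l_minus r_neg)
qed ((elim quot_cases)?; simp add: quot_add quot_zero quot_smult cls_eq_iff pair_append pair_smul
      a_ac m_ac l_distr r_distr)+

lemma quot_algebra: "nonunital_algebra F quot"
proof -
  interpret vectorspace F quot by (rule quot_vectorspace)
  show ?thesis
    by unfold_locales (elim quot_cases; simp add: quot_add quot_smult quot_mult cls_eq_iff
      pair_append pair_smul pair_mul pair_add_fun pair_smult_fun)+
qed

end

section \<open>Block restrictions and dual systems\<close>

definition bwords :: "nat \<Rightarrow> nat list set" where
  "bwords d = {w. length w \<le> d \<and> set w \<subseteq> {0, 1}}"

lemma finite_bwords [simp]: "finite (bwords d)"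
proof -
  have "bwords d = {w. set w \<subseteq> {0, 1} \<and> length w \<le> d}"
    by (auto simp: bwords_def)
  then show ?thesis
    using finite_lists_length_le[of "{0, 1::nat}" d] by simp
qed

context word_field
begin

definition wfuns_len :: "nat \<Rightarrow> (nat list \<Rightarrow> 'f) set" where
  "wfuns_len s = {h \<in> wfuns. \<forall>w. h w \<noteq> \<zero> \<longrightarrow> length w = s \<and> set w \<subseteq> {0, 1}}"

definition fspace :: "nat \<Rightarrow> (nat list \<Rightarrow> 'f) set \<Rightarrow> bool" where
  "fspace s E \<longleftrightarrow> E \<subseteq> wfuns_len s \<and> (\<lambda>_. \<zero>) \<in> E \<and>
     (\<forall>h\<in>E. \<forall>g\<in>E. (\<lambda>w. h w \<oplus> g w) \<in> E) \<and> (\<forall>c\<in>carrier F. \<forall>h\<in>E. (\<lambda>w. c \<otimes> h w) \<in> E)"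

definition restr :: "nat \<Rightarrow> nat list \<Rightarrow> nat list \<Rightarrow> (nat list \<Rightarrow> 'f) \<Rightarrow> nat list \<Rightarrow> 'f" where
  "restr s u v g = (\<lambda>w. if length w = s then g (u @ w @ v) else \<zero>)"

text \<open>Alignment is imposed on the left only: \<open>h\<close> lives on words of length
  \<open>B\<close>, a multiple of \<open>s\<close>, so a right context of the wrong length merely
  gives the zero restriction.\<close>

definition blocks :: "nat \<Rightarrow> (nat list \<Rightarrow> 'f) set \<Rightarrow> nat \<Rightarrow> (nat list \<Rightarrow> 'f) set \<Rightarrow> bool" where
  "blocks s E B E' \<longleftrightarrow> s dvd B \<and> E' \<subseteq> wfuns_len B \<and>
     (\<forall>h\<in>E'. \<forall>u v. s dvd length u \<longrightarrow> restr s u v h \<in> E)"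

lemma wfuns_lenD: "h \<in> wfuns_len s \<Longrightarrow> h \<in> wfuns"
  "h \<in> wfuns_len s \<Longrightarrow> h w \<noteq> \<zero> \<Longrightarrow> length w = s"
  "h \<in> wfuns_len s \<Longrightarrow> h w \<noteq> \<zero> \<Longrightarrow> set w \<subseteq> {0, 1}"
  unfolding wfuns_len_def by blast+

lemma fspaceD:
  assumes "fspace s E"
  shows "h \<in> E \<Longrightarrow> h \<in> wfuns_len s" "(\<lambda>_. \<zero>) \<in> E"
    "h \<in> E \<Longrightarrow> g \<in> E \<Longrightarrow> (\<lambda>w. h w \<oplus> g w) \<in> E"
    "c \<in> carrier F \<Longrightarrow> h \<in> E \<Longrightarrow> (\<lambda>w. c \<otimes> h w) \<in> E"
  using assms unfolding fspace_def by blast+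

text \<open>Because \<open>s\<close> divides \<open>B\<close>, an aligned block of length
  \<open>s\<close> never straddles two aligned blocks of length \<open>B\<close>: restrict first to
  the large block around it, then inside that block.\<close>

lemma blocks_trans:
  assumes "blocks s E B E'" "blocks B E' C E''" "fspace s E" "s > 0" "B > 0"
  shows "blocks s E C E''"
  unfolding blocks_def
proof (intro conjI ballI allI impI)
  show "s dvd C" using assms(1,2) unfolding blocks_def by (meson dvd_trans)
  show "E'' \<subseteq> wfuns_len C" using assms(2) unfolding blocks_def by blast
  fix h and u v :: "nat list" assume h: "h \<in> E''" and u: "s dvd length u"
  have dv: "s dvd B" "B dvd C" using assms(1,2) unfolding blocks_def by auto
  have hC: "h \<in> wfuns_len C" using h assms(2) unfolding blocks_def by blast
  \<comment> \<open>\<open>q\<close> is the start of the large block that contains the small one,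
    \<open>r\<close> the offset inside it.\<close>
  define q r where "q = length u div B * B" and "r = length u mod B"
  have qr: "length u = q + r" "r < B" "B dvd q" using \<open>B > 0\<close> by (simp_all add: q_def r_def)
  have "s dvd r" using u dv(1) unfolding r_def by (simp add: dvd_mod)
  then have rs: "r + s \<le> B"
    using qr(2) dv(1) by (metis dvd_add_left_iff dvd_diff_nat dvd_imp_le le_diff_conv2 less_imp_le_nat zero_less_diff add.commute)
  define u1 u2 where "u1 = take q u" and "u2 = drop q u"
  have u12: "u = u1 @ u2" "length u1 = q" "length u2 = r" using qr(1) by (simp_all add: u1_def u2_def)
  show "restr s u v h \<in> E"
  \<comment> \<open>If the right context cannot fill up the large block, the total length is not a
    multiple of \<open>B\<close>, hence not \<open>C\<close>, and the restriction vanishes.\<close>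
  proof (cases "length v < B - r - s")
    case True
    have "restr s u v h = (\<lambda>_. \<zero>)"
    proof
      fix w
      show "restr s u v h w = \<zero>"
      proof (rule ccontr)
        assume "restr s u v h w \<noteq> \<zero>"
        then have "length w = s" "h (u @ w @ v) \<noteq> \<zero>" by (auto simp: restr_def split: if_splits)
        then have "length (u @ w @ v) = C" using hC wfuns_lenD(2) by blast
        then have "q + (r + s + length v) = C" using \<open>length w = s\<close> qr by simp
        then have "B dvd r + s + length v" using dvd_add_right_iff[OF qr(3), of "r + s + length v"] dv(2) by simp
        moreover have "0 < r + s + length v" "r + s + length v < B" using True \<open>s > 0\<close> by linarith+
        ultimately show False using nat_dvd_not_less[of "r + s + length v" B] by simp
      qed
    qed
    then show ?thesis using fspaceD(2)[OF assms(3)] by simp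
  next
    case False
    define v1 v2 where "v1 = take (B - r - s) v" and "v2 = drop (B - r - s) v"
    have v12: "v = v1 @ v2" "length v1 = B - r - s" using False by (simp_all add: v1_def v2_def)
    have "restr B u1 v2 h \<in> E'"
      using assms(2) h u12(2) qr(3) unfolding blocks_def by blast
    then have "restr s u2 v1 (restr B u1 v2 h) \<in> E"
      using assms(1) u12(3) \<open>s dvd r\<close> unfolding blocks_def by blast
    moreover have "restr s u2 v1 (restr B u1 v2 h) = restr s u v h"
      using u12 v12 rs by (intro ext) (auto simp: restr_def)
    ultimately show ?thesis by simp
  qed
qed

text \<open>A dual system certifies that the words in \<open>W\<close> are linearly independent functionals on \<open>E\<close>.\<close>

definition dual :: "(nat list \<Rightarrow> 'f) set \<Rightarrow> nat list set \<Rightarrow> (nat list \<Rightarrow> nat list \<Rightarrow> 'f) \<Rightarrow> bool" where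
  "dual E W g \<longleftrightarrow> finite W \<and> (\<forall>w\<in>W. g w \<in> E) \<and>
     (\<forall>w\<in>W. \<forall>v\<in>W. g w v = (if v = w then \<one> else \<zero>))"

definition linfun :: "(nat list \<Rightarrow> 'f) set \<Rightarrow> ((nat list \<Rightarrow> 'f) \<Rightarrow> 'f) \<Rightarrow> bool" where
  "linfun E \<rho> \<longleftrightarrow> (\<forall>h\<in>E. \<rho> h \<in> carrier F) \<and> (\<forall>h\<in>E. \<forall>g\<in>E. \<rho> (\<lambda>w. h w \<oplus> g w) = \<rho> h \<oplus> \<rho> g) \<and>
     (\<forall>c\<in>carrier F. \<forall>h\<in>E. \<rho> (\<lambda>w. c \<otimes> h w) = c \<otimes> \<rho> h)"

text \<open>Gaussian elimination, one functional at a time: a word \<open>w0\<close> whose dual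
  vector is not annihilated serves as pivot, the other dual vectors are corrected by multiples of
  that vector, and \<open>w0\<close> is given up. Each relation costs at most one word.\<close>

lemma dual_kernel:
  assumes "finite P" "fspace s E" "dual E W g" "\<forall>\<rho>\<in>P. linfun E \<rho>"
  shows "\<exists>W' g'. dual {h \<in> E. \<forall>\<rho>\<in>P. \<rho> h = \<zero>} W' g' \<and> card W \<le> card W' + card P"
  using assms(1,4)
proof (induction P rule: finite_induct)
  case empty
  then show ?case using assms(3) by (intro exI[of _ W] exI[of _ g]) simp
next
  case (insert \<rho> P)
  then obtain W' g' where IH: "dual {h \<in> E. \<forall>\<rho>\<in>P. \<rho> h = \<zero>} W' g'" "card W \<le> card W' + card P"
    by auto
  have g': "finite W'" "\<And>w. w \<in> W' \<Longrightarrow> g' w \<in> E" "\<And>w \<rho>. w \<in> W' \<Longrightarrow> \<rho> \<in> P \<Longrightarrow> \<rho> (g' w) = \<zero>"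
    "\<And>w v. w \<in> W' \<Longrightarrow> v \<in> W' \<Longrightarrow> g' w v = (if v = w then \<one> else \<zero>)"
    using IH(1) unfolding dual_def by blast+
  have lin: "\<And>h. h \<in> E \<Longrightarrow> \<sigma> h \<in> carrier F"
    "\<And>h g. h \<in> E \<Longrightarrow> g \<in> E \<Longrightarrow> \<sigma> (\<lambda>w. h w \<oplus> g w) = \<sigma> h \<oplus> \<sigma> g"
    "\<And>c h. c \<in> carrier F \<Longrightarrow> h \<in> E \<Longrightarrow> \<sigma> (\<lambda>w. c \<otimes> h w) = c \<otimes> \<sigma> h"
    if "\<sigma> = \<rho> \<or> \<sigma> \<in> P" for \<sigma>
    using insert.prems that unfolding linfun_def by blast+
  show ?case
  proof (cases "\<forall>w\<in>W'. \<rho> (g' w) = \<zero>")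
    case True
    then have "dual {h \<in> E. \<forall>\<rho>\<in>insert \<rho> P. \<rho> h = \<zero>} W' g'"
      using g' unfolding dual_def by auto
    moreover have "card W \<le> card W' + card (insert \<rho> P)" using IH(2) insert.hyps by simp
    ultimately show ?thesis by blast
  next
    case False
    then obtain w0 where w0: "w0 \<in> W'" "\<rho> (g' w0) \<noteq> \<zero>" by blast
    have u: "\<rho> (g' w0) \<in> Units F" using w0 g'(2) lin(1)[of \<rho>] by (simp add: field_Units)
    define c where "c w = \<ominus> (\<rho> (g' w) \<otimes> inv (\<rho> (g' w0)))" for w
    have c: "c w \<in> carrier F" if "w \<in> W'" for w
      using that g'(2) lin(1)[of \<rho>] u by (simp add: c_def)
    define g'' where "g'' w = (\<lambda>v. g' w v \<oplus> c w \<otimes> g' w0 v)" for w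
    have gE: "g'' w \<in> E" if "w \<in> W'" for w
      unfolding g''_def using that g'(2) c w0 fspaceD(3,4)[OF assms(2)] by simp
    have lg: "\<sigma> (g'' w) = \<sigma> (g' w) \<oplus> c w \<otimes> \<sigma> (g' w0)" if "w \<in> W'" "\<sigma> = \<rho> \<or> \<sigma> \<in> P" for w \<sigma>
      unfolding g''_def using that g'(2) c w0 fspaceD(4)[OF assms(2)] lin(2,3)[OF that(2)] by simp
    have "\<rho> (g'' w) = \<zero>" if w: "w \<in> W'" for w
    proof -
      have m: "\<rho> (g' w) \<in> carrier F" "\<rho> (g' w0) \<in> carrier F" "inv (\<rho> (g' w0)) \<in> carrier F"
        using g'(2) lin(1)[of \<rho>] w w0 u by simp_all
      have "c w \<otimes> \<rho> (g' w0) = \<ominus> (\<rho> (g' w) \<otimes> (inv (\<rho> (g' w0)) \<otimes> \<rho> (g' w0)))"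
        using m by (simp add: c_def l_minus m_assoc)
      also have "\<dots> = \<ominus> \<rho> (g' w)" using m u by simp
      finally show ?thesis using lg[OF w, of \<rho>] m by (simp add: r_neg)
    qed
    moreover have "\<sigma> (g'' w) = \<zero>" if "w \<in> W'" "\<sigma> \<in> P" for w \<sigma>
      using lg[OF that(1), of \<sigma>] g'(3)[OF that] g'(3)[OF w0(1) that(2)] c[OF that(1)] that(2) by simp
    \<comment> \<open>The correction leaves biorthogonality intact because \<open>g' w0\<close>
      vanishes on every word of \<open>W'\<close> other than \<open>w0\<close>.\<close>
    moreover have "g'' w v = (if v = w then \<one> else \<zero>)" if "w \<in> W' - {w0}" "v \<in> W' - {w0}" for w v
      using that g'(4) w0(1) c by (simp add: g''_def)
    ultimately have "dual {h \<in> E. \<forall>\<rho>\<in>insert \<rho> P. \<rho> h = \<zero>} (W' - {w0}) g''"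
      using g'(1) gE unfolding dual_def by blast
    moreover have "card W \<le> card (W' - {w0}) + card (insert \<rho> P)"
      using IH(2) insert.hyps w0(1) g'(1) by simp
    ultimately show ?thesis by blast
  qed
qed

section \<open>Elementary tensors and block powers\<close>

primrec tens :: "nat \<Rightarrow> (nat list \<Rightarrow> 'f) list \<Rightarrow> nat list \<Rightarrow> 'f" where
  "tens s [] w = (if w = [] then \<one> else \<zero>)"
| "tens s (t # ts) w = t (take s w) \<otimes> tens s ts (drop s w)"

lemma tens_closed: "set ts \<subseteq> wfuns \<Longrightarrow> tens s ts w \<in> carrier F"
  by (induction ts arbitrary: w) auto

lemma tens_wfuns: "set ts \<subseteq> wfuns \<Longrightarrow> tens s ts \<in> wfuns"
  by (simp add: wfunI tens_closed)

lemma tens_append: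
  "set ts \<subseteq> wfuns \<Longrightarrow> set ts' \<subseteq> wfuns \<Longrightarrow> length u = s * length ts \<Longrightarrow>
    tens s (ts @ ts') (u @ w) = tens s ts u \<otimes> tens s ts' w"
  by (induction ts arbitrary: u) (auto simp: tens_closed m_assoc)

text \<open>The empty product is supported on the empty word, so the factors must consume the whole
  word; truncated blocks are excluded by the supports of the factors.\<close>

lemma tens_nonzero:
  assumes "set ts \<subseteq> wfuns_len s" "tens s ts w \<noteq> \<zero>"
  shows "length w = s * length ts \<and> set w \<subseteq> {0, 1}"
  using assms
proof (induction ts arbitrary: w)
  case Nil
  then show ?case by (auto split: if_splits)
next
  case (Cons t ts)
  have c: "t \<in> wfuns" "set ts \<subseteq> wfuns" using Cons.prems(1) wfuns_lenD(1) by auto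
  have n: "t (take s w) \<noteq> \<zero>" "tens s ts (drop s w) \<noteq> \<zero>"
    using Cons.prems(2) c by (auto simp: tens_closed)
  have "length (take s w) = s" "set (take s w) \<subseteq> {0, 1}"
    using n(1) Cons.prems(1) wfuns_lenD(2,3) by (meson list.set_intros(1) subsetD)+
  moreover have "length (drop s w) = s * length ts \<and> set (drop s w) \<subseteq> {0, 1}"
    using Cons.IH[OF _ n(2)] Cons.prems(1) by simp
  ultimately have "length (take s w @ drop s w) = s * length (t # ts) \<and> set (take s w @ drop s w) \<subseteq> {0, 1}"
    by (simp del: append_take_drop_id length_take length_drop)
  then show ?case by simp
qed

lemma tens_wfuns_len:
  assumes "set ts \<subseteq> wfuns_len s" shows "tens s ts \<in> wfuns_len (s * length ts)"
proof -
  have "set ts \<subseteq> wfuns" using assms wfuns_lenD(1) by blast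
  then show ?thesis
    using tens_nonzero[OF assms] tens_wfuns unfolding wfuns_len_def by blast
qed

text \<open>The length of \<open>x\<close> is left open, since both sides vanish if it is wrong. So
  a functional of the middle word factors uniformly, whatever word is inserted.\<close>

lemma tens_append3:
  assumes "set ts1 \<subseteq> wfuns_len s" "set ts2 \<subseteq> wfuns_len s" "set ts3 \<subseteq> wfuns_len s"
    "length u = s * length ts1" "length v = s * length ts3"
  shows "tens s (ts1 @ ts2 @ ts3) (u @ x @ v) = tens s ts1 u \<otimes> tens s ts2 x \<otimes> tens s ts3 v"
proof -
  have w: "set ts1 \<subseteq> wfuns" "set ts2 \<subseteq> wfuns" "set ts3 \<subseteq> wfuns"
    using assms(1-3) wfuns_lenD(1) by blast+
  have 1: "tens s (ts1 @ ts2 @ ts3) (u @ x @ v) = tens s ts1 u \<otimes> tens s (ts2 @ ts3) (x @ v)"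
    using w assms(4) by (simp add: tens_append)
  show ?thesis
  proof (cases "length x = s * length ts2")
    case True
    then show ?thesis using 1 w by (simp add: tens_append tens_closed m_assoc)
  next
    case False
    have "tens s ts2 x = \<zero>" using False tens_nonzero[OF assms(2)] by blast
    moreover have "tens s (ts2 @ ts3) (x @ v) = \<zero>"
      using False tens_nonzero[of "ts2 @ ts3" s "x @ v"] assms(2,3,5) by (auto simp: algebra_simps)
    ultimately show ?thesis using 1 w by (simp add: tens_closed)
  qed
qed

text \<open>Fixing all slots but one turns an elementary tensor into a scalar multiple of the
  remaining factor; a left context that leaves no slot gives zero.\<close>

lemma restr_tens:
  assumes "fspace s E" "set ts \<subseteq> E" "s dvd length u" "s > 0"
  shows "restr s u v (tens s ts) \<in> E"
proof -
  obtain i where i: "length u = s * i" using assms(3) by (auto elim: dvdE)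
  have E: "set ts \<subseteq> wfuns_len s" using assms(2) fspaceD(1)[OF assms(1)] by blast
  show ?thesis
  proof (cases "i < length ts")
    case True
    define c where "c = tens s (take i ts) u \<otimes> tens s (drop (Suc i) ts) v"
    have ts: "ts = take i ts @ [ts ! i] @ drop (Suc i) ts" using True by (simp add: id_take_nth_drop)
    have sub: "set (take i ts) \<subseteq> wfuns_len s" "set (drop (Suc i) ts) \<subseteq> wfuns_len s" "ts ! i \<in> E"
      using E assms(2) True set_take_subset[of i ts] set_drop_subset[of "Suc i" ts] nth_mem[OF True] by auto
    have tc: "set (take i ts) \<subseteq> wfuns" "set (drop (Suc i) ts) \<subseteq> wfuns" "ts ! i \<in> wfuns"
      using sub fspaceD(1)[OF assms(1)] wfuns_lenD(1) by blast+
    then have c: "c \<in> carrier F" by (simp add: c_def tens_closed)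
    have "restr s u v (tens s ts) = (\<lambda>w. c \<otimes> (ts ! i) w)"
    proof
      fix w
      show "restr s u v (tens s ts) w = c \<otimes> (ts ! i) w"
      proof (cases "length w = s")
        case True
        have "tens s ts (u @ w @ v) = tens s (take i ts) u \<otimes> (tens s ([ts ! i] @ drop (Suc i) ts) (w @ v))"
          using tc i \<open>i < length ts\<close> by (subst ts, subst tens_append) auto
        also have "\<dots> = c \<otimes> (ts ! i) w"
          using tc True by (simp add: c_def tens_closed m_ac)
        finally show ?thesis using True by (simp add: restr_def)
      next
        case False
        then have "(ts ! i) w = \<zero>" using sub(3) fspaceD(1)[OF assms(1)] wfuns_lenD(2) by blast
        then show ?thesis using False c by (simp add: restr_def)
      qed
    qed
    then show ?thesis using fspaceD(4)[OF assms(1) c sub(3)] by simp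
  next
    case False
    have "restr s u v (tens s ts) = (\<lambda>_. \<zero>)"
    proof
      fix w
      show "restr s u v (tens s ts) w = \<zero>"
      proof (rule ccontr)
        assume "restr s u v (tens s ts) w \<noteq> \<zero>"
        then have "length w = s" "tens s ts (u @ w @ v) \<noteq> \<zero>" by (auto simp: restr_def split: if_splits)
        then have "s * i + s + length v = s * length ts" using tens_nonzero[OF E] i by fastforce
        moreover have "s * length ts \<le> s * i" using False by simp
        ultimately show False using assms(4) by linarith
      qed
    qed
    then show ?thesis using fspaceD(2)[OF assms(1)] by simp
  qed
qed

text \<open>For a linear space \<open>E\<close> and \<open>s > 0\<close> this is the
  \<open>m\<close>-th tensor power of \<open>E\<close>, described slot by slot: a tensor lies in the
  power if and only if each of its slots takes values in \<open>E\<close>. In this form linearity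
  and the block condition are immediate.\<close>

definition bpow :: "nat \<Rightarrow> (nat list \<Rightarrow> 'f) set \<Rightarrow> nat \<Rightarrow> (nat list \<Rightarrow> 'f) set" where
  "bpow s E m = {h \<in> wfuns_len (s * m). \<forall>u v. s dvd length u \<longrightarrow> restr s u v h \<in> E}"

lemma wfuns_lenI:
  "h \<in> wfuns \<Longrightarrow> (\<And>w. \<not> (length w = s \<and> set w \<subseteq> {0, 1}) \<Longrightarrow> h w = \<zero>) \<Longrightarrow> h \<in> wfuns_len s"
  unfolding wfuns_len_def by blast

lemma wfuns_len_out: "h \<in> wfuns_len s \<Longrightarrow> \<not> (length w = s \<and> set w \<subseteq> {0, 1}) \<Longrightarrow> h w = \<zero>"
  unfolding wfuns_len_def by blast

lemma wfuns_len_add: "h \<in> wfuns_len s \<Longrightarrow> g \<in> wfuns_len s \<Longrightarrow> (\<lambda>w. h w \<oplus> g w) \<in> wfuns_len s"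
  by (rule wfuns_lenI) (simp_all add: wfuns_lenD(1) wfuns_len_out)

lemma wfuns_len_smult: "c \<in> carrier F \<Longrightarrow> g \<in> wfuns_len s \<Longrightarrow> (\<lambda>w. c \<otimes> g w) \<in> wfuns_len s"
  by (rule wfuns_lenI) (simp_all add: wfuns_lenD(1) wfuns_len_out)

lemma wfuns_len_zero: "(\<lambda>_. \<zero>) \<in> wfuns_len s"
  by (rule wfuns_lenI) (simp_all add: wfunI)

lemma fspace_bpow:
  assumes "fspace s E" shows "fspace (s * m) (bpow s E m)"
proof -
  have "restr s u v (\<lambda>_. \<zero>) = (\<lambda>_. \<zero>)" for u v by (auto simp: restr_def)
  moreover have "restr s u v (\<lambda>w. h w \<oplus> g w) = (\<lambda>w. restr s u v h w \<oplus> restr s u v g w)" for u v h g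
    by (auto simp: restr_def)
  moreover have "restr s u v (\<lambda>w. c \<otimes> g w) = (\<lambda>w. c \<otimes> restr s u v g w)" if "c \<in> carrier F" for u v c g
    using that by (auto simp: restr_def)
  ultimately show ?thesis
    using fspaceD(2-)[OF assms] wfuns_len_add wfuns_len_smult wfuns_len_zero
    unfolding fspace_def[of "s * m"] bpow_def by auto
qed

lemma blocks_bpow: "E' \<subseteq> bpow s E m \<Longrightarrow> blocks s E (s * m) E'"
  unfolding blocks_def bpow_def by auto

lemma tens_bpow:
  assumes "fspace s E" "set ts \<subseteq> E" "s > 0"
  shows "tens s ts \<in> bpow s E (length ts)"
  using tens_wfuns_len[of ts s] restr_tens[OF assms(1,2)] assms fspaceD(1)[OF assms(1)]
  unfolding bpow_def by blast

lemma dual_length: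
  assumes "fspace s E" "dual E W g" "w \<in> W"
  shows "length w = s" "set w \<subseteq> {0, 1}" "g w \<in> wfuns_len s"
proof -
  have "g w \<in> wfuns_len s" "g w w \<noteq> \<zero>"
    using assms fspaceD(1)[OF assms(1)] unfolding dual_def by auto
  then show "length w = s" "set w \<subseteq> {0, 1}" "g w \<in> wfuns_len s" using wfuns_lenD by blast+
qed

text \<open>Biorthogonality multiplies over slots: concatenations of words from \<open>W\<close> are
  dual to tensors of their dual vectors. This is the source of exponential growth.\<close>

lemma dual_bpow:
  assumes "fspace s E" "dual E W g" "s > 0"
  shows "\<exists>W' g'. dual (bpow s E m) W' g' \<and> card W' = card W ^ m"
proof -
  define X where "X = {\<sigma>. set \<sigma> \<subseteq> W \<and> length \<sigma> = m}"
  have fin: "finite W" using assms(2) by (simp add: dual_def)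
  have len: "\<forall>w\<in>W. length w = s" using dual_length(1)[OF assms(1,2)] by blast
  have ev: "tens s (map g \<sigma>) (concat \<tau>) = (if \<tau> = \<sigma> then \<one> else \<zero>)"
    if "set \<sigma> \<subseteq> W" "set \<tau> \<subseteq> W" "length \<tau> = length \<sigma>" for \<sigma> \<tau>
    using that
  proof (induction \<sigma> arbitrary: \<tau>)
    case (Cons w \<sigma>)
    then obtain v \<tau>' where \<tau>: "\<tau> = v # \<tau>'" by (cases \<tau>) auto
    have "length v = s" "g w v = (if v = w then \<one> else \<zero>)"
      using Cons.prems \<tau> len assms(2) unfolding dual_def by auto
    then show ?case using Cons \<tau> by auto
  qed auto
  have inj: "inj_on concat X"
  proof (rule inj_onI)
    fix \<sigma> \<tau> assume *: "\<sigma> \<in> X" "\<tau> \<in> X" "concat \<sigma> = concat \<tau>"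
    have "tens s (map g \<sigma>) (concat \<tau>) = \<one>" using ev[of \<sigma> \<sigma>] * by (auto simp: X_def)
    then show "\<sigma> = \<tau>" using ev[of \<sigma> \<tau>] * by (auto simp: X_def split: if_splits)
  qed
  define g' where "g' w = tens s (map g (the_inv_into X concat w))" for w
  have g': "g' (concat \<sigma>) = tens s (map g \<sigma>)" if "\<sigma> \<in> X" for \<sigma>
    using the_inv_into_f_f[OF inj that] by (simp add: g'_def)
  have "dual (bpow s E m) (concat ` X) g'"
    unfolding dual_def
  proof (intro conjI ballI)
    show "finite (concat ` X)" using fin by (auto simp: X_def intro: finite_lists_length_eq)
    fix w assume "w \<in> concat ` X"
    then obtain \<sigma> where \<sigma>: "\<sigma> \<in> X" "w = concat \<sigma>" by blast
    have "set (map g \<sigma>) \<subseteq> E" using \<sigma> assms(2) by (auto simp: X_def dual_def)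
    then show "g' w \<in> bpow s E m"
      using tens_bpow[OF assms(1) _ assms(3), of "map g \<sigma>"] \<sigma> g' by (auto simp: X_def)
    fix v assume "v \<in> concat ` X"
    then obtain \<tau> where \<tau>: "\<tau> \<in> X" "v = concat \<tau>" by blast
    show "g' w v = (if v = w then \<one> else \<zero>)"
      using ev[of \<sigma> \<tau>] \<sigma> \<tau> g' inj_onD[OF inj] by (auto simp: X_def)
  qed
  moreover have "card (concat ` X) = card W ^ m"
    using card_image[OF inj] card_lists_length_eq[OF fin, of m] by (simp add: X_def)
  ultimately show ?thesis by blast
qed

end

section \<open>Padding\<close>

context word_field
begin

lemma tens_add_last:
  assumes "set ts \<subseteq> wfuns" "e \<in> wfuns" "e' \<in> wfuns"
  shows "tens s (ts @ [\<lambda>w. e w \<oplus> e' w]) w = tens s (ts @ [e]) w \<oplus> tens s (ts @ [e']) w"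
  using assms by (induction ts arbitrary: w) (auto simp: tens_closed r_distr)

lemma tens_smult_last:
  assumes "set ts \<subseteq> wfuns" "e \<in> wfuns" "c \<in> carrier F"
  shows "tens s (ts @ [\<lambda>w. c \<otimes> e w]) w = c \<otimes> tens s (ts @ [e]) w"
  using assms by (induction ts arbitrary: w) (auto simp: tens_closed m_ac)

text \<open>With all slots but the last fixed, this is a linear image of \<open>E\<close> and not a
  tensor power: the length grows and the dimension does not.\<close>

definition padded :: "nat \<Rightarrow> (nat list \<Rightarrow> 'f) set \<Rightarrow> nat \<Rightarrow> (nat list \<Rightarrow> 'f) \<Rightarrow> (nat list \<Rightarrow> 'f) set" where
  "padded s E m \<xi> = (\<lambda>e. tens s (replicate m \<xi> @ [e])) ` E"

lemma padded_subset_bpow: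
  assumes "fspace s E" "\<xi> \<in> E" "s > 0"
  shows "padded s E m \<xi> \<subseteq> bpow s E (Suc m)"
proof
  fix h assume "h \<in> padded s E m \<xi>"
  then obtain e where e: "e \<in> E" "h = tens s (replicate m \<xi> @ [e])" by (auto simp: padded_def)
  have "set (replicate m \<xi> @ [e]) \<subseteq> E" using assms e by auto
  from tens_bpow[OF assms(1) this assms(3)] show "h \<in> bpow s E (Suc m)" using e by simp
qed

lemma fspace_padded:
  assumes "fspace s E" "\<xi> \<in> E" "s > 0"
  shows "fspace (s * Suc m) (padded s E m \<xi>)"
proof -
  have Ew: "h \<in> E \<Longrightarrow> h \<in> wfuns" for h using fspaceD(1)[OF assms(1)] wfuns_lenD(1) by blast
  have ts: "set (replicate m \<xi>) \<subseteq> wfuns" using Ew assms(2) by auto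
  have add: "(\<lambda>w. h w \<oplus> g w) \<in> padded s E m \<xi>" if hg: "h \<in> padded s E m \<xi>" "g \<in> padded s E m \<xi>" for h g
  proof -
    obtain e e' where "e \<in> E" "e' \<in> E" "h = tens s (replicate m \<xi> @ [e])" "g = tens s (replicate m \<xi> @ [e'])"
      using hg by (auto simp: padded_def)
    then show ?thesis
      unfolding padded_def using tens_add_last[OF ts Ew Ew, of e e' s] fspaceD(3)[OF assms(1), of e e']
      by (intro image_eqI[of _ _ "\<lambda>w. e w \<oplus> e' w"]) auto
  qed
  have smult: "(\<lambda>w. c \<otimes> h w) \<in> padded s E m \<xi>" if hg: "h \<in> padded s E m \<xi>" "c \<in> carrier F" for h c
  proof -
    obtain e where "e \<in> E" "h = tens s (replicate m \<xi> @ [e])"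
      using hg by (auto simp: padded_def)
    then show ?thesis
      unfolding padded_def using tens_smult_last[OF ts Ew hg(2), of e s] fspaceD(4)[OF assms(1) hg(2), of e]
      by (intro image_eqI[of _ _ "\<lambda>w. c \<otimes> e w"]) auto
  qed
  have zero: "(\<lambda>_. \<zero>) \<in> padded s E m \<xi>"
  proof -
    obtain h where h: "h \<in> padded s E m \<xi>" using assms(2) by (auto simp: padded_def)
    then have "h \<in> wfuns" using padded_subset_bpow[OF assms] wfuns_lenD(1) unfolding bpow_def by blast
    then have "(\<lambda>w. \<zero> \<otimes> h w) = (\<lambda>_. \<zero>)" by simp
    then show ?thesis using smult[OF h zero_closed] by simp
  qed
  have "padded s E m \<xi> \<subseteq> wfuns_len (s * Suc m)"
    using padded_subset_bpow[OF assms] unfolding bpow_def by blast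
  then show ?thesis unfolding fspace_def using add smult zero by blast
qed

lemma tens_replicate_one:
  assumes "\<xi> w0 = \<one>" "length w0 = s"
  shows "tens s (replicate m \<xi>) (concat (replicate m w0)) = \<one>"
  using assms by (induction m) auto

lemma length_concat_replicate: "length (concat (replicate m w)) = length w * m"
  by (induction m) auto

text \<open>The fixed slots contribute the factor one on the prefix made of \<open>m\<close> copies
  of \<open>w0\<close>, so prefixing every word of \<open>W\<close> by it transports the dual system
  without loss.\<close>

lemma dual_padded:
  assumes "fspace s E" "dual E W g" "s > 0" "w0 \<in> W"
  shows "\<exists>W' g'. dual (padded s E m (g w0)) W' g' \<and> card W' = card W"
proof -
  define p where "p = concat (replicate m w0)"
  have w0: "length w0 = s" "g w0 \<in> wfuns_len s" "g w0 w0 = \<one>"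
    using dual_length(1,3)[OF assms(1,2,4)] assms(2,4) unfolding dual_def by auto
  have p: "length p = s * m" using w0 by (simp add: p_def length_concat_replicate)
  define g' where "g' w = tens s (replicate m (g w0) @ [g (drop (s * m) w)])" for w
  have w: "set (replicate m (g w0)) \<subseteq> wfuns" using w0(2) wfuns_lenD(1) by auto
  have "dual (padded s E m (g w0)) ((@) p ` W) g'"
    unfolding dual_def
  proof (intro conjI ballI)
    show "finite ((@) p ` W)" using assms(2) unfolding dual_def by blast
    fix x assume "x \<in> (@) p ` W"
    then obtain w where w: "w \<in> W" "x = p @ w" by blast
    then show "g' x \<in> padded s E m (g w0)" using assms(2) p unfolding padded_def g'_def dual_def by auto
    fix y assume "y \<in> (@) p ` W"
    then obtain v where v: "v \<in> W" "y = p @ v" by blast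
    have gw: "g w \<in> wfuns" "length v = s" "g w v = (if v = w then \<one> else \<zero>)"
      using dual_length[OF assms(1,2)] assms(2) w v wfuns_lenD(1) unfolding dual_def by blast+
    have "g' x y = tens s (replicate m (g w0)) p \<otimes> tens s [g w] v"
      unfolding g'_def using w(2) v p gw(1) \<open>set (replicate m (g w0)) \<subseteq> wfuns\<close>
      by (simp add: tens_append del: tens.simps)
    also have "\<dots> = g w v" using gw w0 by (simp add: p_def tens_replicate_one)
    finally show "g' x y = (if y = x then \<one> else \<zero>)" using gw w v by simp
  qed
  moreover have "card ((@) p ` W) = card W" by (intro card_image inj_onI) simp
  ultimately show ?thesis by blast
qed

text \<open>The prefix enters only through a scalar. Normalising at the prefix of copies of
  \<open>w0\<close>, where this scalar is one, expresses the unknown last factor by values of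
  \<open>h\<close> itself.\<close>

lemma padded_split:
  assumes "fspace s E" "\<xi> \<in> E" "\<xi> w0 = \<one>" "length w0 = s" "h \<in> padded s E m \<xi>" "length a = s * m" "length z = s"
  shows "h (a @ z) = tens s (replicate m \<xi>) a \<otimes> h (concat (replicate m w0) @ z)"
proof -
  obtain e where e: "e \<in> E" "h = tens s (replicate m \<xi> @ [e])" using assms(5) by (auto simp: padded_def)
  have w: "\<xi> \<in> wfuns" "e \<in> wfuns" using assms(1,2) e(1) fspaceD(1) wfuns_lenD(1) by blast+
  then have ts: "set (replicate m \<xi>) \<subseteq> wfuns" by auto
  have "h (b @ z) = tens s (replicate m \<xi>) b \<otimes> e z" if "length b = s * m" for b
    using e w ts assms(7) that by (simp add: tens_append)
  then show ?thesis
    using assms w ts tens_replicate_one[of \<xi> w0 s m, OF assms(3,4)]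
    by (simp add: length_concat_replicate tens_closed)
qed

section \<open>Functionals seen through a short window\<close>

definition delta :: "nat list \<Rightarrow> nat list \<Rightarrow> 'f" where
  "delta z = (\<lambda>w. if w = z then \<one> else \<zero>)"

lemma delta_wfuns_len: "z \<in> bwords s \<Longrightarrow> length z = s \<Longrightarrow> delta z \<in> wfuns_len s"
  by (rule wfuns_lenI) (auto simp: delta_def bwords_def intro: wfunI)

text \<open>Two padded blocks, because a window no longer than one such block meets at most two
  consecutive aligned ones. Point masses in the free slots span all possible last factors.\<close>

definition double_padded :: "nat \<Rightarrow> (nat list \<Rightarrow> 'f) \<Rightarrow> nat list \<Rightarrow> nat list \<Rightarrow> (nat list \<Rightarrow> 'f) list" where
  "double_padded m \<xi> z z' = replicate m \<xi> @ delta z # replicate m \<xi> @ [delta z']"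

text \<open>\<open>q\<close> and \<open>k\<close> select the run of slots that the window meets,
  \<open>u\<close> and \<open>v\<close> are the parts of its outer slots that lie outside the
  window. Only the ranges of \<open>q\<close> and \<open>k\<close> depend on \<open>m\<close>, which
  makes the number of functionals quadratic in \<open>m\<close>.\<close>

definition window_funs :: "nat \<Rightarrow> nat \<Rightarrow> (nat list \<Rightarrow> 'f) \<Rightarrow> (nat list \<Rightarrow> 'f) set" where
  "window_funs s m \<xi> = (\<lambda>(q, k, z, z', u, v) w.
       tens s (take k (drop q (double_padded m \<xi> z z'))) (u @ w @ v)) `
     ({..2 * Suc m} \<times> {..2 * Suc m} \<times> {z \<in> bwords s. length z = s} \<times> {z \<in> bwords s. length z = s} \<times>
      bwords s \<times> bwords s)"

lemma finite_window_funs: "finite (window_funs s m \<xi>)"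
  unfolding window_funs_def by simp

lemma card_window_funs: "card (window_funs s m \<xi>) \<le> (2 * m + 3) ^ 2 * card (bwords s) ^ 4"
proof -
  let ?Z = "{z \<in> bwords s. length z = s}"
  have Suc: "Suc (2 * Suc m) = 2 * m + 3" by simp
  have "card (window_funs s m \<xi>) \<le> card ({..2 * Suc m} \<times> {..2 * Suc m} \<times> ?Z \<times> ?Z \<times> bwords s \<times> bwords s)"
    unfolding window_funs_def by (rule card_image_le) simp
  also have "\<dots> = (2 * m + 3) * ((2 * m + 3) * (card ?Z * (card ?Z * (card (bwords s) * card (bwords s)))))"
    by (simp only: card_cartesian_product card_atMost Suc)
  also have "\<dots> \<le> (2 * m + 3) * ((2 * m + 3) * (card (bwords s) * (card (bwords s) * (card (bwords s) * card (bwords s)))))"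
    by (intro mult_le_mono le_refl card_mono) auto
  also have "\<dots> = (2 * m + 3) ^ 2 * card (bwords s) ^ 4"
    by (simp only: power2_eq_square power4_eq_xxxx mult.assoc)
  finally show ?thesis .
qed

lemma window_funs_wfuns:
  assumes "\<xi> \<in> wfuns_len s" shows "window_funs s m \<xi> \<subseteq> wfuns"
proof -
  have "tens s (take k (drop q (double_padded m \<xi> z z'))) (u @ w @ v) \<in> carrier F" for k q z z' u v w
  proof (rule tens_closed)
    have "set (double_padded m \<xi> z z') \<subseteq> wfuns"
      using assms wfuns_lenD(1) by (auto simp: double_padded_def delta_def intro: wfunI)
    then show "set (take k (drop q (double_padded m \<xi> z z'))) \<subseteq> wfuns"
      by (meson order_trans set_drop_subset set_take_subset)
  qed
  then show ?thesis unfolding window_funs_def by (auto intro!: wfunI)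
qed

text \<open>A function with all blocks in \<^const>\<open>padded\<close> has rank one in all but two of the small
  blocks that a window of length at most \<open>s * Suc m\<close> can meet. So the window functionals
  span a space whose dimension is polynomial in \<open>m\<close>.\<close>

lemma window_decompose:
  assumes E: "fspace s E" "\<xi> \<in> E" "\<xi> w0 = \<one>" "length w0 = s" "s > 0"
    and g: "g \<in> wfuns_len B" "\<forall>u v. s * Suc m dvd length u \<longrightarrow> restr (s * Suc m) u v g \<in> padded s E m \<xi>"
    and u0: "s * Suc m dvd length u0" "length u0 + 2 * (s * Suc m) + length v0 = B"
      "s * Suc m dvd length v0"
  shows "\<exists>H. (\<forall>z z'. H (z, z') \<in> carrier F) \<and> (\<forall>W. length W = 2 * (s * Suc m) \<longrightarrow>
    g (u0 @ W @ v0) = (\<Oplus>p\<in>{z \<in> bwords s. length z = s} \<times> {z \<in> bwords s. length z = s}.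
       H p \<otimes> tens s (double_padded m \<xi> (fst p) (snd p)) W))"
proof -
  define p where "p = concat (replicate m w0)"
  define \<Xi> where "\<Xi> = tens s (replicate m \<xi>)"
  \<comment> \<open>The coefficients are the values of \<open>g\<close> after both padding prefixes
    have been replaced by the reference prefix \<open>p\<close>.\<close>
  define H where "H = (\<lambda>(z, z'). g (u0 @ p @ z @ p @ z' @ v0))"
  let ?Z = "{z \<in> bwords s. length z = s}"
  have gw: "g \<in> wfuns" using g(1) wfuns_lenD(1) by blast
  have \<xi>w: "\<xi> \<in> wfuns_len s" "\<xi> \<in> wfuns" using E fspaceD(1) wfuns_lenD(1) by blast+
  have ts: "set (replicate m \<xi>) \<subseteq> wfuns" using \<xi>w by auto
  have \<Xi>c: "\<Xi> a \<in> carrier F" for a using tens_closed[OF ts] by (simp add: \<Xi>_def)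
  have lp: "length p = s * m" using E(4) by (simp add: p_def length_concat_replicate)
  have Hc: "H q \<in> carrier F" for q using gw by (cases q) (simp add: H_def)
  have main: "g (u0 @ W @ v0) = (\<Oplus>q\<in>?Z \<times> ?Z. H q \<otimes> tens s (double_padded m \<xi> (fst q) (snd q)) W)"
    if W: "length W = 2 * (s * Suc m)" for W
  proof -
    define a where "a = take (s * m) W"
    define z where "z = take s (drop (s * m) W)"
    define a' where "a' = take (s * m) (drop (s * Suc m) W)"
    define z' where "z' = drop (s * m) (drop (s * Suc m) W)"
    have len: "length a = s * m" "length z = s" "length a' = s * m" "length z' = s"
      using W by (simp_all add: a_def z_def a'_def z'_def)
    have Weq: "W = a @ z @ a' @ z'"
    proof -
      have "drop s (drop (s * m) W) = a' @ z'"
        unfolding a'_def z'_def append_take_drop_id by (simp add: add.commute)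
      then have "drop (s * m) W = z @ a' @ z'" by (metis append_take_drop_id z_def)
      then show ?thesis by (metis append_take_drop_id a_def)
    qed
    have "g (u0 @ (a @ z) @ (a' @ z' @ v0)) = \<Xi> a \<otimes> g (u0 @ (p @ z) @ (a' @ z' @ v0))"
      using padded_split[OF E(1-4) g(2)[rule_format, OF u0(1), of "a' @ z' @ v0"] len(1,2)] len lp
      by (simp add: restr_def \<Xi>_def p_def)
    \<comment> \<open>Replacing the first prefix by \<open>p\<close> keeps its length, so the second
      block is still aligned and can be split in the same way.\<close>
    moreover have "s * Suc m dvd length (u0 @ p @ z)"
      using dvd_add[OF u0(1) dvd_refl] len lp by (simp add: algebra_simps)
    note padded_split[OF E(1-4) g(2)[rule_format, OF this, of v0] len(3,4)]
    then have "g (u0 @ (p @ z) @ (a' @ z' @ v0)) = \<Xi> a' \<otimes> H (z, z')"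
      using len lp by (simp add: restr_def \<Xi>_def p_def H_def)
    ultimately have lhs: "g (u0 @ W @ v0) = \<Xi> a \<otimes> (\<Xi> a' \<otimes> H (z, z'))"
      using Weq by simp
    have tens: "tens s (double_padded m \<xi> y y') W = \<Xi> a \<otimes> (delta y z \<otimes> (\<Xi> a' \<otimes> delta y' z'))" for y y'
    proof -
      have d: "delta y \<in> wfuns" for y by (auto simp: delta_def intro: wfunI)
      show ?thesis
        unfolding double_padded_def Weq using ts d len
        by (simp add: tens_append \<Xi>_def)
    qed
    have terms: "H q \<otimes> tens s (double_padded m \<xi> (fst q) (snd q)) W =
        (if (z, z') = q then \<Xi> a \<otimes> (\<Xi> a' \<otimes> H q) else \<zero>)" for q
      using \<Xi>c Hc by (cases q) (auto simp: tens delta_def m_ac)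
    show ?thesis
    proof (cases "(z, z') \<in> ?Z \<times> ?Z")
      case True
      have "(\<Oplus>q\<in>?Z \<times> ?Z. H q \<otimes> tens s (double_padded m \<xi> (fst q) (snd q)) W) =
          (\<Oplus>q\<in>?Z \<times> ?Z. if (z, z') = q then \<Xi> a \<otimes> (\<Xi> a' \<otimes> H q) else \<zero>)"
        by (simp only: terms)
      also have "\<dots> = \<Xi> a \<otimes> (\<Xi> a' \<otimes> H (z, z'))"
        using True \<Xi>c Hc by (intro add.finprod_singleton) auto
      finally show ?thesis using lhs by simp
    next
      case False
      \<comment> \<open>A free slot with a foreign letter kills both sides: \<open>g\<close> by its
        support, the sum because no pair of point masses matches.\<close>
      then have "\<not> set W \<subseteq> {0, 1}" using Weq len by (auto simp: bwords_def)
      then have "g (u0 @ W @ v0) = \<zero>" using wfuns_len_out[OF g(1), of "u0 @ W @ v0"] by auto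
      moreover have "(\<Oplus>q\<in>?Z \<times> ?Z. H q \<otimes> tens s (double_padded m \<xi> (fst q) (snd q)) W) = (\<Oplus>q\<in>?Z \<times> ?Z. \<zero>)"
        using False unfolding terms by (intro finsum_cong') auto
      ultimately show ?thesis by simp
    qed
  qed
  show ?thesis using main Hc by (intro exI[of _ H]) blast
qed

text \<open>Every translate of \<open>g\<close> is, on words of length at most
  \<open>s * Suc m\<close>, a combination of window functionals: two consecutive aligned blocks
  around the window carry all the information, and complete slots outside the window split off as
  scalars.\<close>

lemma window_funs_span:
  assumes E: "fspace s E" "\<xi> \<in> E" "\<xi> w0 = \<one>" "length w0 = s" "s > 0"
    and g: "g \<in> wfuns_len B" "\<forall>u v. s * Suc m dvd length u \<longrightarrow> restr (s * Suc m) u v g \<in> padded s E m \<xi>"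
    and B: "s * Suc m dvd B" "2 * (s * Suc m) \<le> B"
    and L: "wcomb L" "\<And>p. p \<in> set L \<Longrightarrow> length (snd p) \<le> s * Suc m"
      "\<And>t. t \<in> window_funs s m \<xi> \<Longrightarrow> pair t L = \<zero>"
  shows "pair (\<lambda>w. g (u @ w @ v)) L = \<zero>"
\<comment> \<open>Outside this range no admissible word completes the context to length
  \<open>B\<close>.\<close>
proof (cases "length u + length v \<le> B \<and> B \<le> length u + length v + s * Suc m")
  case False
  have "g (u @ w @ v) = \<zero>" if "length w \<le> s * Suc m" for w
    using wfuns_len_out[OF g(1), of "u @ w @ v"] False that by auto
  then show ?thesis using L by (intro pair_zero) auto
next
  case True
  define s' where "s' = s * Suc m"
  have s': "s' > 0" using E(5) by (simp add: s'_def)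
  obtain M where M: "B = s' * M" using B(1) by (auto simp: s'_def elim: dvdE)
  have M2: "M \<ge> 2" using B(2)[folded s'_def] M s' by (metis mult.commute nat_mult_le_cancel1)
  define l where "l = B - length u - length v"
  have l: "length u + l + length v = B" "l \<le> s'" using True by (auto simp: l_def s'_def)
  \<comment> \<open>\<open>Q\<close> counts the aligned blocks before the pair that covers the
    window. The minimum with \<open>M - 2\<close> steps back near the end of the word, where a
    second block would be missing.\<close>
  define Q where "Q = min (length u div s') (M - 2)"
  have Qu: "s' * Q \<le> length u" unfolding Q_def
    by (metis div_times_less_eq_dividend min.cobounded1 mult.commute mult_le_mono2 order_trans)
  have Q2: "length u - s' * Q + l \<le> 2 * s'"
  proof (cases "length u div s' \<le> M - 2")
    case True
    then have "length u - s' * Q = length u mod s'" by (simp add: Q_def minus_mult_div_eq_mod)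
    then show ?thesis using l(2) mod_less_divisor[OF s', of "length u"] by linarith
  next
    case False
    then have "Q = M - 2" by (simp add: Q_def)
    moreover have "s' * (M - 2) + 2 * s' = s' * M"
      using M2 by (metis add_mult_distrib2 le_add_diff_inverse2 mult.commute)
    ultimately show ?thesis using l(1) M Qu unfolding \<open>Q = M - 2\<close> by linarith
  qed
  have QM: "s' * Q + 2 * s' + s' * (M - 2 - Q) = B"
  proof -
    have "Q + 2 + (M - 2 - Q) = M" using M2 by (auto simp: Q_def)
    then show ?thesis using M by (metis add_mult_distrib2 mult.commute)
  qed
  define u0 u1 where "u0 = take (s' * Q) u" and "u1 = drop (s' * Q) u"
  \<comment> \<open>The right context lends \<open>n\<close> letters, so that the window and its
    near contexts fill exactly two blocks.\<close>
  define n where "n = 2 * s' - (length u1 + l)"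
  define v1 v0 where "v1 = take n v" and "v0 = drop n v"
  have u01: "u = u0 @ u1" "length u0 = s' * Q" "length u1 = length u - s' * Q"
    using Qu by (simp_all add: u0_def u1_def)
  have nv: "n + s' * (M - 2 - Q) = length v" using QM l(1) Qu Q2 u01(3) unfolding n_def by linarith
  have v01: "v = v1 @ v0" "length v1 = n" "length v0 = s' * (M - 2 - Q)"
    using nv by (simp_all add: v0_def v1_def)
  have n2: "length u1 + l + n = 2 * s'" using Q2 u01(3) unfolding n_def by linarith
  let ?Z = "{z \<in> bwords s. length z = s}"
  have "s * Suc m dvd length u0" "length u0 + 2 * (s * Suc m) + length v0 = B" "s * Suc m dvd length v0"
    unfolding s'_def[symmetric] using u01(2) v01(3) QM by simp_all
  from window_decompose[OF E g this]
  obtain H where "(\<forall>z z'. H (z, z') \<in> carrier F) \<and> (\<forall>W. length W = 2 * s' \<longrightarrow>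
    g (u0 @ W @ v0) = (\<Oplus>p\<in>?Z \<times> ?Z. H p \<otimes> tens s (double_padded m \<xi> (fst p) (snd p)) W))"
    unfolding s'_def[symmetric] by (elim exE)
  then have H: "\<And>z z'. H (z, z') \<in> carrier F" "\<And>W. length W = 2 * s' \<Longrightarrow>
    g (u0 @ W @ v0) = (\<Oplus>p\<in>?Z \<times> ?Z. H p \<otimes> tens s (double_padded m \<xi> (fst p) (snd p)) W)"
    by simp_all
  have \<xi>w: "\<xi> \<in> wfuns_len s" using E fspaceD(1) by blast
  have dp: "set (double_padded m \<xi> z z') \<subseteq> wfuns_len s" "length (double_padded m \<xi> z z') = 2 * Suc m"
    if "z \<in> ?Z" "z' \<in> ?Z" for z z'
    using that \<xi>w delta_wfuns_len by (auto simp: double_padded_def)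
  define \<tau> where "\<tau> p = (\<lambda>w. tens s (double_padded m \<xi> (fst p) (snd p)) (u1 @ w @ v1))" for p
  have \<tau>w: "\<tau> p \<in> wfuns" if "p \<in> ?Z \<times> ?Z" for p
  proof -
    have "set (double_padded m \<xi> (fst p) (snd p)) \<subseteq> wfuns_len s"
      using dp(1)[of "fst p" "snd p"] that by (simp add: mem_Times_iff)
    then have "set (double_padded m \<xi> (fst p) (snd p)) \<subseteq> wfuns" using wfuns_lenD(1) by blast
    then show ?thesis unfolding \<tau>_def by (intro wfunI tens_closed)
  qed
  have "g (u @ w @ v) = (\<Oplus>p\<in>?Z \<times> ?Z. H p \<otimes> \<tau> p w)" for w
  proof (cases "length w = l")
    case True
    have "g (u @ w @ v) = g (u0 @ (u1 @ w @ v1) @ v0)" using u01(1) v01(1) by simp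
    also have "\<dots> = (\<Oplus>p\<in>?Z \<times> ?Z. H p \<otimes> \<tau> p w)"
      unfolding \<tau>_def using True n2 v01(2) by (intro H(2)) simp
    finally show ?thesis .
  next
    case False
    have "g (u @ w @ v) = \<zero>" using wfuns_len_out[OF g(1), of "u @ w @ v"] False l(1) by auto
    moreover have "\<tau> p w = \<zero>" if p: "p \<in> ?Z \<times> ?Z" for p
    proof (rule ccontr)
      assume "\<tau> p w \<noteq> \<zero>"
      then have "length (u1 @ w @ v1) = s * (2 * Suc m)"
        using tens_nonzero[OF dp(1), of "fst p" "snd p" "u1 @ w @ v1"] dp(2)[of "fst p" "snd p"] p
        unfolding \<tau>_def mem_Times_iff by presburger
      then show False using False n2 v01(2) by (simp add: s'_def algebra_simps)
    qed
    then have "(\<Oplus>p\<in>?Z \<times> ?Z. H p \<otimes> \<tau> p w) = (\<Oplus>p\<in>?Z \<times> ?Z. \<zero>)"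
      using H(1) by (intro finsum_cong') auto
    ultimately show ?thesis by simp
  qed
  then have "pair (\<lambda>w. g (u @ w @ v)) L = pair (\<lambda>w. \<Oplus>p\<in>?Z \<times> ?Z. H p \<otimes> \<tau> p w) L" by simp
  also have "\<dots> = (\<Oplus>p\<in>?Z \<times> ?Z. H p \<otimes> pair (\<tau> p) L)"
    using \<tau>w H(1) L(1) by (intro pair_finsum_fun) auto
  also have "\<dots> = (\<Oplus>p\<in>?Z \<times> ?Z. \<zero>)"
  proof (intro finsum_cong' refl)
    fix p assume p: "p \<in> ?Z \<times> ?Z"
    obtain z z' where z: "p = (z, z')" "z \<in> ?Z" "z' \<in> ?Z" using p by auto
    \<comment> \<open>Complete slots inside the contexts contribute scalars. What remains is a run
      of slots with partial contexts of length at most \<open>s\<close>, that is, a window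
      functional.\<close>
    define q k where "q = length u1 div s" and "k = length v1 div s"
    define u' u2 where "u' = take (s * q) u1" and "u2 = drop (s * q) u1"
    define v2 v' where "v2 = take (length v1 - s * k) v1" and "v' = drop (length v1 - s * k) v1"
    have qk: "s * q \<le> length u1" "s * k \<le> length v1" by (simp_all add: q_def k_def)
    have u': "u1 = u' @ u2" "length u' = s * q" "length u2 \<le> s"
      using qk E(5) mod_less_divisor[OF E(5), of "length u1"]
      by (simp_all add: u'_def u2_def q_def minus_mult_div_eq_mod)
    have "length v1 - s * k \<le> s"
      using mod_less_divisor[OF E(5), of "length v1"] by (simp add: k_def minus_mult_div_eq_mod)
    then have v': "v1 = v2 @ v'" "length v' = s * k" "length v2 \<le> s"
      using qk(2) by (simp_all add: v'_def v2_def)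
    have "s * (q + k) \<le> s * (2 * Suc m)" using qk n2 v01(2) unfolding s'_def distrib_left by linarith
    then have qkm: "q + k \<le> 2 * Suc m" using E(5) mult_le_cancel1 by blast
    let ?ts = "double_padded m \<xi> z z'"
    define n' where "n' = 2 * Suc m - k - q"
    define t1 t2 t3 where "t1 = take q ?ts" and "t2 = take n' (drop q ?ts)" and "t3 = drop n' (drop q ?ts)"
    have t: "?ts = t1 @ t2 @ t3" by (simp add: t1_def t2_def t3_def del: drop_drop)
    have tl: "length t1 = q" "length t3 = k"
      using dp(2)[OF z(2,3)] qkm by (simp_all add: t1_def t3_def n'_def)
    have tw: "set t1 \<subseteq> wfuns_len s" "set t2 \<subseteq> wfuns_len s" "set t3 \<subseteq> wfuns_len s"
      using dp(1)[OF z(2,3)] t by auto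
    have tw': "set t1 \<subseteq> wfuns" "set t2 \<subseteq> wfuns" "set t3 \<subseteq> wfuns"
      using tw wfuns_lenD(1) by blast+
    have \<tau>: "\<tau> p w = (tens s t1 u' \<otimes> tens s t3 v') \<otimes> tens s t2 (u2 @ w @ v2)" for w
    proof -
      have "\<tau> p w = tens s (t1 @ t2 @ t3) (u' @ (u2 @ w @ v2) @ v')"
        by (simp add: \<tau>_def z(1) t u'(1) v'(1))
      also have "\<dots> = tens s t1 u' \<otimes> tens s t2 (u2 @ w @ v2) \<otimes> tens s t3 v'"
        using u'(2) v'(2) tl by (intro tens_append3 tw) simp_all
      finally show ?thesis using tw' by (simp add: tens_closed m_ac)
    qed
    have "pair (\<lambda>w. tens s t2 (u2 @ w @ v2)) L = \<zero>"
    proof (cases "u2 \<in> bwords s \<and> v2 \<in> bwords s")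
      case True
      have "(\<lambda>w. tens s t2 (u2 @ w @ v2)) \<in> window_funs s m \<xi>"
        unfolding window_funs_def t2_def using True z qkm
        by (intro image_eqI[of _ _ "(q, n', z, z', u2, v2)"]) (auto simp: n'_def)
      then show ?thesis by (rule L(3))
    next
      case False
      then have "tens s t2 (u2 @ w @ v2) = \<zero>" for w
        using tens_nonzero[OF tw(2), of "u2 @ w @ v2"] u'(3) v'(3) by (auto simp: bwords_def)
      then show ?thesis using L(1) by (simp add: pair_zero)
    qed
    then have "pair (\<tau> p) L = \<zero>"
      unfolding \<tau> using tw' L(1) by (subst pair_smult_fun) (auto simp: tens_closed intro: wfunI)
    then show "H p \<otimes> pair (\<tau> p) L = \<zero>" using H(1) z(1) by simp
  qed simp
  also have "\<dots> = \<zero>" by simp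
  finally show ?thesis .
qed

end

section \<open>Nil relations\<close>

context word_field
begin

primrec lpow :: "('f \<times> nat list) list \<Rightarrow> nat \<Rightarrow> ('f \<times> nat list) list" where
  "lpow L 0 = single []"
| "lpow L (Suc n) = mul L (lpow L n)"

lemma wcomb_lpow [simp]: "wcomb L \<Longrightarrow> wcomb (lpow L n)"
  by (induction n) simp_all

text \<open>The two lists may order their entries and associate their coefficients differently, so
  only their pairings are compared. Multiplication on the right is the form in which nilpotency is
  stated and in which the last factor of a product can be isolated.\<close>

lemma pair_lpow_Suc_right:
  assumes "t \<in> wfuns" "wcomb L"
  shows "pair t (lpow L (Suc n)) = pair t (mul (lpow L n) L)"
  using assms(1)
proof (induction n arbitrary: t)
  case 0
  then show ?case using assms(2) by (simp add: pair_mul)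
next
  case (Suc n)
  have IH: "pair (\<lambda>v. t (w @ v)) (mul L (lpow L n)) = pair (\<lambda>v. t (w @ v)) (mul (lpow L n) L)" for w
    using Suc.IH[of "\<lambda>v. t (w @ v)"] Suc.prems by simp
  have "pair t (lpow L (Suc (Suc n))) = pair (\<lambda>w. pair (\<lambda>v. t (w @ v)) (mul L (lpow L n))) L"
    using Suc.prems assms(2) by (simp add: pair_mul)
  also have "\<dots> = pair (\<lambda>w. pair (\<lambda>v. t (w @ v)) (mul (lpow L n) L)) L"
    by (simp only: IH)
  also have "\<dots> = pair t (mul (lpow L (Suc n)) L)"
    using Suc.prems assms(2) by (simp add: pair_mul)
  finally show ?case .
qed

lemma length_lpow:
  assumes "vcomb L" "p \<in> set (lpow L n)" shows "n \<le> length (snd p)"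
  using assms(2)
proof (induction n arbitrary: p)
  case (Suc n)
  then obtain q r where "q \<in> set L" "r \<in> set (lpow L n)" "snd p = snd q @ snd r"
    by (auto simp: mul_def)
  moreover have "length (snd q) > 0" using \<open>q \<in> set L\<close> assms(1) by (auto simp: vcomb_def)
  moreover have "n \<le> length (snd r)" using Suc.IH \<open>r \<in> set (lpow L n)\<close> by blast
  ultimately show ?case by (simp only: length_append)
qed simp

section \<open>Expansion of powers and symmetrised relations\<close>

primrec coef :: "('f \<times> nat list) list \<Rightarrow> nat list \<Rightarrow> 'f" where
  "coef [] w = \<zero>"
| "coef (p # L) w = (if snd p = w then fst p else \<zero>) \<oplus> coef L w"

lemma coef_closed [simp]: "wcomb L \<Longrightarrow> coef L w \<in> carrier F"
  by (induction L) auto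

lemma pair_coef:
  assumes "t \<in> wfuns" "wcomb L" "finite X" "\<And>p. p \<in> set L \<Longrightarrow> t (snd p) \<noteq> \<zero> \<Longrightarrow> snd p \<in> X"
  shows "pair t L = (\<Oplus>w\<in>X. coef L w \<otimes> t w)"
  using assms(2,4)
proof (induction L)
  case Nil
  have "(\<Oplus>w\<in>X. coef [] w \<otimes> t w) = (\<Oplus>w\<in>X. \<zero>)"
    using assms(1) by (intro finsum_cong') auto
  then show ?case by simp
next
  case (Cons p L)
  have "(\<Oplus>w\<in>X. coef (p # L) w \<otimes> t w) =
      (\<Oplus>w\<in>X. (if snd p = w then fst p \<otimes> t w else \<zero>) \<oplus> coef L w \<otimes> t w)"
    using Cons.prems(1) assms(1) by (intro finsum_cong') (auto simp: l_distr)
  also have "\<dots> = (\<Oplus>w\<in>X. if snd p = w then fst p \<otimes> t w else \<zero>) \<oplus> (\<Oplus>w\<in>X. coef L w \<otimes> t w)"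
    using Cons.prems(1) assms(1) by (intro finsum_addf) auto
  also have "(\<Oplus>w\<in>X. if snd p = w then fst p \<otimes> t w else \<zero>) = fst p \<otimes> t (snd p)"
  proof (cases "snd p \<in> X")
    case True
    then show ?thesis
      using Cons.prems(1) assms(1,3) by (intro add.finprod_singleton) auto
  next
    case False
    then have "t (snd p) = \<zero>" using Cons.prems(2)[of p] by auto
    moreover have "(\<Oplus>w\<in>X. if snd p = w then fst p \<otimes> t w else \<zero>) = (\<Oplus>w\<in>X. \<zero>)"
      using False by (intro finsum_cong') auto
    ultimately show ?thesis using Cons.prems(1) by simp
  qed
  finally show ?case using Cons by simp
qed

primrec cprod :: "(nat list \<Rightarrow> 'f) \<Rightarrow> nat list list \<Rightarrow> 'f" where
  "cprod c [] = \<one>"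
| "cprod c (w # \<sigma>) = c w \<otimes> cprod c \<sigma>"

lemma cprod_closed [simp]: "c \<in> wfuns \<Longrightarrow> cprod c \<sigma> \<in> carrier F"
  by (induction \<sigma>) auto

lemma cprod_remove1: "c \<in> wfuns \<Longrightarrow> w \<in> set \<sigma> \<Longrightarrow> cprod c \<sigma> = c w \<otimes> cprod c (remove1 w \<sigma>)"
  by (induction \<sigma>) (auto simp: m_lcomm)

lemma cprod_mset: "c \<in> wfuns \<Longrightarrow> mset \<sigma> = mset \<tau> \<Longrightarrow> cprod c \<sigma> = cprod c \<tau>"
proof (induction \<sigma> arbitrary: \<tau>)
  case (Cons w \<sigma>)
  then have "w \<in> set \<tau>" by (metis list.set_intros(1) mset_eq_setD)
  moreover have "mset \<sigma> = mset (remove1 w \<tau>)" using Cons.prems(2) by (metis add_mset_remove_trivial mset.simps(2) mset_remove1)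
  ultimately show ?case using Cons.IH[of "remove1 w \<tau>"] Cons.prems(1) cprod_remove1[of c w \<tau>] by simp
qed simp

definition seqs :: "nat list set \<Rightarrow> nat \<Rightarrow> nat list list set" where
  "seqs X n = {\<sigma>. set \<sigma> \<subseteq> X \<and> length \<sigma> = n}"

lemma finite_seqs: "finite X \<Longrightarrow> finite (seqs X n)"
  unfolding seqs_def by (rule finite_lists_length_eq)

lemma finsum_seqs_Suc:
  assumes "finite X" "\<And>\<sigma>. f \<sigma> \<in> carrier F"
  shows "(\<Oplus>\<sigma>\<in>seqs X (Suc n). f \<sigma>) = (\<Oplus>w\<in>X. \<Oplus>\<sigma>\<in>seqs X n. f (w # \<sigma>))"
proof -
  have "seqs X (Suc n) = (\<Union>w\<in>X. (#) w ` seqs X n)"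
    by (auto simp: seqs_def length_Suc_conv image_iff)
  then have "(\<Oplus>\<sigma>\<in>seqs X (Suc n). f \<sigma>) = (\<Oplus>\<sigma>\<in>(\<Union>w\<in>X. (#) w ` seqs X n). f \<sigma>)" by simp
  also have "\<dots> = (\<Oplus>w\<in>X. \<Oplus>\<sigma>\<in>(#) w ` seqs X n. f \<sigma>)"
    using assms finite_seqs[OF assms(1)]
    by (intro add.finprod_UN_disjoint) (auto simp: pairwise_def disjnt_def)
  also have "\<dots> = (\<Oplus>w\<in>X. \<Oplus>\<sigma>\<in>seqs X n. f (w # \<sigma>))"
    using assms by (intro finsum_cong' add.finprod_reindex refl) (auto intro!: finsum_closed)
  finally show ?thesis .
qed

text \<open>\<open>X\<close> has to contain only the binary words of \<open>L\<close>: a product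
  with any other factor is killed by the support of \<open>t\<close>. Repeated entries of
  \<open>L\<close> are merged by \<open>coef\<close>, so the index set does not depend on the
  list.\<close>

lemma pair_lpow_expand:
  assumes "t \<in> wfuns" "wcomb L" "finite X" "\<And>w. t w \<noteq> \<zero> \<Longrightarrow> set w \<subseteq> {0, 1}"
    "\<And>p. p \<in> set L \<Longrightarrow> set (snd p) \<subseteq> {0, 1} \<Longrightarrow> snd p \<in> X"
  shows "pair t (lpow L n) = (\<Oplus>\<sigma>\<in>seqs X n. cprod (coef L) \<sigma> \<otimes> t (concat \<sigma>))"
  using assms(1,4)
proof (induction n arbitrary: t)
  case 0
  have "seqs X 0 = {[]}" by (auto simp: seqs_def)
  then show ?case using 0 by simp
next
  case (Suc n)
  have cw: "coef L \<in> wfuns" using assms(2) by (simp add: wfunI)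
  define s where "s w = pair (\<lambda>v. t (w @ v)) (lpow L n)" for w
  have sw: "s \<in> wfuns" using Suc.prems(1) assms(2) unfolding s_def by (intro wfunI) simp
  have s0: "snd p \<in> X" if "p \<in> set L" "s (snd p) \<noteq> \<zero>" for p
  proof (rule assms(5)[OF that(1)], rule ccontr)
    assume "\<not> set (snd p) \<subseteq> {0, 1}"
    then have "t (snd p @ v) = \<zero>" for v using Suc.prems(2)[of "snd p @ v"] by auto
    then have "s (snd p) = \<zero>" unfolding s_def using assms(2) by (intro pair_zero) auto
    then show False using that(2) by simp
  qed
  have "pair t (lpow L (Suc n)) = pair s L"
    using Suc.prems(1) assms(2) by (simp add: pair_mul s_def[abs_def])
  also have "\<dots> = (\<Oplus>w\<in>X. coef L w \<otimes> s w)"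
    by (rule pair_coef[OF sw assms(2,3) s0])
  also have "\<dots> = (\<Oplus>w\<in>X. \<Oplus>\<sigma>\<in>seqs X n. cprod (coef L) (w # \<sigma>) \<otimes> t (concat (w # \<sigma>)))"
  proof (intro finsum_cong' refl)
    fix w assume "w \<in> X"
    have "s w = (\<Oplus>\<sigma>\<in>seqs X n. cprod (coef L) \<sigma> \<otimes> t (w @ concat \<sigma>))"
      unfolding s_def
    proof (rule Suc.IH)
      show "(\<lambda>v. t (w @ v)) \<in> wfuns" using Suc.prems(1) by simp
      show "t (w @ v) \<noteq> \<zero> \<Longrightarrow> set v \<subseteq> {0, 1}" for v using Suc.prems(2)[of "w @ v"] by simp
    qed
    then have "coef L w \<otimes> s w = (\<Oplus>\<sigma>\<in>seqs X n. coef L w \<otimes> (cprod (coef L) \<sigma> \<otimes> t (w @ concat \<sigma>)))"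
      using finite_seqs[OF assms(3)] cw Suc.prems(1) assms(2) by (simp add: finsum_rdistr)
    also have "\<dots> = (\<Oplus>\<sigma>\<in>seqs X n. cprod (coef L) (w # \<sigma>) \<otimes> t (concat (w # \<sigma>)))"
      using cw Suc.prems(1) assms(2) by (intro finsum_cong') (auto simp: m_assoc)
    finally show "coef L w \<otimes> s w = (\<Oplus>\<sigma>\<in>seqs X n. cprod (coef L) (w # \<sigma>) \<otimes> t (concat (w # \<sigma>)))" .
  next
    show "(\<lambda>w. \<Oplus>\<sigma>\<in>seqs X n. cprod (coef L) (w # \<sigma>) \<otimes> t (concat (w # \<sigma>))) \<in> X \<rightarrow> carrier F"
      using cw Suc.prems(1) by (auto intro!: finsum_closed simp del: cprod.simps)
  qed
  also have "\<dots> = (\<Oplus>\<sigma>\<in>seqs X (Suc n). cprod (coef L) \<sigma> \<otimes> t (concat \<sigma>))"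
    using cw Suc.prems(1) by (intro finsum_seqs_Suc[symmetric] assms(3)) auto
  finally show ?case .
qed

text \<open>Up to its coefficient, this is the contribution of one commutative monomial to the value
  of \<open>h\<close> on \<open>u L^n x\<close>, where \<open>n = size \<mu>\<close>. Every distinct
  ordering of \<open>\<mu>\<close> is counted once, so no multinomial factors occur and the
  characteristic plays no part.\<close>

definition rel :: "nat list \<Rightarrow> nat list \<Rightarrow> nat list multiset \<Rightarrow> (nat list \<Rightarrow> 'f) \<Rightarrow> 'f" where
  "rel u x \<mu> h = (\<Oplus>\<sigma>\<in>{\<sigma>. mset \<sigma> = \<mu>}. h (u @ concat \<sigma> @ x))"

lemma finite_mset_fiber: "finite {\<sigma>. mset \<sigma> = \<mu>}"
proof (rule finite_subset)
  show "{\<sigma>. mset \<sigma> = \<mu>} \<subseteq> {\<sigma>. set \<sigma> \<subseteq> set_mset \<mu> \<and> length \<sigma> = size \<mu>}" by auto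
qed (simp add: finite_lists_length_eq)

lemma linfun_rel:
  assumes "fspace s E" shows "linfun E (rel u x \<mu>)"
proof -
  have w: "h \<in> E \<Longrightarrow> h \<in> wfuns" for h using fspaceD(1)[OF assms] wfuns_lenD(1) by blast
  show ?thesis
    unfolding linfun_def rel_def
    using w finite_mset_fiber by (auto intro!: finsum_closed finsum_addf finsum_rdistr[symmetric])
qed

definition nwords :: "nat \<Rightarrow> nat list set" where
  "nwords d = bwords d - {[]}"

text \<open>The contexts, of length at most \<open>d\<close>, stand for the pieces of factors cut
  off by the ends of a block. Larger multisets give nothing on words of length \<open>B\<close>,
  because their members are nonempty.\<close>

definition nil_rels :: "nat \<Rightarrow> nat \<Rightarrow> ((nat list \<Rightarrow> 'f) \<Rightarrow> 'f) set" where
  "nil_rels d B = (\<lambda>(u, x, \<mu>). rel u x \<mu>) `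
     (bwords d \<times> bwords d \<times> {\<mu>. set_mset \<mu> \<subseteq> nwords d \<and> size \<mu> \<le> B})"

text \<open>A multiset is determined by its multiplicities, so the bound is polynomial in
  \<open>B\<close> with an exponent fixed by \<open>X\<close>; counting sequences instead would give
  an exponential bound.\<close>

lemma card_bounded_multisets:
  assumes "finite X"
  shows "finite {\<mu>. set_mset \<mu> \<subseteq> X \<and> size \<mu> \<le> B}" "card {\<mu>. set_mset \<mu> \<subseteq> X \<and> size \<mu> \<le> B} \<le> (B + 1) ^ card X"
proof -
  let ?M = "{\<mu>. set_mset \<mu> \<subseteq> X \<and> size \<mu> \<le> B}" and ?f = "\<lambda>\<mu>. restrict (count \<mu>) X"
  have inj: "inj_on ?f ?M"
  proof (rule inj_onI)
    fix \<mu> \<nu> assume *: "\<mu> \<in> ?M" "\<nu> \<in> ?M" "?f \<mu> = ?f \<nu>"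
    show "\<mu> = \<nu>"
    proof (rule multiset_eqI)
      fix w
      show "count \<mu> w = count \<nu> w"
      proof (cases "w \<in> X")
        case True
        then show ?thesis using fun_cong[OF *(3), of w] by simp
      next
        case False
        then have "w \<notin># \<mu>" "w \<notin># \<nu>" using * by auto
        then show ?thesis by (simp add: not_in_iff)
      qed
    qed
  qed
  have sub: "?f ` ?M \<subseteq> X \<rightarrow>\<^sub>E {..B}"
    by (auto intro: order_trans[OF count_le_size])
  have fin: "finite (X \<rightarrow>\<^sub>E {..B})" and card: "card (X \<rightarrow>\<^sub>E {..B}) = (B + 1) ^ card X"
    using assms by (simp_all add: finite_PiE card_PiE)
  show "finite ?M" by (rule inj_on_finite[OF inj sub fin])
  show "card ?M \<le> (B + 1) ^ card X" using card_inj_on_le[OF inj sub fin] card by simp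
qed

lemma finite_nwords [simp]: "finite (nwords d)"
  by (simp add: nwords_def)

lemma finite_nil_rels: "finite (nil_rels d B)"
  unfolding nil_rels_def using card_bounded_multisets(1)[of "nwords d" B] by simp

lemma card_nil_rels: "card (nil_rels d B) \<le> card (bwords d) ^ 2 * (B + 1) ^ card (bwords d)"
proof -
  let ?M = "{\<mu>. set_mset \<mu> \<subseteq> nwords d \<and> size \<mu> \<le> B}"
  have "card (nil_rels d B) \<le> card (bwords d \<times> bwords d \<times> ?M)"
    unfolding nil_rels_def using card_bounded_multisets(1)[of "nwords d" B] by (intro card_image_le) simp
  also have "\<dots> = card (bwords d) ^ 2 * card ?M"
    by (simp add: card_cartesian_product power2_eq_square)
  also have "card ?M \<le> (B + 1) ^ card (nwords d)" by (rule card_bounded_multisets) simp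
  also have "(B + 1) ^ card (nwords d) \<le> (B + 1) ^ card (bwords d)"
    by (intro power_increasing card_mono) (auto simp: nwords_def)
  finally show ?thesis by simp
qed

lemma length_concat_ge: "[] \<notin> set \<sigma> \<Longrightarrow> length \<sigma> \<le> length (concat \<sigma>)"
proof (induction \<sigma>)
  case (Cons w \<sigma>)
  then show ?case by (cases w) auto
qed simp

text \<open>Expanding a power of a generic combination of words of length at most \<open>d\<close> and collecting
  coefficients, only one relation per multiset of words is needed, whatever the coefficients.\<close>

lemma pair_lpow_nil_rels:
  assumes h: "h \<in> wfuns_len B" "\<And>\<rho>. \<rho> \<in> nil_rels d B \<Longrightarrow> \<rho> h = \<zero>"
    and L: "vcomb L" "\<And>p. p \<in> set L \<Longrightarrow> length (snd p) \<le> d"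
    and u: "length u \<le> d" "length x \<le> d"
  shows "pair (\<lambda>w. h (u @ w @ x)) (lpow L a) = \<zero>"
proof (cases "u \<in> bwords d \<and> x \<in> bwords d")
  case False
  then have "h (u @ w @ x) = \<zero>" for w
    using u wfuns_len_out[OF h(1), of "u @ w @ x"] by (auto simp: bwords_def)
  then show ?thesis using L(1) by (simp add: pair_zero)
next
  case True
  have hw: "h \<in> wfuns" using h(1) wfuns_lenD(1) by blast
  have cw: "coef L \<in> wfuns" using L(1) by (simp add: wfunI)
  let ?S = "seqs (nwords d) a" and ?f = "\<lambda>\<sigma>. cprod (coef L) \<sigma> \<otimes> h (u @ concat \<sigma> @ x)"
  have fin: "finite ?S" by (simp add: finite_seqs)
  have fc: "?f \<sigma> \<in> carrier F" for \<sigma> using hw cw by simp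
  have "pair (\<lambda>w. h (u @ w @ x)) (lpow L a) = (\<Oplus>\<sigma>\<in>?S. ?f \<sigma>)"
  proof (rule pair_lpow_expand)
    show "(\<lambda>w. h (u @ w @ x)) \<in> wfuns" using hw by simp
    show "h (u @ w @ x) \<noteq> \<zero> \<Longrightarrow> set w \<subseteq> {0, 1}" for w using wfuns_lenD(3)[OF h(1), of "u @ w @ x"] by auto
    show "p \<in> set L \<Longrightarrow> set (snd p) \<subseteq> {0, 1} \<Longrightarrow> snd p \<in> nwords d" for p
      using L by (auto simp: nwords_def bwords_def vcomb_def)
  qed (use L in simp_all)
  also have "?S = (\<Union>\<mu>\<in>mset ` ?S. {\<sigma> \<in> ?S. mset \<sigma> = \<mu>})" by auto
  also have "(\<Oplus>\<sigma>\<in>(\<Union>\<mu>\<in>mset ` ?S. {\<sigma> \<in> ?S. mset \<sigma> = \<mu>}). ?f \<sigma>) =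
      (\<Oplus>\<mu>\<in>mset ` ?S. \<Oplus>\<sigma>\<in>{\<sigma> \<in> ?S. mset \<sigma> = \<mu>}. ?f \<sigma>)"
    using fin fc by (intro add.finprod_UN_disjoint) (auto simp: pairwise_def disjnt_def)
  also have "\<dots> = (\<Oplus>\<mu>\<in>mset ` ?S. \<zero>)"
  proof (intro finsum_cong' refl)
    fix \<mu> assume "\<mu> \<in> mset ` ?S"
    then obtain \<tau> where \<tau>: "\<tau> \<in> ?S" "\<mu> = mset \<tau>" by blast
    have \<mu>: "set_mset \<mu> \<subseteq> nwords d" "size \<mu> = a" using \<tau> by (auto simp: seqs_def)
    have fib: "{\<sigma> \<in> ?S. mset \<sigma> = \<mu>} = {\<sigma>. mset \<sigma> = \<mu>}" using \<mu> by (auto simp: seqs_def)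
    have "(\<Oplus>\<sigma>\<in>{\<sigma>. mset \<sigma> = \<mu>}. ?f \<sigma>) =
        (\<Oplus>\<sigma>\<in>{\<sigma>. mset \<sigma> = \<mu>}. cprod (coef L) \<tau> \<otimes> h (u @ concat \<sigma> @ x))"
    proof (intro finsum_cong' refl)
      fix \<sigma> assume "\<sigma> \<in> {\<sigma>. mset \<sigma> = \<mu>}"
      then have "cprod (coef L) \<sigma> = cprod (coef L) \<tau>" using \<tau>(2) by (intro cprod_mset[OF cw]) simp
      then show "?f \<sigma> = cprod (coef L) \<tau> \<otimes> h (u @ concat \<sigma> @ x)" by simp
    qed (use hw cw in simp)
    also have "\<dots> = cprod (coef L) \<tau> \<otimes> rel u x \<mu> h"
      unfolding rel_def using finite_mset_fiber hw cw by (subst finsum_rdistr) auto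
    also have "rel u x \<mu> h = \<zero>"
    proof (cases "a \<le> B")
      case a: True
      show ?thesis
        using True \<mu> a by (intro h(2)) (auto simp: nil_rels_def intro!: image_eqI[of _ _ "(u, x, \<mu>)"])
    next
      case False
      \<comment> \<open>More than \<open>B\<close> nonempty factors exceed the length on which
        \<open>h\<close> lives.\<close>
      have "h (u @ concat \<sigma> @ x) = \<zero>" if "mset \<sigma> = \<mu>" for \<sigma>
      proof -
        have "[] \<notin> set \<sigma>" "length \<sigma> = a" using that \<mu> by (auto simp: nwords_def)
        then have "length (concat \<sigma>) \<ge> a" using length_concat_ge by blast
        then show ?thesis using False wfuns_len_out[OF h(1), of "u @ concat \<sigma> @ x"] by auto
      qed
      then have "rel u x \<mu> h = (\<Oplus>\<sigma>\<in>{\<sigma>. mset \<sigma> = \<mu>}. \<zero>)" unfolding rel_def by (intro finsum_cong') auto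
      then show ?thesis by simp
    qed
    finally show "(\<Oplus>\<sigma>\<in>{\<sigma> \<in> ?S. mset \<sigma> = \<mu>}. ?f \<sigma>) = \<zero>" using fib cw by simp
  qed simp
  finally show ?thesis by simp
qed

text \<open>In a product of the words of \<open>L\<close>, consider the factor that crosses the right end of an
  aligned block of length \<open>B\<close>; summing over everything to its left inside the block gives a
  relation.\<close>

lemma pair_lpow_block:
  assumes g: "g \<in> wfuns" "\<forall>u v. B dvd length u \<longrightarrow>
      restr B u v g \<in> wfuns_len B \<and> (\<forall>\<rho>\<in>nil_rels d B. \<rho> (restr B u v g) = \<zero>)"
    and L: "vcomb L" "\<And>p. p \<in> set L \<Longrightarrow> length (snd p) \<le> d"
    and u: "B dvd length u1" "length u2 \<le> d" and B: "d < B"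
  shows "pair (\<lambda>w. if B - length u2 \<le> length w then g (u1 @ u2 @ w @ v) else \<zero>) (lpow L N) = \<zero>"
proof (induction N arbitrary: v)
  case 0
  have "(\<lambda>w. if B - length u2 \<le> length w then g (u1 @ u2 @ w @ v) else \<zero>) \<in> wfuns"
    using g(1) by (intro wfunI) auto
  \<comment> \<open>The empty product does not reach the end of the block, since
    \<open>length u2 \<le> d\<close> and \<open>d < B\<close>.\<close>
  then show ?case using u B by simp
next
  case (Suc N)
  define M where "M = B - length u2"
  have M: "0 < M" "M + length u2 = B" using u B by (auto simp: M_def)
  define t where "t v w = (if M \<le> length w then g (u1 @ u2 @ w @ v) else \<zero>)" for v w
  have tw: "t v \<in> wfuns" for v using g(1) by (intro wfunI) (auto simp: t_def)
  have lw: "wcomb (lpow L N)" using L(1) by simp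
  have inner: "pair (\<lambda>w. t v (w @ y)) (lpow L N) = \<zero>" if y: "length y \<le> d" for y
  proof -
    \<comment> \<open>\<open>r j\<close> treats the case that the block ends inside the last factor
      \<open>y\<close>, after its first \<open>j\<close> letters: these form the right context of a
      relation, the rest of \<open>y\<close> lies beyond the block.\<close>
    define r where "r j w = restr B u1 (drop j y @ v) g (u2 @ w @ take j y)" for j w
    have rw: "r j \<in> wfuns" for j
    proof -
      have "restr B u1 (drop j y @ v) g \<in> wfuns" using g(2) u(1) wfuns_lenD(1) by blast
      then show ?thesis unfolding r_def by (intro wfunI) simp
    qed
    have r0: "pair (r j) (lpow L N) = \<zero>" for j
      unfolding r_def[abs_def] using g(2) u L y
      by (intro pair_lpow_nil_rels[where B = B and d = d]) auto
    have rj: "\<one> \<otimes> r j w = (if M - length w = j then g (u1 @ u2 @ w @ y @ v) else \<zero>)" if "j \<in> {1..length y}" for j w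
    proof -
      have td: "take i y @ drop i y @ v = y @ v" for i by (metis append_assoc append_take_drop_id)
      show ?thesis using that M g(1) by (auto simp: r_def restr_def td)
    qed
    \<comment> \<open>Either \<open>w\<close> alone reaches the end of the block, and
      \<open>y\<close> moves to the outer context for the induction hypothesis, or the end falls
      after exactly one \<open>j\<close> among the letters of \<open>y\<close>.\<close>
    have "t v (w @ y) = t (y @ v) w \<oplus> (\<Oplus>j\<in>{1..length y}. \<one> \<otimes> r j w)" for w
    proof -
      have eq: "(\<Oplus>j\<in>{1..length y}. \<one> \<otimes> r j w) =
          (\<Oplus>j\<in>{1..length y}. if M - length w = j then g (u1 @ u2 @ w @ y @ v) else \<zero>)"
        using rj g(1) by (intro finsum_cong') auto
      show ?thesis
      proof (cases "M - length w \<in> {1..length y}")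
        case True
        have "(\<Oplus>j\<in>{1..length y}. \<one> \<otimes> r j w) = g (u1 @ u2 @ w @ y @ v)"
          unfolding eq using True g(1) by (intro add.finprod_singleton) auto
        then show ?thesis using True g(1) by (auto simp: t_def)
      next
        case False
        have "(\<Oplus>j\<in>{1..length y}. \<one> \<otimes> r j w) = (\<Oplus>j\<in>{1..length y}. \<zero>)"
          unfolding eq using False by (intro finsum_cong') auto
        then show ?thesis using False g(1) by (auto simp: t_def)
      qed
    qed
    then have "pair (\<lambda>w. t v (w @ y)) (lpow L N) =
        pair (\<lambda>w. t (y @ v) w \<oplus> (\<Oplus>j\<in>{1..length y}. \<one> \<otimes> r j w)) (lpow L N)" by simp
    also have "\<dots> = pair (t (y @ v)) (lpow L N) \<oplus> pair (\<lambda>w. \<Oplus>j\<in>{1..length y}. \<one> \<otimes> r j w) (lpow L N)"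
      using tw rw lw by (intro pair_add_fun) (auto intro!: wfunI finsum_closed)
    also have "pair (\<lambda>w. \<Oplus>j\<in>{1..length y}. \<one> \<otimes> r j w) (lpow L N) =
        (\<Oplus>j\<in>{1..length y}. \<one> \<otimes> pair (r j) (lpow L N))"
      using rw lw by (intro pair_finsum_fun) auto
    also have "\<dots> = \<zero>" by (simp add: r0)
    also have "pair (t (y @ v)) (lpow L N) = \<zero>"
      using Suc.IH[of "y @ v"] by (simp add: t_def[abs_def] M_def)
    finally show ?thesis by simp
  qed
  have "pair (t v) (lpow L (Suc N)) = pair (\<lambda>y. pair (\<lambda>w. t v (w @ y)) (lpow L N)) L"
    using tw L(1) by (subst pair_lpow_Suc_right) (simp_all add: pair_mul_swap)
  also have "\<dots> = \<zero>"
    by (rule pair_zero) (use L inner in auto)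
  finally show ?case by (simp add: t_def[abs_def] M_def)
qed

text \<open>Leading factors are absorbed into the left context until it reaches the next aligned
  boundary. Each adds at least one and at most \<open>d\<close> letters, so at most \<open>B\<close>
  factors are spent and the overshoot is at most \<open>d\<close>; the remaining factors, at least
  \<open>B\<close> of them, span the rest of the following block, where
  \<open>pair_lpow_block\<close> applies.\<close>

lemma pair_lpow_zero:
  assumes g: "g \<in> wfuns" "\<forall>u v. B dvd length u \<longrightarrow>
      restr B u v g \<in> wfuns_len B \<and> (\<forall>\<rho>\<in>nil_rels d B. \<rho> (restr B u v g) = \<zero>)"
    and L: "vcomb L" "\<And>p. p \<in> set L \<Longrightarrow> length (snd p) \<le> d" and B: "d < B" and N: "2 * B \<le> N"
  shows "pair (\<lambda>w. g (u @ w @ v)) (lpow L N) = \<zero>"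
proof -
  \<comment> \<open>The first aligned position strictly beyond the left context.\<close>
  define P where "P = B * (length u div B + 1)"
  have BP: "B dvd P" by (simp add: P_def)
  have "P \<le> length u + B" "length u \<le> P"
  proof -
    have "length u = B * (length u div B) + length u mod B" "length u mod B < B" using B by simp_all
    then show "P \<le> length u + B" "length u \<le> P" unfolding P_def distrib_left by linarith+
  qed
  \<comment> \<open>Generalised over context and exponent. The difference
    \<open>P - length u\<close> is truncated at zero, so past the boundary the condition on the
    exponent is just \<open>B \<le> N\<close>.\<close>
  moreover have "pair (\<lambda>w. g (u @ w @ v)) (lpow L N) = \<zero>" if "length u \<le> P + d" "B + (P - length u) \<le> N" for u N
    using that
  proof (induction N arbitrary: u)
    case 0
    then show ?case using B by simp
  next
    case (Suc N)
    show ?case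
    proof (cases "P \<le> length u")
      case True
      define u1 u2 where "u1 = take P u" and "u2 = drop P u"
      have u: "u = u1 @ u2" "B dvd length u1" "length u2 \<le> d"
        using True Suc.prems(1) BP by (simp_all add: u1_def u2_def)
      have "pair (\<lambda>w. g (u @ w @ v)) (lpow L (Suc N)) =
          pair (\<lambda>w. if B - length u2 \<le> length w then g (u1 @ u2 @ w @ v) else \<zero>) (lpow L (Suc N))"
      proof (rule pair_cong)
        \<comment> \<open>At least \<open>B\<close> nonempty factors remain, so every product
          reaches the end of the block and the case distinction is invisible.\<close>
        fix p assume "p \<in> set (lpow L (Suc N))"
        then have "Suc N \<le> length (snd p)" using length_lpow[OF L(1)] by blast
        then have "B - length u2 \<le> length (snd p)" using Suc.prems(2) by linarith
        then show "g (u @ snd p @ v) = (if B - length u2 \<le> length (snd p) then g (u1 @ u2 @ snd p @ v) else \<zero>)"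
          using u(1) by simp
      qed
      also have "\<dots> = \<zero>" by (rule pair_lpow_block[of g B d L u1 u2 _ "Suc N", OF g L u(2,3) B])
      finally show ?thesis .
    next
      case False
      have "pair (\<lambda>w. g (u @ w @ v)) (lpow L (Suc N)) =
          pair (\<lambda>y. pair (\<lambda>w. g ((u @ y) @ w @ v)) (lpow L N)) L"
        using g(1) L(1) by (simp add: pair_mul)
      also have "\<dots> = \<zero>"
      proof (rule pair_zero)
        fix p assume p: "p \<in> set L"
        have "0 < length (snd p)" "length (snd p) \<le> d" using p L by (auto simp: vcomb_def)
        moreover have "length (u @ snd p) = length u + length (snd p)" by simp
        ultimately have "length (u @ snd p) \<le> P + d" "B + (P - length (u @ snd p)) \<le> N"
          using False Suc.prems(2) by linarith+
        then show "pair (\<lambda>w. g ((u @ snd p) @ w @ v)) (lpow L N) = \<zero>"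
          by (rule Suc.IH)
      qed (use L in simp)
      finally show ?thesis .
    qed
  qed
  ultimately show ?thesis using N by auto
qed

end

section \<open>Generation, nilpotency and growth of the quotient\<close>

lemma unital_hull_simps [simp]:
  "carrier (unital_hull F A) = carrier F \<times> carrier A"
  "\<one>\<^bsub>unital_hull F A\<^esub> = (\<one>\<^bsub>F\<^esub>, \<zero>\<^bsub>A\<^esub>)"
  "\<zero>\<^bsub>unital_hull F A\<^esub> = (\<zero>\<^bsub>F\<^esub>, \<zero>\<^bsub>A\<^esub>)"
  "(a, x) \<oplus>\<^bsub>unital_hull F A\<^esub> (b, y) = (a \<oplus>\<^bsub>F\<^esub> b, x \<oplus>\<^bsub>A\<^esub> y)"
  "c \<odot>\<^bsub>unital_hull F A\<^esub> (a, x) = (c \<otimes>\<^bsub>F\<^esub> a, c \<odot>\<^bsub>A\<^esub> x)"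
  "(a, x) \<otimes>\<^bsub>unital_hull F A\<^esub> (b, y) =
     (a \<otimes>\<^bsub>F\<^esub> b, (a \<odot>\<^bsub>A\<^esub> y \<oplus>\<^bsub>A\<^esub> b \<odot>\<^bsub>A\<^esub> x) \<oplus>\<^bsub>A\<^esub> x \<otimes>\<^bsub>A\<^esub> y)"
  by (simp_all add: unital_hull_def)

lemma unital_hull_vectorspace:
  assumes "vectorspace F A" shows "vectorspace F (unital_hull F A)"
proof -
  interpret vectorspace F A by fact
  show ?thesis
  proof (intro vs_criteria allI impI ballI; (elim conjE)?)
    show "field F" by (rule field_axioms)
    fix v assume "v \<in> carrier (unital_hull F A)"
    then obtain a x where v: "v = (a, x)" "a \<in> carrier F" "x \<in> carrier A" by auto
    show "\<exists>y\<in>carrier (unital_hull F A). v \<oplus>\<^bsub>unital_hull F A\<^esub> y = \<zero>\<^bsub>unital_hull F A\<^esub>"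
      using v by (intro bexI[of _ "(\<ominus>\<^bsub>F\<^esub> a, \<ominus>\<^bsub>A\<^esub> x)"]) (auto simp: R.r_neg M.r_neg)
  qed (auto simp: M.a_assoc M.a_comm M.a_lcomm R.a_assoc R.a_comm R.a_lcomm R.m_assoc R.l_distr R.r_distr
        smult_l_distr smult_r_distr smult_assoc1)
qed

context translation_system
begin

lemma minus_zero_imp_eq:
  assumes "a \<in> carrier F" "b \<in> carrier F" "a \<ominus> b = \<zero>" shows "a = b"
  using minus_equality[of a "\<ominus> b"] assms by (simp add: a_minus_def)

definition letters :: "'a free_coset set" where
  "letters = {cls (single [0]), cls (single [1])}"

lemma cls_Cons:
  "c \<in> carrier F \<Longrightarrow> w \<noteq> [] \<Longrightarrow> vcomb L \<Longrightarrow>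
    cls ((c, w) # L) = c \<odot>\<^bsub>quot\<^esub> cls (single w) \<oplus>\<^bsub>quot\<^esub> cls L"
  by (simp add: quot_smult quot_add cls_eq_iff pair_append pair_smul)

lemma cls_single_Cons: "w \<noteq> [] \<Longrightarrow> cls (single (x # w)) = cls (single [x]) \<otimes>\<^bsub>quot\<^esub> cls (single w)"
  by (simp add: quot_mult cls_eq_iff pair_mul)

text \<open>Combinations may use any natural number as a letter; since all but two letters vanish in
  the quotient, \<open>letters\<close> generates it.\<close>

lemma cls_single_bad: "\<not> set w \<subseteq> {0, 1} \<Longrightarrow> cls (single w) = \<zero>\<^bsub>quot\<^esub>"
  using T_letters[of _ w] by (auto simp: quot_zero cls_eq_iff)

lemma letters_subset: "letters \<subseteq> carrier quot"
  by (simp add: letters_def)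

lemma subalgebra_full:
  assumes "subalgebra F B quot" "letters \<subseteq> B"
  shows "B = carrier quot"
proof
  interpret submodule F B quot
    using assms(1) unfolding subalgebra_def VectorSpace.subspace_def by blast
  show "B \<subseteq> carrier quot" by (rule subset)
  have s: "cls (single w) \<in> B" if "w \<noteq> []" for w
  proof (cases "set w \<subseteq> {0, 1}")
    case True
    then show ?thesis using that
    proof (induction w)
      case (Cons x w)
      have x: "cls (single [x]) \<in> B" using Cons.prems assms(2) by (auto simp: letters_def)
      show ?case
      proof (cases "w = []")
        case False
        then show ?thesis
          using Cons x assms(1) cls_single_Cons[of w x] unfolding subalgebra_def by auto
      qed (use x in simp)
    qed simp
  qed (simp add: cls_single_bad)
  have "cls L \<in> B" if "vcomb L" for L
    using that
  proof (induction L)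
    case Nil
    then show ?case using zero_closed by (simp add: quot_zero)
  next
    case (Cons p L)
    obtain c w where p: "p = (c, w)" by (cases p)
    have "c \<in> carrier F" "w \<noteq> []" "vcomb L" using Cons.prems p by (auto simp: vcomb_def)
    then show ?case using Cons.IH s p by (simp add: cls_Cons smult_closed)
  qed
  then show "carrier quot \<subseteq> B" by (auto simp: carrier_quot)
qed

lemma subalgebra_quot: "subalgebra F (carrier quot) quot"
proof -
  interpret Q: nonunital_algebra F quot by (rule quot_algebra)
  have "submodule F (carrier quot) quot"
    by (rule submodule.intro) (auto intro: Q.module_axioms)
  then show ?thesis
    unfolding subalgebra_def VectorSpace.subspace_def
    using Q.mult_closed Q.vectorspace_axioms by blast
qed

lemma generatesI: "letters \<subseteq> X \<Longrightarrow> X \<subseteq> carrier quot \<Longrightarrow> generates F quot X"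
proof -
  assume X: "letters \<subseteq> X" "X \<subseteq> carrier quot"
  have "B = carrier quot" if "subalgebra F B quot \<and> X \<subseteq> B" for B
    using that X(1) by (intro subalgebra_full) auto
  then have "{B. subalgebra F B quot \<and> X \<subseteq> B} = {carrier quot}"
    using subalgebra_quot X(2) by blast
  then show ?thesis using X(2) by (simp add: generates_def)
qed

definition gspace :: "'a free_coset set" where
  "gspace = LinearCombinations.module.span F quot letters"

lemma generating_gspace: "generating_subspace F quot gspace"
proof -
  interpret Q: vectorspace F quot by (rule quot_vectorspace)
  have sub: "VectorSpace.subspace F gspace quot"
    unfolding gspace_def by (rule Q.span_is_subspace[OF letters_subset])
  interpret G: vectorspace F "quot\<lparr>carrier := gspace\<rparr>" by (rule Q.subspace_is_vs[OF sub])
  have l: "letters \<subseteq> gspace"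
    unfolding gspace_def by (rule Q.in_own_span[OF letters_subset])
  have "G.gen_set letters"
    using Q.span_li_not_depend(1)[OF l Q.is_module[OF sub]] by (simp add: gspace_def)
  then have "G.fin_dim" unfolding G.fin_dim_def using l by (intro exI[of _ letters]) (simp add: letters_def)
  moreover have "gspace \<subseteq> carrier quot"
    unfolding gspace_def by (rule Q.span_is_subset2[OF letters_subset])
  ultimately show ?thesis
    unfolding generating_subspace_def using sub generatesI[OF l] by blast
qed

lemma finitely_generated_quot: "finitely_generated F quot"
  unfolding finitely_generated_def
  using generatesI[OF order_refl letters_subset] by (intro exI[of _ letters]) (simp add: letters_def)

lemma vcomb_lpow: "vcomb L \<Longrightarrow> vcomb (lpow L (Suc n))"
proof -
  assume L: "vcomb L"
  have "snd p \<noteq> []" if "p \<in> set (mul L K)" for p K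
    using that L by (fastforce simp: mul_def vcomb_def)
  moreover have "wcomb (mul L (lpow L n))" using L by simp
  ultimately show ?thesis unfolding lpow.simps vcomb_def by blast
qed

lemma iterate_mult_quot:
  assumes "vcomb L"
  shows "((\<lambda>y. y \<otimes>\<^bsub>quot\<^esub> cls L) ^^ k) (cls L) = cls (lpow L (Suc k))"
proof (induction k)
  case 0
  then show ?case using assms by (simp add: cls_eq_iff pair_mul)
next
  case (Suc k)
  have "cls (lpow L (Suc k)) \<otimes>\<^bsub>quot\<^esub> cls L = cls (mul (lpow L (Suc k)) L)"
    using assms by (intro quot_mult vcomb_lpow)
  also have "\<dots> = cls (lpow L (Suc (Suc k)))"
    unfolding cls_eq_iff using assms pair_lpow_Suc_right[of _ L "Suc k"] by simp
  finally show ?case using Suc by simp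
qed

lemma nil_quot:
  assumes "\<And>L. vcomb L \<Longrightarrow> \<exists>k. \<forall>t\<in>T. pair t (lpow L (Suc k)) = \<zero>"
  shows "nil_algebra quot"
  unfolding nil_algebra_def
proof
  fix X assume "X \<in> carrier quot"
  then obtain L where L: "vcomb L" "X = cls L" by (rule quot_cases)
  obtain k where "\<forall>t\<in>T. pair t (lpow L (Suc k)) = \<zero>" using assms[OF L(1)] by blast
  then have "((\<lambda>y. y \<otimes>\<^bsub>quot\<^esub> X) ^^ k) X = \<zero>\<^bsub>quot\<^esub>"
    unfolding L(2) iterate_mult_quot[OF L(1)] quot_zero cls_eq_iff by simp
  then show "\<exists>k. ((\<lambda>y. y \<otimes>\<^bsub>quot\<^esub> X) ^^ k) X = \<zero>\<^bsub>quot\<^esub>" by blast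
qed

text \<open>An identity equals all its own powers, so in a nil algebra it is zero; a functional that
  is nonzero on some word rules this out. The result selects the unital-hull branch of
  \<open>growth\<close>.\<close>

lemma quot_no_identity:
  assumes "nil_algebra quot" "t \<in> T" "t w \<noteq> \<zero>" "w \<noteq> []"
  shows "\<not> is_identity quot e"
proof
  interpret Q: nonunital_algebra F quot by (rule quot_algebra)
  assume e: "is_identity quot e"
  then have "((\<lambda>y. y \<otimes>\<^bsub>quot\<^esub> e) ^^ k) e = e" for k
    by (induction k) (auto simp: is_identity_def)
  then have "e = \<zero>\<^bsub>quot\<^esub>" using assms(1) e by (auto simp: nil_algebra_def is_identity_def)
  moreover have "e \<otimes>\<^bsub>quot\<^esub> cls (single w) = cls (single w)"
    using e assms(4) by (simp add: is_identity_def)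
  moreover have "\<zero>\<^bsub>quot\<^esub> \<otimes>\<^bsub>quot\<^esub> cls (single w) = \<zero>\<^bsub>quot\<^esub>"
    using assms(4) by (simp add: quot_zero quot_mult mul_def)
  ultimately have "cls (single w) = cls []" by (simp add: quot_zero)
  then show False using assms(2,3) by (simp add: cls_eq_iff)
qed

section \<open>Growth filtration in the unital hull\<close>

abbreviation uhull :: "('a, 'a \<times> 'a free_coset) module" where
  "uhull \<equiv> unital_hull F quot"

definition vdeg :: "nat \<Rightarrow> ('a \<times> nat list) list set" where
  "vdeg n = {L. vcomb L \<and> (\<forall>p\<in>set L. length (snd p) \<le> n)}"

lemma vdeg_vcomb: "L \<in> vdeg n \<Longrightarrow> vcomb L"
  by (simp add: vdeg_def)

lemma vdeg_simps [simp]: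
  "[] \<in> vdeg n" "L @ K \<in> vdeg n \<longleftrightarrow> L \<in> vdeg n \<and> K \<in> vdeg n"
  "single w \<in> vdeg n \<longleftrightarrow> w \<noteq> [] \<and> length w \<le> n"
  by (auto simp: vdeg_def single_def vcomb_def)

lemma vdeg_smul [simp]: "c \<in> carrier F \<Longrightarrow> L \<in> vdeg n \<Longrightarrow> smul c L \<in> vdeg n"
  by (auto simp: vdeg_def smul_def vcomb_def wcomb_def)

lemma vdeg_mul: "L \<in> vdeg n \<Longrightarrow> K \<in> vdeg m \<Longrightarrow> mul L K \<in> vdeg (n + m)"
  by (fastforce simp: vdeg_def mul_def vcomb_def wcomb_def)

lemma vdeg_mono: "L \<in> vdeg n \<Longrightarrow> n \<le> m \<Longrightarrow> L \<in> vdeg m"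
  by (auto simp: vdeg_def)

text \<open>Closed form of \<open>F + V + ... + V^n\<close> for \<open>V = gspace\<close>, as
  confirmed by \<open>growth_carrier\<close>.\<close>

definition filt :: "nat \<Rightarrow> ('a \<times> 'a free_coset) set" where
  "filt n = carrier F \<times> cls ` vdeg n"

lemma uhull_vectorspace: "vectorspace F uhull"
  by (rule unital_hull_vectorspace[OF quot_vectorspace])

lemma filt_subspace: "VectorSpace.subspace F (filt n) uhull"
proof -
  interpret H: vectorspace F uhull by (rule uhull_vectorspace)
  have "submodule F (filt n) uhull"
  proof (rule submodule.intro)
    show "Module.module F uhull" by (rule H.module_axioms)
    show "filt n \<subseteq> carrier uhull" by (auto simp: filt_def vdeg_vcomb)
    show "\<zero>\<^bsub>uhull\<^esub> \<in> filt n" by (auto simp: filt_def quot_zero)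
    show "v \<oplus>\<^bsub>uhull\<^esub> w \<in> filt n" if vw: "v \<in> filt n" "w \<in> filt n" for v w
    proof -
      obtain a L b K where "v = (a, cls L)" "w = (b, cls K)" "a \<in> carrier F" "b \<in> carrier F" "L \<in> vdeg n" "K \<in> vdeg n"
        using vw by (auto simp: filt_def)
      then show ?thesis by (auto simp: filt_def quot_add vdeg_vcomb intro!: imageI)
    qed
    show "c \<odot>\<^bsub>uhull\<^esub> v \<in> filt n" if cv: "c \<in> carrier F" "v \<in> filt n" for c v
    proof -
      obtain a L where "v = (a, cls L)" "a \<in> carrier F" "L \<in> vdeg n"
        using cv by (auto simp: filt_def)
      then show ?thesis using cv(1) by (auto simp: filt_def quot_smult vdeg_vcomb intro!: imageI)
    qed
  qed
  then show ?thesis unfolding VectorSpace.subspace_def using uhull_vectorspace by blast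
qed

lemma gspace_vdeg: "gspace \<subseteq> cls ` vdeg 1"
proof
  interpret Q: vectorspace F quot by (rule quot_vectorspace)
  fix X assume X: "X \<in> gspace"
  have "submodule F (cls ` vdeg 1) quot"
  proof (rule submodule.intro)
    show "Module.module F quot" by (rule Q.module_axioms)
    show "cls ` vdeg 1 \<subseteq> carrier quot" by (auto simp: vdeg_vcomb)
    show "\<zero>\<^bsub>quot\<^esub> \<in> cls ` vdeg 1" by (simp add: quot_zero)
  qed (auto simp: quot_add quot_smult vdeg_vcomb intro!: imageI)
  moreover have "letters \<subseteq> cls ` vdeg 1" by (auto simp: letters_def)
  ultimately show "X \<in> cls ` vdeg 1" using X Q.span_is_subset unfolding gspace_def by blast
qed

lemma power_space_subset_filt: "power_space F uhull (Pair \<zero> ` gspace) i \<subseteq> filt i"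
proof (induction i)
  interpret H: vectorspace F uhull by (rule uhull_vectorspace)
  {
    case 0
    have "{\<one>\<^bsub>uhull\<^esub>} \<subseteq> filt 0" by (auto simp: filt_def quot_zero)
    then show ?case using H.span_is_subset[OF _ H.is_module[OF filt_subspace]] by simp
  next
    case (Suc i)
    interpret Q: nonunital_algebra F quot by (rule quot_algebra)
    have "x \<otimes>\<^bsub>uhull\<^esub> v \<in> filt (Suc i)"
      if x: "x \<in> power_space F uhull (Pair \<zero> ` gspace) i" and v: "v \<in> Pair \<zero> ` gspace" for x v
    proof -
      obtain a L where L: "x = (a, cls L)" "a \<in> carrier F" "L \<in> vdeg i"
        using x Suc by (auto simp: filt_def)
      obtain K where K: "v = (\<zero>, cls K)" "K \<in> vdeg 1" using v gspace_vdeg by auto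
      have "x \<otimes>\<^bsub>uhull\<^esub> v = (\<zero>, cls ((smul a K @ smul \<zero> L) @ mul L K))"
        using L K by (simp add: quot_smult quot_mult quot_add vdeg_vcomb)
      moreover have "(smul a K @ smul \<zero> L) @ mul L K \<in> vdeg (Suc i)"
        using L K vdeg_mul[OF L(3) K(2)] vdeg_mono[of K 1 "Suc i"] vdeg_mono[of L i "Suc i"] by simp
      ultimately show ?thesis by (simp add: filt_def)
    qed
    then have "{x \<otimes>\<^bsub>uhull\<^esub> v |x v. x \<in> power_space F uhull (Pair \<zero> ` gspace) i \<and> v \<in> Pair \<zero> ` gspace} \<subseteq> filt (Suc i)"
      by blast
    then show ?case using H.span_is_subset[OF _ H.is_module[OF filt_subspace]] by simp
  }
qed

text \<open>Induction runs from the right end because \<open>power_space\<close> multiplies by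
  generators on the right; the first letter arises as the unit of the hull times a
  generator.\<close>

lemma single_in_power_space:
  assumes "w \<noteq> []" "set w \<subseteq> {0, 1}"
  shows "(\<zero>, cls (single w)) \<in> power_space F uhull (Pair \<zero> ` gspace) (length w)"
  using assms
proof (induction w rule: rev_induct)
  case (snoc x w)
  interpret H: vectorspace F uhull by (rule uhull_vectorspace)
  interpret Q: nonunital_algebra F quot by (rule quot_algebra)
  have ps: "power_space F uhull (Pair \<zero> ` gspace) i \<subseteq> carrier uhull" for i
    using power_space_subset_filt[of i] H.is_module[OF filt_subspace[of i]] submodule.subset by blast
  have "cls (single [x]) \<in> letters" using snoc.prems by (auto simp: letters_def)
  then have "cls (single [x]) \<in> gspace"
    unfolding gspace_def using Q.in_own_span[OF letters_subset] by blast
  then have x: "(\<zero>, cls (single [x])) \<in> Pair \<zero> ` gspace" by simp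
  have "\<exists>y\<in>power_space F uhull (Pair \<zero> ` gspace) (length w).
      (\<zero>, cls (single (w @ [x]))) = y \<otimes>\<^bsub>uhull\<^esub> (\<zero>, cls (single [x]))"
  proof (cases "w = []")
    case True
    have "\<one>\<^bsub>uhull\<^esub> \<in> LinearCombinations.module.span F uhull {\<one>\<^bsub>uhull\<^esub>}"
      by (rule H.span_self) (simp add: quot_zero)
    moreover have "(\<zero>, cls (single [x])) = \<one>\<^bsub>uhull\<^esub> \<otimes>\<^bsub>uhull\<^esub> (\<zero>, cls (single [x]))"
      by (simp add: quot_zero quot_smult quot_add quot_mult cls_eq_iff pair_append pair_smul pair_mul)
    ultimately show ?thesis using True unfolding True list.size power_space.simps append_Nil by blast
  next
    case False
    have "(\<zero>, cls (single (w @ [x]))) = (\<zero>, cls (single w)) \<otimes>\<^bsub>uhull\<^esub> (\<zero>, cls (single [x]))"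
      using False by (simp add: quot_smult quot_add quot_mult cls_eq_iff pair_append pair_smul pair_mul)
    moreover have "(\<zero>, cls (single w)) \<in> power_space F uhull (Pair \<zero> ` gspace) (length w)"
      using snoc False by simp
    ultimately show ?thesis by blast
  qed
  then have "(\<zero>, cls (single (w @ [x]))) \<in> {y \<otimes>\<^bsub>uhull\<^esub> v |y v.
      y \<in> power_space F uhull (Pair \<zero> ` gspace) (length w) \<and> v \<in> Pair \<zero> ` gspace}"
    using x by blast
  moreover have "{y \<otimes>\<^bsub>uhull\<^esub> v |y v. y \<in> power_space F uhull (Pair \<zero> ` gspace) (length w) \<and>
      v \<in> Pair \<zero> ` gspace} \<subseteq> carrier uhull"
  proof -
    have "y \<otimes>\<^bsub>uhull\<^esub> v \<in> carrier uhull" if y: "y \<in> carrier uhull" and v: "v \<in> Pair \<zero> ` gspace" for y v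
    proof -
      obtain K where "v = (\<zero>, cls K)" "vcomb K" using v gspace_vdeg vdeg_vcomb by auto
      then show ?thesis using y by (cases y) (auto intro!: Q.mult_closed)
    qed
    then show ?thesis using ps by blast
  qed
  ultimately show ?case using H.span_mem by auto
qed simp

lemma growth_carrier:
  "LinearCombinations.module.span F uhull (\<Union>i\<le>n. power_space F uhull (Pair \<zero> ` gspace) i) = filt n"
proof
  interpret H: vectorspace F uhull by (rule uhull_vectorspace)
  interpret Q: nonunital_algebra F quot by (rule quot_algebra)
  let ?P = "power_space F uhull (Pair \<zero> ` gspace)"
  have "filt i \<subseteq> filt n" if "i \<le> n" for i
    using that vdeg_mono by (auto simp: filt_def)
  then have P: "(\<Union>i\<le>n. ?P i) \<subseteq> filt n" using power_space_subset_filt by blast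
  then show "H.span (\<Union>i\<le>n. ?P i) \<subseteq> filt n"
    using H.span_is_subset[OF _ H.is_module[OF filt_subspace]] by blast
  have Pc: "(\<Union>i\<le>n. ?P i) \<subseteq> carrier uhull"
    using P submodule.subset[OF H.is_module[OF filt_subspace]] by blast
  interpret S: submodule F "H.span (\<Union>i\<le>n. ?P i)" uhull
    by (rule H.span_is_submodule[OF Pc])
  have one: "\<one>\<^bsub>uhull\<^esub> \<in> H.span (\<Union>i\<le>n. ?P i)"
  proof -
    have "\<one>\<^bsub>uhull\<^esub> \<in> ?P 0" using H.span_self[of "\<one>\<^bsub>uhull\<^esub>"] by (simp add: quot_zero)
    then show ?thesis using H.in_own_span[OF Pc] by blast
  qed
  have s: "(\<zero>, cls (single w)) \<in> H.span (\<Union>i\<le>n. ?P i)" if w: "w \<noteq> []" "length w \<le> n" for w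
  proof (cases "set w \<subseteq> {0, 1}")
    case True
    then show ?thesis using single_in_power_space[OF w(1)] w(2) H.in_own_span[OF Pc] by blast
  next
    case False
    then show ?thesis using S.zero_closed by (simp add: cls_single_bad)
  qed
  have "(\<zero>, cls L) \<in> H.span (\<Union>i\<le>n. ?P i)" if "L \<in> vdeg n" for L
    using that
  proof (induction L)
    case Nil
    then show ?case using S.zero_closed by (simp add: quot_zero)
  next
    case (Cons p L)
    obtain c w where p: "p = (c, w)" by (cases p)
    have c: "c \<in> carrier F" "w \<noteq> []" "length w \<le> n" "L \<in> vdeg n" "vcomb L"
      using Cons.prems p by (auto simp: vdeg_def vcomb_def)
    have "(\<zero>, cls (p # L)) = c \<odot>\<^bsub>uhull\<^esub> (\<zero>, cls (single w)) \<oplus>\<^bsub>uhull\<^esub> (\<zero>, cls L)"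
      using c p by (simp add: cls_Cons)
    then show ?case
      using S.m_closed[OF S.smult_closed[OF c(1) s[OF c(2,3)]] Cons.IH[OF c(4)]] by (simp only:)
  qed
  then have "(a, cls L) \<in> H.span (\<Union>i\<le>n. ?P i)" if "a \<in> carrier F" "L \<in> vdeg n" for a L
  proof -
    have "(a, cls L) = a \<odot>\<^bsub>uhull\<^esub> \<one>\<^bsub>uhull\<^esub> \<oplus>\<^bsub>uhull\<^esub> (\<zero>, cls L)"
      using that by (simp add: vdeg_vcomb)
    then show ?thesis
      using S.m_closed[OF S.smult_closed[OF that(1) one]] \<open>\<And>L. L \<in> vdeg n \<Longrightarrow> (\<zero>, cls L) \<in> H.span (\<Union>i\<le>n. ?P i)\<close>[OF that(2)]
      by (simp only:)
  qed
  then show "filt n \<subseteq> H.span (\<Union>i\<le>n. ?P i)" by (auto simp: filt_def)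
qed

lemma growth_eq:
  assumes "\<And>e. \<not> is_identity quot e"
  shows "growth F quot gspace n = vectorspace.dim F (uhull\<lparr>carrier := filt n\<rparr>)"
  using assms by (simp add: growth_def unital_growth_def growth_carrier)

text \<open>Induction over the functionals: if the new one vanishes on the joint kernel of the
  others, the old representatives suffice; otherwise an element \<open>b\<close> of that kernel on
  which it is nonzero is added, and \<open>K\<close> is adjusted by a multiple of \<open>b\<close>.
  Values are compared on representatives since members of \<open>\<Lambda>\<close> need not be well
  defined on classes.\<close>

lemma finite_codimension:
  assumes "finite \<Lambda>" "\<Lambda> \<subseteq> wfuns"
  shows "\<exists>Bs. finite Bs \<and> card Bs \<le> card \<Lambda> \<and> Bs \<subseteq> vdeg n \<and> (\<forall>L\<in>vdeg n. \<exists>K\<in>vdeg n.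
    (\<zero>, cls K) \<in> LinearCombinations.module.span F uhull ((\<lambda>L. (\<zero>, cls L)) ` Bs) \<and>
    (\<forall>t\<in>\<Lambda>. pair t L = pair t K))"
  using assms
proof (induction \<Lambda> rule: finite_induct)
  case empty
  interpret H: vectorspace F uhull by (rule uhull_vectorspace)
  have "(\<zero>, cls []) \<in> H.span {}" using H.span_zero[of "{}"] by (simp add: quot_zero)
  then show ?case by (intro exI[of _ "{}"]) (auto intro!: bexI[of _ "[]"])
next
  case (insert s \<Lambda>)
  interpret H: vectorspace F uhull by (rule uhull_vectorspace)
  let ?e = "\<lambda>L. (\<zero>, cls L)"
  obtain Bs where Bs: "finite Bs" "card Bs \<le> card \<Lambda>" "Bs \<subseteq> vdeg n" "\<And>L. L \<in> vdeg n \<Longrightarrow> \<exists>K\<in>vdeg n.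
      ?e K \<in> H.span (?e ` Bs) \<and> (\<forall>t\<in>\<Lambda>. pair t L = pair t K)"
    using insert.IH insert.prems by auto
  have \<Lambda>: "s \<in> wfuns" "\<Lambda> \<subseteq> wfuns" using insert.prems by auto
  have ec: "?e ` Bs \<subseteq> carrier uhull" using Bs(3) by (auto simp: vdeg_vcomb)
  have w: "L \<in> vdeg n \<Longrightarrow> wcomb L" for L using vdeg_vcomb vcomb_wcomb by blast
  show ?case
  proof (cases "\<forall>L\<in>vdeg n. (\<forall>t\<in>\<Lambda>. pair t L = \<zero>) \<longrightarrow> pair s L = \<zero>")
    case True
    have "\<exists>K\<in>vdeg n. ?e K \<in> H.span (?e ` Bs) \<and> (\<forall>t\<in>insert s \<Lambda>. pair t L = pair t K)"
      if L: "L \<in> vdeg n" for L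
    proof -
      obtain K where K: "K \<in> vdeg n" "?e K \<in> H.span (?e ` Bs)" "\<And>t. t \<in> \<Lambda> \<Longrightarrow> pair t L = pair t K"
        using Bs(4)[OF L] by blast
      let ?D = "L @ smul (\<ominus> \<one>) K"
      have D: "pair t ?D = pair t L \<ominus> pair t K" if "t \<in> wfuns" for t
        using that L K(1) w by (simp add: pair_append pair_smul l_minus a_minus_def)
      have "pair t ?D = \<zero>" if t: "t \<in> \<Lambda>" for t
      proof -
        have "t \<in> wfuns" using t \<Lambda>(2) by blast
        then show ?thesis using D K(3)[OF t] K(1) w by (simp add: a_minus_def r_neg)
      qed
      moreover have "?D \<in> vdeg n" using L K(1) by simp
      ultimately have "pair s ?D = \<zero>" using True by blast
      then have "pair s L \<ominus> pair s K = \<zero>" using D[OF \<Lambda>(1)] by simp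
      then have "pair s L = pair s K" 
        using \<Lambda>(1) L K(1) w by (intro minus_zero_imp_eq[of "pair s L" "pair s K"]) simp_all
      then show ?thesis using K by blast
    qed
    then show ?thesis using Bs(1-3) insert.hyps by (intro exI[of _ Bs]) simp
  next
    case False
    then obtain b where b: "b \<in> vdeg n" "\<And>t. t \<in> \<Lambda> \<Longrightarrow> pair t b = \<zero>" "pair s b \<noteq> \<zero>" by blast
    have u: "pair s b \<in> Units F" using b \<Lambda>(1) w by (simp add: field_Units)
    have ec': "?e ` insert b Bs \<subseteq> carrier uhull" using ec b(1) by (auto simp: vdeg_vcomb)
    interpret S: submodule F "H.span (?e ` insert b Bs)" uhull by (rule H.span_is_submodule[OF ec'])
    have "\<exists>K\<in>vdeg n. ?e K \<in> H.span (?e ` insert b Bs) \<and> (\<forall>t\<in>insert s \<Lambda>. pair t L = pair t K)"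
      if L: "L \<in> vdeg n" for L
    proof -
      obtain K where K: "K \<in> vdeg n" "?e K \<in> H.span (?e ` Bs)" "\<And>t. t \<in> \<Lambda> \<Longrightarrow> pair t L = pair t K"
        using Bs(4)[OF L] by blast
      have cs: "pair s L \<in> carrier F" "pair s K \<in> carrier F" "inv (pair s b) \<in> carrier F" "pair s b \<in> carrier F"
        using L K(1) \<Lambda>(1) w u by auto
      define c where "c = (pair s L \<ominus> pair s K) \<otimes> inv (pair s b)"
      have c: "c \<in> carrier F" using cs by (simp add: c_def)
      have "c \<otimes> pair s b = (pair s L \<ominus> pair s K) \<otimes> (inv (pair s b) \<otimes> pair s b)"
        using cs by (simp add: c_def m_assoc)
      also have "\<dots> = pair s L \<ominus> pair s K" using cs u by simp
      finally have "pair s K \<oplus> c \<otimes> pair s b = pair s L" using a_lcomm[OF cs(2,1) a_inv_closed[OF cs(2)]] cs by (simp add: a_minus_def r_neg)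
      then have "pair s (K @ smul c b) = pair s L"
        using K(1) b(1) c \<Lambda>(1) w by (simp add: pair_append pair_smul)
      moreover have "pair t (K @ smul c b) = pair t L" if t: "t \<in> \<Lambda>" for t
      proof -
        have "t \<in> wfuns" using t \<Lambda>(2) by blast
        then show ?thesis using K(3)[OF t] b(2)[OF t] K(1) b(1) c w by (simp add: pair_append pair_smul)
      qed
      moreover have "?e (K @ smul c b) \<in> H.span (?e ` insert b Bs)"
      proof -
        have "?e b \<in> H.span (?e ` insert b Bs)" using H.in_own_span[OF ec'] by blast
        moreover have "?e K \<in> H.span (?e ` insert b Bs)"
          using K(2) H.span_is_monotone[of "?e ` Bs" "?e ` insert b Bs"] by blast
        moreover have "?e (K @ smul c b) = ?e K \<oplus>\<^bsub>uhull\<^esub> c \<odot>\<^bsub>uhull\<^esub> ?e b"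
          using K(1) b(1) c by (simp add: quot_add quot_smult vdeg_vcomb)
        ultimately show ?thesis using S.m_closed S.smult_closed[OF c] by metis
      qed
      moreover have "K @ smul c b \<in> vdeg n" using K(1) b(1) c by simp
      ultimately show ?thesis by (metis insertE)
    qed
    moreover have "card (insert b Bs) \<le> card (insert s \<Lambda>)"
      using Bs(1,2) insert.hyps by (metis card_insert_disjoint card_insert_le_m1 Suc_le_mono card_insert_if le_SucI)
    ultimately show ?thesis using Bs(1,3) b(1) by (intro exI[of _ "insert b Bs"]) auto
  qed
qed

text \<open>Once \<open>\<Lambda>\<close> determines every member of \<open>T\<close> on
  \<open>vdeg n\<close>, equal values on \<open>\<Lambda>\<close> mean equal classes. The additional
  spanning element is the unit of the hull.\<close>

lemma filt_spanning:
  assumes "finite \<Lambda>" "\<Lambda> \<subseteq> wfuns"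
    and det: "\<And>L t. L \<in> vdeg n \<Longrightarrow> \<forall>s\<in>\<Lambda>. pair s L = \<zero> \<Longrightarrow> t \<in> T \<Longrightarrow> pair t L = \<zero>"
  shows "\<exists>A. finite A \<and> card A \<le> Suc (card \<Lambda>) \<and> A \<subseteq> filt n \<and> LinearCombinations.module.span F uhull A = filt n"
proof -
  interpret H: vectorspace F uhull by (rule uhull_vectorspace)
  let ?e = "\<lambda>L. (\<zero>, cls L)"
  obtain Bs where Bs: "finite Bs" "card Bs \<le> card \<Lambda>" "Bs \<subseteq> vdeg n" "\<And>L. L \<in> vdeg n \<Longrightarrow> \<exists>K\<in>vdeg n.
      ?e K \<in> H.span (?e ` Bs) \<and> (\<forall>t\<in>\<Lambda>. pair t L = pair t K)"
    using finite_codimension[OF assms(1,2), of n] by blast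
  define A where "A = insert \<one>\<^bsub>uhull\<^esub> (?e ` Bs)"
  have A: "A \<subseteq> filt n" using Bs(3) by (auto simp: A_def filt_def quot_zero)
  then have Ac: "A \<subseteq> carrier uhull" using submodule.subset[OF H.is_module[OF filt_subspace]] by blast
  interpret S: submodule F "H.span A" uhull by (rule H.span_is_submodule[OF Ac])
  have "(a, cls L) \<in> H.span A" if a: "a \<in> carrier F" "L \<in> vdeg n" for a L
  proof -
    obtain K where K: "K \<in> vdeg n" "?e K \<in> H.span (?e ` Bs)" "\<And>t. t \<in> \<Lambda> \<Longrightarrow> pair t L = pair t K"
      using Bs(4)[OF a(2)] by blast
    have w: "wcomb L" "wcomb K" using a(2) K(1) vdeg_vcomb vcomb_wcomb by blast+
    let ?D = "L @ smul (\<ominus> \<one>) K"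
    have D: "pair t ?D = pair t L \<ominus> pair t K" if "t \<in> wfuns" for t
      using that w by (simp add: pair_append pair_smul l_minus a_minus_def)
    have "pair t ?D = \<zero>" if t: "t \<in> \<Lambda>" for t
    proof -
      have "t \<in> wfuns" using t assms(2) by blast
      then show ?thesis using D K(3)[OF t] w by (simp add: a_minus_def r_neg)
    qed
    then have "pair t ?D = \<zero>" if "t \<in> T" for t using det[of ?D t] a(2) K(1) that by simp
    then have "pair t L \<ominus> pair t K = \<zero>" if "t \<in> T" for t using D[of t] that by simp
    then have "pair t L = pair t K" if "t \<in> T" for t
      using that w by (intro minus_zero_imp_eq[of "pair t L" "pair t K"]) simp_all
    then have "cls L = cls K" by (simp add: cls_eq_iff)
    then have "(a, cls L) = a \<odot>\<^bsub>uhull\<^esub> \<one>\<^bsub>uhull\<^esub> \<oplus>\<^bsub>uhull\<^esub> ?e K"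
      using a K(1) by (simp add: quot_smult quot_add quot_zero cls_eq_iff pair_append vdeg_vcomb smul_def)
    moreover have "\<one>\<^bsub>uhull\<^esub> \<in> H.span A" using H.in_own_span[OF Ac] by (auto simp: A_def)
    moreover have "?e K \<in> H.span A"
      using K(2) H.span_is_monotone[of "?e ` Bs" A] by (auto simp: A_def)
    ultimately show ?thesis using S.m_closed S.smult_closed[OF a(1)] by metis
  qed
  then have "filt n \<subseteq> H.span A" by (auto simp: filt_def)
  moreover have "H.span A \<subseteq> filt n" by (rule H.span_is_subset[OF A H.is_module[OF filt_subspace]])
  moreover have "card A \<le> Suc (card \<Lambda>)"
    unfolding A_def using Bs(1,2) card_image_le[OF Bs(1), of ?e] card_insert_le_m1[of "Suc (card \<Lambda>)" "?e ` Bs"] by auto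
  ultimately show ?thesis using A Bs(1) by (intro exI[of _ A]) (auto simp: A_def)
qed

lemma dim_filt_le:
  assumes "finite \<Lambda>" "\<Lambda> \<subseteq> wfuns"
    and "\<And>L t. L \<in> vdeg n \<Longrightarrow> \<forall>s\<in>\<Lambda>. pair s L = \<zero> \<Longrightarrow> t \<in> T \<Longrightarrow> pair t L = \<zero>"
  shows "vectorspace.fin_dim F (uhull\<lparr>carrier := filt n\<rparr>)"
    and "vectorspace.dim F (uhull\<lparr>carrier := filt n\<rparr>) \<le> Suc (card \<Lambda>)"
proof -
  interpret H: vectorspace F uhull by (rule uhull_vectorspace)
  interpret N: vectorspace F "uhull\<lparr>carrier := filt n\<rparr>" by (rule H.subspace_is_vs[OF filt_subspace])
  obtain A where A: "finite A" "card A \<le> Suc (card \<Lambda>)" "A \<subseteq> filt n" "H.span A = filt n"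
    using filt_spanning[OF assms] by blast
  have "N.gen_set A" using H.span_li_not_depend(1)[OF A(3) H.is_module[OF filt_subspace]] A(4) by simp
  then show "N.fin_dim" "N.dim \<le> Suc (card \<Lambda>)"
    using A N.gen_ge_dim[OF A(1)] unfolding N.fin_dim_def by force+
qed

lemma pair_delta_determined:
  assumes "t \<in> wfuns" "wcomb L" "finite X" "\<And>p. p \<in> set L \<Longrightarrow> t (snd p) \<noteq> \<zero> \<Longrightarrow> snd p \<in> X"
    "\<And>x. x \<in> X \<Longrightarrow> pair (delta x) L = \<zero>"
  shows "pair t L = \<zero>"
proof -
  have d: "delta x \<in> wfuns" for x by (auto simp: delta_def intro: wfunI)
  have "pair t L = pair (\<lambda>w. \<Oplus>x\<in>X. t x \<otimes> delta x w) L"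
  proof (rule pair_cong)
    fix p assume p: "p \<in> set L"
    have "(\<Oplus>x\<in>X. t x \<otimes> delta x (snd p)) = (\<Oplus>x\<in>X. if snd p = x then t x else \<zero>)"
      using assms(1) by (intro finsum_cong') (auto simp: delta_def)
    also have "\<dots> = t (snd p)"
    proof (cases "snd p \<in> X")
      case True
      then show ?thesis using assms(1,3) by (intro add.finprod_singleton) auto
    next
      case False
      then have "t (snd p) = \<zero>" using assms(4)[OF p] by blast
      moreover have "(\<Oplus>x\<in>X. if snd p = x then t x else \<zero>) = (\<Oplus>x\<in>X. \<zero>)"
        using False by (intro finsum_cong') auto
      ultimately show ?thesis by simp
    qed
    finally show "t (snd p) = (\<Oplus>x\<in>X. t x \<otimes> delta x (snd p))" by simp
  qed
  also have "\<dots> = (\<Oplus>x\<in>X. t x \<otimes> pair (delta x) L)"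
    using assms(1-3) d by (intro pair_finsum_fun) auto
  also have "\<dots> = (\<Oplus>x\<in>X. \<zero>)" using assms(1,5) by (intro finsum_cong') auto
  finally show ?thesis by simp
qed

text \<open>Finite dimension must be known before the size of an independent set can be compared
  with \<open>dim\<close>. The point masses on the finitely many binary words of length at most
  \<open>n\<close> provide it.\<close>

lemma fin_dim_filt: "vectorspace.fin_dim F (uhull\<lparr>carrier := filt n\<rparr>)"
proof (rule dim_filt_le(1)[of "delta ` bwords n"])
  show "delta ` bwords n \<subseteq> wfuns" by (auto simp: delta_def intro: wfunI)
  show "pair t L = \<zero>" if "L \<in> vdeg n" "\<forall>s\<in>delta ` bwords n. pair s L = \<zero>" "t \<in> T" for L t
  proof (rule pair_delta_determined[of _ _ "bwords n"])
    show "snd p \<in> bwords n" if "p \<in> set L" "t (snd p) \<noteq> \<zero>" for p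
      using that T_letters[OF \<open>t \<in> T\<close>] \<open>L \<in> vdeg n\<close> unfolding bwords_def vdeg_def by blast
  qed (use that vdeg_vcomb in auto)
qed simp

lemma dim_filt_ge:
  assumes "dual T W g" "\<And>w. w \<in> W \<Longrightarrow> length w = n" "n > 0"
  shows "card W \<le> vectorspace.dim F (uhull\<lparr>carrier := filt n\<rparr>)"
proof -
  interpret H: vectorspace F uhull by (rule uhull_vectorspace)
  interpret N: vectorspace F "uhull\<lparr>carrier := filt n\<rparr>" by (rule H.subspace_is_vs[OF filt_subspace])
  let ?e = "\<lambda>w. (\<zero>, cls (single w))"
  have W: "finite W" "\<And>w. w \<in> W \<Longrightarrow> g w \<in> T"
    "\<And>w v. w \<in> W \<Longrightarrow> v \<in> W \<Longrightarrow> g w v = (if v = w then \<one> else \<zero>)"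
    using assms(1) unfolding dual_def by blast+
  have "w \<noteq> []" if "w \<in> W" for w using assms(2)[OF that] assms(3) by auto
  then have ef: "?e ` W \<subseteq> filt n" using assms(2) by (auto simp: filt_def intro!: imageI)
  have ec: "?e ` W \<subseteq> carrier uhull" using ef submodule.subset[OF H.is_module[OF filt_subspace]] by blast
  have nsp: "?e w \<notin> H.span (?e ` W')" if w: "w \<in> W" "W' \<subseteq> W" "w \<notin> W'" for w W'
  proof
    assume in_span: "?e w \<in> H.span (?e ` W')"
    \<comment> \<open>The kernel of \<open>g w\<close>, which is well defined on classes because
      \<open>g w\<close> lies in \<open>T\<close>. It contains the classes of all words in
      \<open>W'\<close> but not that of \<open>w\<close>.\<close>
    define Z where "Z = carrier F \<times> cls ` {L. vcomb L \<and> pair (g w) L = \<zero>}"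
    have gT: "g w \<in> T" using W(2) w by blast
    have "submodule F Z uhull"
    proof (rule submodule.intro)
      show "Module.module F uhull" by (rule H.module_axioms)
      show "Z \<subseteq> carrier uhull" by (auto simp: Z_def)
      show "\<zero>\<^bsub>uhull\<^esub> \<in> Z" by (auto simp: Z_def quot_zero)
      show "x \<oplus>\<^bsub>uhull\<^esub> y \<in> Z" if "x \<in> Z" "y \<in> Z" for x y
        using that gT by (auto simp: Z_def quot_add pair_append intro!: imageI)
      show "c \<odot>\<^bsub>uhull\<^esub> x \<in> Z" if "c \<in> carrier F" "x \<in> Z" for c x
        using that gT by (auto simp: Z_def quot_smult pair_smul intro!: imageI)
    qed
    moreover have "?e ` W' \<subseteq> Z"
    proof
      fix x assume "x \<in> ?e ` W'"
      then obtain v where v: "v \<in> W'" "x = ?e v" by blast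
      then have "v \<in> W" using w by blast
      then have "g w v = \<zero>" "v \<noteq> []" using W(3)[of w v] w v assms(2)[of v] assms(3) by auto
      then show "x \<in> Z" using v gT by (auto simp: Z_def intro!: imageI)
    qed
    ultimately have "?e w \<in> Z" using in_span H.span_is_subset by blast
    then obtain L where "cls (single w) = cls L" "pair (g w) L = \<zero>" by (auto simp: Z_def)
    then have "g w w = \<zero>" using gT by (auto simp: cls_eq_iff)
    then show False using W(3)[of w w] w by simp
  qed
  have inj: "inj_on ?e W"
  proof (rule inj_onI)
    fix w v assume "w \<in> W" "v \<in> W" "?e w = ?e v"
    moreover have "g w w = \<one>" "g w v = (if v = w then \<one> else \<zero>)" using W(3) \<open>w \<in> W\<close> \<open>v \<in> W\<close> by auto
    ultimately show "w = v" using W(2)[of w] by (auto simp: cls_eq_iff split: if_splits)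
  qed
  have "H.lin_indpt (?e ` W)"
  proof
    assume "H.lin_dep (?e ` W)"
    then obtain u where u: "u \<in> ?e ` W" "u \<in> H.span (?e ` W - {u})"
      using H.lindep_span[OF ec] W(1) by blast
    then obtain w where w: "w \<in> W" "u = ?e w" by blast
    have "?e ` W - {u} = ?e ` (W - {w})" using w inj by (auto simp: inj_on_def)
    then show False using nsp[of w "W - {w}"] u(2) w by auto
  qed
  then have "N.lin_indpt (?e ` W)"
    using H.span_li_not_depend(2)[OF ef H.is_module[OF filt_subspace]] by simp
  then have "card (?e ` W) \<le> N.dim"
    using N.li_le_dim(2)[OF fin_dim_filt, of "?e ` W"] ef by simp
  then show ?thesis using card_image[OF inj] by simp
qed

end

section \<open>Choice of the parameters\<close>

text \<open>\<open>m\<close> enters the left side quadratically, while \<open>w n\<close> eventually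
  exceeds \<open>n ^ 3\<close>; the constants are absorbed by taking \<open>m\<close> large.\<close>

lemma super_polynomial_dominates:
  assumes "super_polynomial w" "s > 0"
  shows "\<exists>m\<ge>m0. C + K * (2 * m + 3) ^ 2 \<le> w (s * Suc m)"
proof -
  have "filterlim (\<lambda>n. real (w n) / real n powr 3) at_top sequentially"
    by (rule assms(1)[unfolded super_polynomial_def, rule_format]) simp
  then have "eventually (\<lambda>n. 1 \<le> real (w n) / real n powr 3) sequentially"
    unfolding filterlim_at_top by blast
  then obtain n0 where n0: "\<And>n. n \<ge> n0 \<Longrightarrow> 1 \<le> real (w n) / real n powr 3"
    unfolding eventually_sequentially by blast
  \<comment> \<open>The factor 9 is the square of 3 in \<open>2 * m + 3 \<le> 3 * Suc m\<close>; now
    \<open>C + 9 * K \<le> Suc m\<close> turns the square into a cube.\<close>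
  define m where "m = m0 + n0 + C + 9 * K"
  define n where "n = s * Suc m"
  have "1 * Suc m \<le> s * Suc m" using assms(2) by (intro mult_le_mono1) simp
  then have n: "n \<ge> Suc m" by (simp only: n_def mult_1)
  have "real n ^ 3 \<le> real (w n)"
  proof -
    have "n \<ge> n0" "n > 0" using n by (auto simp: m_def)
    then have "real n powr 3 \<le> real (w n)" using n0[of n] by (simp add: le_divide_eq split: if_splits)
    then show ?thesis using \<open>n > 0\<close> powr_realpow[of "real n" 3] by simp
  qed
  then have "n ^ 3 \<le> w n" by (metis of_nat_le_iff of_nat_power)
  have "C + K * (2 * m + 3) ^ 2 \<le> C * Suc m ^ 2 + K * (3 * Suc m) ^ 2"
    by (intro add_mono mult_le_mono power_mono) auto
  also have "\<dots> = (C + 9 * K) * Suc m ^ 2" by (simp add: power_mult_distrib algebra_simps del: power_Suc mult_Suc_right mult_Suc)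
  also have "\<dots> \<le> Suc m * Suc m ^ 2" by (intro mult_le_mono1) (simp add: m_def)
  also have "\<dots> = Suc m ^ 3" by (simp only: power3_eq_cube power2_eq_square mult.assoc)
  also have "\<dots> \<le> n ^ 3" using n by (rule power_mono) simp
  also have "\<dots> \<le> w n" by fact
  finally show ?thesis by (intro exI[of _ m]) (simp add: n_def m_def)
qed

lemma eventually_poly_le_power2:
  "eventually (\<lambda>m. (K::real) * real m ^ D \<le> 2 ^ m / 2) sequentially"
proof -
  have "filterlim (\<lambda>m. real m * ln 2) at_top sequentially"
    by (subst mult.commute) (rule filterlim_tendsto_pos_mult_at_top[OF tendsto_const _ filterlim_real_sequentially], simp)
  from filterlim_compose[OF tendsto_power_div_exp_0[of D] this]
  have "(\<lambda>m. (real m * ln 2) ^ D / exp (real m * ln 2)) \<longlonglongrightarrow> 0" .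
  then have "(\<lambda>m. (K / ln 2 ^ D) * ((real m * ln 2) ^ D / exp (real m * ln 2))) \<longlonglongrightarrow> (K / ln 2 ^ D) * 0"
    by (intro tendsto_mult tendsto_const)
  then have "eventually (\<lambda>m. (K / ln 2 ^ D) * ((real m * ln 2) ^ D / exp (real m * ln 2)) < 1 / 2) sequentially"
    by (rule order_tendstoD(2)) simp
  then show ?thesis
  proof (rule eventually_mono)
    fix m assume *: "(K / ln 2 ^ D) * ((real m * ln 2) ^ D / exp (real m * ln 2)) < 1 / 2"
    have "exp (real m * ln 2) = (2::real) ^ m" by (simp add: exp_of_nat_mult)
    then have "K * real m ^ D / 2 ^ m < 1 / 2" using * by (simp add: power_mult_distrib)
    then show "K * real m ^ D \<le> 2 ^ m / 2" by (simp add: field_simps)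
  qed
qed

text \<open>In terms of the length \<open>s * m\<close>, the right side is an exponential with base
  the \<open>s\<close>-th root of 2, which exceeds 1 for every fixed \<open>s\<close>. Half of it
  bounds \<open>f\<close>, the other half the number of relations.\<close>

lemma subexponential_dominated:
  assumes "subexponential f" "s > 0"
  shows "\<exists>m\<ge>m0. f (s * m) + 2 + K * (s * m + 1) ^ D \<le> 2 ^ m"
proof -
  \<comment> \<open>The \<open>s\<close>-th root makes \<open>c ^ (s * m)\<close> equal to
    \<open>(3 / 2) ^ m\<close>, which stays well below \<open>2 ^ m\<close>.\<close>
  define c where "c = root s (3 / 2)"
  have c: "c > 1" "c ^ s = 3 / 2" using assms(2) by (simp_all add: c_def)
  have "limsup (\<lambda>n. ereal (root n (real (f n)))) < ereal c"
    using assms(1) c(1) unfolding subexponential_def by simp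
  then have "eventually (\<lambda>n. ereal (root n (real (f n))) < ereal c) sequentially"
    by (rule Limsup_lessD)
  then obtain n0 where n0: "\<And>n. n \<ge> n0 \<Longrightarrow> root n (real (f n)) < c"
    unfolding eventually_sequentially by auto
  have "eventually (\<lambda>m. real (2 + K * (s + 1) ^ D) * real m ^ D \<le> 2 ^ m / 2) sequentially"
    by (rule eventually_poly_le_power2)
  then obtain m1 where m1: "\<And>m. m \<ge> m1 \<Longrightarrow> real (2 + K * (s + 1) ^ D) * real m ^ D \<le> 2 ^ m / 2"
    unfolding eventually_sequentially by blast
  \<comment> \<open>The summand 3 ensures \<open>(3 / 4) ^ m \<le> 1 / 2\<close>, that is,
    \<open>(3 / 2) ^ m \<le> 2 ^ m / 2\<close>.\<close>
  define m where "m = m0 + m1 + n0 + 3"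
  have "s * m \<ge> m" "m > 0" using assms(2) by (simp_all add: m_def)
  moreover have "n0 \<le> m" by (simp add: m_def)
  ultimately have sm: "s * m \<ge> n0" "s * m > 0" by linarith+
  have "real (f (s * m)) = root (s * m) (real (f (s * m))) ^ (s * m)" using sm(2) by simp
  also have "\<dots> \<le> c ^ (s * m)" using n0[OF sm(1)] by (intro power_mono) (auto intro: less_imp_le real_root_ge_zero)
  also have "\<dots> = (3 / 2) ^ m" by (simp add: power_mult c(2))
  also have "\<dots> \<le> 2 ^ m / 2"
  proof -
    have "(3 / 4 :: real) ^ m \<le> (3 / 4) ^ 3" by (rule power_decreasing) (simp_all add: m_def)
    also have "\<dots> \<le> 1 / 2" by (simp add: power3_eq_cube)
    finally have "(3 / 4 :: real) ^ m * 2 ^ m \<le> 1 / 2 * 2 ^ m" by (rule mult_right_mono) simp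
    then show ?thesis by (simp flip: power_mult_distrib)
  qed
  finally have f: "real (f (s * m)) \<le> 2 ^ m / 2" .
  have "m1 \<le> m" by (simp add: m_def)
  have "2 + K * (s * m + 1) ^ D \<le> 2 * m ^ D + K * ((s + 1) * m) ^ D"
    using \<open>m > 0\<close> by (intro add_mono mult_le_mono power_mono) auto
  also have "\<dots> = (2 + K * (s + 1) ^ D) * m ^ D" unfolding power_mult_distrib[of "s + 1"] by (simp only: add_mult_distrib mult.assoc)
  finally have "real (2 + K * (s * m + 1) ^ D) \<le> real ((2 + K * (s + 1) ^ D) * m ^ D)" by (rule of_nat_mono)
  also have "\<dots> \<le> 2 ^ m / 2"
    using m1[OF \<open>m1 \<le> m\<close>] by (simp only: of_nat_mult of_nat_power)
  finally have "real (f (s * m) + 2 + K * (s * m + 1) ^ D) \<le> real (2 ^ m)" using f by simp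
  then have "f (s * m) + 2 + K * (s * m + 1) ^ D \<le> 2 ^ m" by (simp only: of_nat_le_iff)
  then show ?thesis by (intro exI[of _ m]) (simp add: m_def)
qed

section \<open>Stages, their iteration and the resulting algebra\<close>

context word_field
begin

lemma fspace_kernel:
  assumes "fspace s E" "\<forall>\<rho>\<in>P. linfun E \<rho>"
  shows "fspace s {h \<in> E. \<forall>\<rho>\<in>P. \<rho> h = \<zero>}"
proof -
  have zero: "\<rho> (\<lambda>_. \<zero>) = \<zero>" if "\<rho> \<in> P" for \<rho>
  proof -
    have "linfun E \<rho>" using assms(2) that by blast
    then have "\<forall>h\<in>E. \<rho> h \<in> carrier F" "\<forall>c\<in>carrier F. \<forall>h\<in>E. \<rho> (\<lambda>w. c \<otimes> h w) = c \<otimes> \<rho> h"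
      by (simp_all add: linfun_def)
    from this(1)[THEN bspec, OF fspaceD(2)[OF assms(1)]]
      this(2)[THEN bspec, OF zero_closed, THEN bspec, OF fspaceD(2)[OF assms(1)]]
    show ?thesis by simp
  qed
  have lin: "\<And>\<rho> h g. \<rho> \<in> P \<Longrightarrow> h \<in> E \<Longrightarrow> g \<in> E \<Longrightarrow> \<rho> (\<lambda>w. h w \<oplus> g w) = \<rho> h \<oplus> \<rho> g"
    "\<And>\<rho> c h. \<rho> \<in> P \<Longrightarrow> c \<in> carrier F \<Longrightarrow> h \<in> E \<Longrightarrow> \<rho> (\<lambda>w. c \<otimes> h w) = c \<otimes> \<rho> h"
    using assms(2) unfolding linfun_def by blast+
  let ?K = "{h \<in> E. \<forall>\<rho>\<in>P. \<rho> h = \<zero>}"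
  have "(\<lambda>w. h w \<oplus> g w) \<in> ?K" if hg: "h \<in> ?K" "g \<in> ?K" for h g
  proof -
    have "\<rho> (\<lambda>w. h w \<oplus> g w) = \<zero>" if "\<rho> \<in> P" for \<rho>
    proof -
      have "\<rho> h = \<zero>" "\<rho> g = \<zero>" using hg that by blast+
      then show ?thesis using lin(1)[OF that, of h g] hg by simp
    qed
    then show ?thesis using hg fspaceD(3)[OF assms(1), of h g] by blast
  qed
  moreover have "(\<lambda>w. c \<otimes> h w) \<in> ?K" if ch: "c \<in> carrier F" "h \<in> ?K" for c h
  proof -
    have "\<rho> (\<lambda>w. c \<otimes> h w) = \<zero>" if "\<rho> \<in> P" for \<rho>
    proof -
      have "\<rho> h = \<zero>" using ch that by blast
      then show ?thesis using lin(2)[OF that, of c h] ch by simp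
    qed
    then show ?thesis using ch fspaceD(4)[OF assms(1), of c h] by blast
  qed
  moreover have "(\<lambda>_. \<zero>) \<in> ?K" using zero fspaceD(2)[OF assms(1)] by blast
  moreover have "?K \<subseteq> wfuns_len s" using fspaceD(1)[OF assms(1)] by blast
  ultimately show ?thesis unfolding fspace_def by blast
qed

lemma blocks_refl:
  assumes "fspace s E" "s > 0" shows "blocks s E s E"
  unfolding blocks_def
proof (intro conjI ballI allI impI)
  show "E \<subseteq> wfuns_len s" using fspaceD(1)[OF assms(1)] by blast
  fix h and u v :: "nat list" assume h: "h \<in> E" "s dvd length u"
  have hl: "h \<in> wfuns_len s" using h(1) fspaceD(1)[OF assms(1)] by blast
  show "restr s u v h \<in> E"
  proof (cases "u = [] \<and> v = []")
    case True
    then have "restr s u v h = h" using wfuns_len_out[OF hl] by (auto simp: restr_def)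
    then show ?thesis using h by simp
  next
    case False
    then have "restr s u v h = (\<lambda>_. \<zero>)" using wfuns_len_out[OF hl] by (auto simp: restr_def)
    then show ?thesis using fspaceD(2)[OF assms(1)] by simp
  qed
qed simp

text \<open>Rank two is the least that makes tensor powers grow exponentially; it also supplies the
  nonzero functional used for padding.\<close>

definition stage :: "nat \<Rightarrow> (nat list \<Rightarrow> 'f) set \<Rightarrow> bool" where
  "stage s E \<longleftrightarrow> s > 0 \<and> fspace s E \<and> (\<exists>W g. dual E W g \<and> 2 \<le> card W)"

text \<open>Quantifying over every space built on \<open>E\<close> secures the bound at length
  \<open>n\<close> before the later stages exist. In the count, \<open>bwords s\<close> accounts for
  the functionals of earlier stages, \<open>\<Lambda>\<close> for the present and later ones, and
  \<open>Suc\<close> for the unit of the hull.\<close>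

definition thin_at :: "nat \<Rightarrow> nat \<Rightarrow> nat \<Rightarrow> nat \<Rightarrow> (nat list \<Rightarrow> 'f) set \<Rightarrow> bool" where
  "thin_at n b s B E \<longleftrightarrow> (\<exists>\<Lambda>. finite \<Lambda> \<and> \<Lambda> \<subseteq> wfuns \<and> Suc (card (bwords s) + card \<Lambda>) \<le> b \<and>
     (\<forall>C E' g u v L. blocks B E C E' \<and> C > 0 \<and> g \<in> E' \<and> wcomb L \<and> (\<forall>p\<in>set L. length (snd p) \<le> n) \<and>
        (\<forall>t\<in>\<Lambda>. pair t L = \<zero>) \<longrightarrow> pair (\<lambda>w. g (u @ w @ v)) L = \<zero>))"

text \<open>The condition \<open>n \<ge> s\<close> drives the thin lengths to infinity along a chain
  of steps.\<close>

definition stage_step :: "(nat \<Rightarrow> nat) \<Rightarrow> (nat \<Rightarrow> nat) \<Rightarrow> nat \<Rightarrow> nat \<Rightarrow> (nat list \<Rightarrow> 'f) set \<Rightarrow>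
    nat \<Rightarrow> (nat list \<Rightarrow> 'f) set \<Rightarrow> bool" where
  "stage_step f \<omega> d s E B E' \<longleftrightarrow> s < B \<and> d < B \<and> blocks s E B E' \<and>
     (\<forall>h\<in>E'. \<forall>\<rho>\<in>nil_rels d B. \<rho> h = \<zero>) \<and> (\<exists>W g. dual E' W g \<and> f B \<le> card W) \<and>
     (\<exists>n\<ge>s. thin_at n (\<omega> n) s B E')"

lemma stage_step_exists:
  assumes st: "stage s E" and f: "subexponential f" and \<omega>: "super_polynomial \<omega>"
  shows "\<exists>B E'. stage B E' \<and> stage_step f \<omega> d s E B E'"
proof -
  have s: "s > 0" "fspace s E" using st by (auto simp: stage_def)
  obtain W g where W: "dual E W g" "2 \<le> card W" using st by (auto simp: stage_def)
  then obtain w0 where w0: "w0 \<in> W" by fastforce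
  define \<xi> where "\<xi> = g w0"
  have \<xi>: "\<xi> \<in> E" "\<xi> w0 = \<one>" "length w0 = s"
    using W(1) w0 dual_length(1)[OF s(2) W(1) w0] by (auto simp: \<xi>_def dual_def)
  \<comment> \<open>Only \<open>s\<close> and \<open>\<omega>\<close> enter this choice. The fourth
    power counts two free slots and two partial contexts of a window functional.\<close>
  obtain m where m: "Suc (card (bwords s)) + card (bwords s) ^ 4 * (2 * m + 3) ^ 2 \<le> \<omega> (s * Suc m)"
    using super_polynomial_dominates[OF \<omega> s(1)] by blast
  define s1 where "s1 = s * Suc m"
  define E1 where "E1 = padded s E m \<xi>"
  have s1: "s1 > 0" "s \<le> s1" using s(1) by (simp_all add: s1_def)
  have E1: "fspace s1 E1" unfolding s1_def E1_def by (rule fspace_padded[OF s(2) \<xi>(1) s(1)])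
  have bE1: "blocks s E s1 E1"
    unfolding s1_def E1_def by (rule blocks_bpow[OF padded_subset_bpow[OF s(2) \<xi>(1) s(1)]])
  obtain W1 g1 where W1: "dual E1 W1 g1" "card W1 = card W"
    using dual_padded[OF s(2) W(1) s(1) w0] unfolding E1_def \<xi>_def by blast
  \<comment> \<open>\<open>d + 2\<close> yields \<open>d < B\<close> and at least two padded blocks,
    as the window argument requires. The summand 2 in the second inequality keeps the rank at least
    two after the relations are imposed.\<close>
  obtain m' where m': "m' \<ge> d + 2"
    "f (s1 * m') + 2 + card (bwords d) ^ 2 * (s1 * m' + 1) ^ card (bwords d) \<le> 2 ^ m'"
    using subexponential_dominated[OF f s1(1)] by blast
  define B where "B = s1 * m'"
  have "m' \<le> s1 * m'" using s1(1) by simp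
  moreover have "2 * s1 \<le> s1 * m'" using m'(1) by simp
  ultimately have B: "d < B" "2 * s1 \<le> B" "B > 0" using m'(1) s1(1) unfolding B_def by linarith+
  let ?E2 = "bpow s1 E1 m'"
  have E2: "fspace B ?E2" unfolding B_def by (rule fspace_bpow[OF E1])
  obtain W2 g2 where W2: "dual ?E2 W2 g2" "card W2 = card W1 ^ m'"
    using dual_bpow[OF E1 W1(1) s1(1)] by blast
  define E' where "E' = {h \<in> ?E2. \<forall>\<rho>\<in>nil_rels d B. \<rho> h = \<zero>}"
  have lin: "\<forall>\<rho>\<in>nil_rels d B. linfun ?E2 \<rho>"
    using linfun_rel[OF E2] by (auto simp: nil_rels_def)
  have E': "fspace B E'" unfolding E'_def by (rule fspace_kernel[OF E2 lin])
  obtain W3 g3 where W3: "dual E' W3 g3" "card W2 \<le> card W3 + card (nil_rels d B)"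
    using dual_kernel[OF finite_nil_rels E2 W2(1) lin] unfolding E'_def by blast
  have "2 ^ m' \<le> card W2" unfolding W2(2) W1(2) using W(2) by (intro power_mono) auto
  then have cW3: "f B + 2 \<le> card W3"
    using m'(2) W3(2) card_nil_rels[of d B] unfolding B_def by linarith
  have bE': "blocks s1 E1 B E'"
    unfolding B_def by (rule blocks_bpow) (auto simp: E'_def)
  \<comment> \<open>Every later space restricts to the padded space on aligned blocks of length
    \<open>s1\<close>, so the bound fixed with \<open>m\<close> survives the tensor power, the
    relations and all further stages.\<close>
  have "thin_at s1 (\<omega> s1) s B E'"
    unfolding thin_at_def
  proof (intro exI[of _ "window_funs s m \<xi>"] conjI allI impI; (elim conjE)?)
    show "finite (window_funs s m \<xi>)" by (rule finite_window_funs)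
    show "window_funs s m \<xi> \<subseteq> wfuns" using window_funs_wfuns fspaceD(1)[OF s(2) \<xi>(1)] by blast
    show "Suc (card (bwords s) + card (window_funs s m \<xi>)) \<le> \<omega> s1"
      using m card_window_funs[of s m \<xi>] by (simp add: s1_def mult.commute)
    fix C E3 g and u v :: "nat list" and L
    assume b: "blocks B E' C E3" and C: "C > 0" and g: "g \<in> E3" and L: "wcomb L"
      "\<forall>p\<in>set L. length (snd p) \<le> s1" "\<forall>t\<in>window_funs s m \<xi>. pair t L = \<zero>"
    have b1: "blocks s1 E1 C E3" by (rule blocks_trans[OF bE' b E1 s1(1) B(3)])
    have gC: "g \<in> wfuns_len C" using b g unfolding blocks_def by blast
    have "\<forall>u v. s * Suc m dvd length u \<longrightarrow> restr (s * Suc m) u v g \<in> padded s E m \<xi>"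
      using b1 g unfolding blocks_def s1_def E1_def by blast
    moreover have "s * Suc m dvd C" using b1 unfolding blocks_def s1_def by blast
    moreover have "B \<le> C" using b C dvd_imp_le unfolding blocks_def by blast
    then have "2 * (s * Suc m) \<le> C" using B(2) unfolding s1_def by linarith
    ultimately show "pair (\<lambda>w. g (u @ w @ v)) L = \<zero>"
      using L unfolding s1_def by (intro window_funs_span[OF s(2) \<xi> s(1) gC]) auto
  qed
  moreover have "blocks s E B E'" by (rule blocks_trans[OF bE1 bE' s(2) s(1) s1(1)])
  moreover have "s < B" using s1 B by linarith
  ultimately have "stage_step f \<omega> d s E B E'"
    unfolding stage_step_def using B(1) W3(1) cW3 s1(2) by (auto simp: E'_def intro: exI[of _ s1])
  moreover have "stage B E'"
    unfolding stage_def using B(3) E' W3(1) cW3 by (meson add_leE)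
  ultimately show ?thesis by blast
qed

lemma stage_initial: "stage 1 (wfuns_len 1)"
proof -
  have "fspace 1 (wfuns_len 1)"
    unfolding fspace_def using wfuns_len_add wfuns_len_smult wfuns_len_zero by blast
  moreover have "dual (wfuns_len 1) {[0], [1]} delta"
    unfolding dual_def using delta_wfuns_len[of _ 1] by (auto simp: delta_def bwords_def)
  moreover have "card {[0::nat], [1]} = 2" by simp
  ultimately show ?thesis
    unfolding stage_def by (intro conjI exI[of _ "{[0], [1]}"] exI[of _ delta]) simp_all
qed

lemma oscillating_nil_algebra:
  assumes f: "subexponential f" and \<omega>: "super_polynomial \<omega>"
  shows "\<exists>(R :: ('f, 'f free_coset) module) V.
           nonunital_algebra F R \<and> finitely_generated F R \<and> nil_algebra R \<and>
           generating_subspace F R V \<and>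
           infinite {n. n \<ge> 1 \<and> growth F R V n \<le> \<omega> n} \<and>
           infinite {n. n \<ge> 1 \<and> growth F R V n \<ge> f n}"
proof -
  \<comment> \<open>Step \<open>k\<close> imposes the relations for degree \<open>k\<close>, so
    every combination is covered from some stage on.\<close>
  have "\<exists>S. \<forall>k. stage (fst (S k)) (snd (S k)) \<and>
      stage_step f \<omega> k (fst (S k)) (snd (S k)) (fst (S (Suc k))) (snd (S (Suc k)))"
  proof (rule dependent_nat_choice)
    show "\<exists>x. stage (fst x) (snd x)" using stage_initial by (intro exI[of _ "(1, wfuns_len 1)"]) simp
    show "\<exists>y. stage (fst y) (snd y) \<and> stage_step f \<omega> k (fst x) (snd x) (fst y) (snd y)"
      if "stage (fst x) (snd x)" for x k
      using stage_step_exists[OF that f \<omega>, of k] by auto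
  qed
  then obtain S where S: "\<And>k. stage (fst (S k)) (snd (S k))"
    "\<And>k. stage_step f \<omega> k (fst (S k)) (snd (S k)) (fst (S (Suc k))) (snd (S (Suc k)))" by blast
  define s E where "s k = fst (S k)" and "E k = snd (S k)" for k
  have st: "s k > 0" "fspace (s k) (E k)" "\<exists>W g. dual (E k) W g \<and> 2 \<le> card W" for k
    using S(1)[of k] by (auto simp: stage_def s_def E_def)
  have step: "stage_step f \<omega> k (s k) (E k) (s (Suc k)) (E (Suc k))" for k
    using S(2) by (simp add: s_def E_def)
  have smono: "s j \<le> s k" if "j \<le> k" for j k
    using step by (intro lift_Suc_mono_le[OF _ that]) (auto simp: stage_step_def intro: less_imp_le)
  have sk: "k \<le> s k" for k
  proof (induction k)
    case (Suc k)
    then show ?case using step[of k] unfolding stage_step_def by linarith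
  qed simp
  have bl: "blocks (s j) (E j) (s k) (E k)" if "j \<le> k" for j k
    using that
  proof (induction k rule: dec_induct)
    case base
    show ?case by (rule blocks_refl[OF st(2,1)])
  next
    case (step k)
    then show ?case
      using blocks_trans[OF step.IH _ st(2,1,1)] \<open>\<And>k. stage_step f \<omega> k (s k) (E k) (s (Suc k)) (E (Suc k))\<close>
      unfolding stage_step_def by blast
  qed
  have Es: "g \<in> E k \<Longrightarrow> g \<in> wfuns_len (s k)" for g k using fspaceD(1)[OF st(2)] by blast
  \<comment> \<open>Closure under translates is all that the quotient asks for; the block conditions
    between stages enter only when vanishing is proved.\<close>
  define T where "T = {\<lambda>w. g (u @ w @ v) | g u v k. g \<in> E k}"
  have TE: "g \<in> E k \<Longrightarrow> g \<in> T" for g k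
    unfolding T_def by (intro CollectI exI[of _ g] exI[of _ "[]"] exI[of _ k]) simp
  interpret translation_system F T
  proof
    show "T \<subseteq> wfuns"
    proof
      fix t assume "t \<in> T"
      then obtain g u v k where g: "t = (\<lambda>w. g (u @ w @ v))" "g \<in> E k" by (auto simp: T_def)
      then show "t \<in> wfuns" using wfuns_lenD(1)[OF Es[OF g(2)]] by simp
    qed
    show "(\<lambda>w. t (u @ w)) \<in> T" if t: "t \<in> T" for t u
    proof -
      obtain g u' v k where "t = (\<lambda>w. g (u' @ w @ v))" "g \<in> E k" using t by (auto simp: T_def)
      then show ?thesis unfolding T_def
        by (intro CollectI exI[of _ g] exI[of _ "u' @ u"] exI[of _ v] exI[of _ k]) simp
    qed
    show "(\<lambda>w. t (w @ u)) \<in> T" if t: "t \<in> T" for t u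
    proof -
      obtain g u' v k where "t = (\<lambda>w. g (u' @ w @ v))" "g \<in> E k" using t by (auto simp: T_def)
      then show ?thesis unfolding T_def
        by (intro CollectI exI[of _ g] exI[of _ u'] exI[of _ "u @ v"] exI[of _ k]) simp
    qed
    show "set w \<subseteq> {0, 1}" if t: "t \<in> T" "t w \<noteq> \<zero>" for t w
    proof -
      obtain g u v k where g: "t = (\<lambda>w. g (u @ w @ v))" "g \<in> E k" using t(1) by (auto simp: T_def)
      then show ?thesis using wfuns_lenD(3)[OF Es[OF g(2)], of "u @ w @ v"] t(2) by auto
    qed
  qed
  have nil: "nil_algebra quot"
  proof (rule nil_quot)
    fix L assume L: "vcomb L"
    \<comment> \<open>The degree of \<open>L\<close>, with 0 inserted for the empty combination.
      From stage \<open>Suc k\<close> on, the relations for degree \<open>k\<close> hold on every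
      aligned block of length \<open>B\<close>.\<close>
    define k where "k = Max (insert 0 ((\<lambda>p. length (snd p)) ` set L))"
    have k: "length (snd p) \<le> k" if "p \<in> set L" for p
      unfolding k_def using that by (intro Max_ge) auto
    define B where "B = s (Suc k)"
    have B: "k < B" using step[of k] by (simp add: stage_step_def B_def)
    have "pair t (lpow L (Suc (2 * B))) = \<zero>" if "t \<in> T" for t
    proof -
      obtain g u v j where g: "t = (\<lambda>w. g (u @ w @ v))" "g \<in> E j" using \<open>t \<in> T\<close> by (auto simp: T_def)
      have gs: "g \<in> wfuns_len (s j)" by (rule Es[OF g(2)])
      show ?thesis
      proof (cases "Suc k \<le> j")
        case True
        have "restr B u v g \<in> E (Suc k)" if "B dvd length u" for u v
          using bl[OF True] g(2) that unfolding blocks_def B_def by blast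
        then have "\<forall>u v. B dvd length u \<longrightarrow>
            restr B u v g \<in> wfuns_len B \<and> (\<forall>\<rho>\<in>nil_rels k B. \<rho> (restr B u v g) = \<zero>)"
          using Es step[of k] unfolding stage_step_def B_def by blast
        then show ?thesis
          unfolding g(1) using L k B wfuns_lenD(1)[OF gs] by (intro pair_lpow_zero[where d = k and B = B]) auto
      next
        case False
        \<comment> \<open>The remaining stages live on words of length at most \<open>B\<close>, so
          a product of more than \<open>2 * B\<close> nonempty words is already invisible to them.
          One exponent thus serves for all of \<open>T\<close>.\<close>
        then have "s j \<le> B" using smono[of j "Suc k"] by (simp add: B_def)
        show ?thesis
        proof (rule pair_zero)
          show "wcomb (lpow L (Suc (2 * B)))" using L by (intro wcomb_lpow) simp
          fix p assume "p \<in> set (lpow L (Suc (2 * B)))"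
          then have "Suc (2 * B) \<le> length (snd p)" by (rule length_lpow[OF L])
          then have "length (u @ snd p @ v) \<noteq> s j" using \<open>s j \<le> B\<close> by simp
          then show "t (snd p) = \<zero>" using wfuns_len_out[OF gs] g(1) by blast
        qed
      qed
    qed
    then show "\<exists>k. \<forall>t\<in>T. pair t (lpow L (Suc k)) = \<zero>" by blast
  qed
  have noid: "\<not> is_identity quot e" for e
  proof -
    obtain W g where W: "dual (E 0) W g" "2 \<le> card W" using st(3) by blast
    then obtain w where w: "w \<in> W" by fastforce
    have "g w \<in> T" "g w w \<noteq> \<zero>" using W(1) w TE[of _ 0] by (auto simp: dual_def)
    moreover have "w \<noteq> []" using dual_length(1)[OF st(2) W(1) w] st(1)[of 0] by auto
    ultimately show ?thesis using quot_no_identity[OF nil] by blast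
  qed
  have upper: "\<exists>n\<ge>s k. growth F quot gspace n \<le> \<omega> n" for k
  proof -
    obtain n where n: "n \<ge> s k" "thin_at n (\<omega> n) (s k) (s (Suc k)) (E (Suc k))"
      using step[of k] by (auto simp: stage_step_def)
    from n(2)[unfolded thin_at_def] obtain \<Lambda> where \<Lambda>: "finite \<Lambda>" "\<Lambda> \<subseteq> wfuns"
      "Suc (card (bwords (s k)) + card \<Lambda>) \<le> \<omega> n"
      "\<forall>C E' g u v L. blocks (s (Suc k)) (E (Suc k)) C E' \<and> C > 0 \<and> g \<in> E' \<and> wcomb L \<and>
        (\<forall>p\<in>set L. length (snd p) \<le> n) \<and> (\<forall>t\<in>\<Lambda>. pair t L = \<zero>) \<longrightarrow> pair (\<lambda>w. g (u @ w @ v)) L = \<zero>"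
      by (elim exE conjE)
    \<comment> \<open>Translates from stages up to \<open>k\<close> vanish beyond length
      \<open>s k\<close> and are determined by point masses; \<open>\<Lambda>\<close> takes care of
      all later stages at once.\<close>
    let ?\<Lambda> = "delta ` bwords (s k) \<union> \<Lambda>"
    have dw: "delta ` bwords (s k) \<subseteq> wfuns" by (auto simp: delta_def intro: wfunI)
    have "vectorspace.dim F (uhull\<lparr>carrier := filt n\<rparr>) \<le> Suc (card ?\<Lambda>)"
    proof (rule dim_filt_le(2))
      show "finite ?\<Lambda>" using \<Lambda>(1) by simp
      show "?\<Lambda> \<subseteq> wfuns" using \<Lambda>(2) dw by blast
      fix L t assume L: "L \<in> vdeg n" "\<forall>s\<in>?\<Lambda>. pair s L = \<zero>" and t: "t \<in> T"
      obtain g u v j where g: "t = (\<lambda>w. g (u @ w @ v))" "g \<in> E j" using t by (auto simp: T_def)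
      have gs: "g \<in> wfuns_len (s j)" by (rule Es[OF g(2)])
      have wL: "wcomb L" using L(1) vdeg_vcomb vcomb_wcomb by blast
      show "pair t L = \<zero>"
      proof (cases "Suc k \<le> j")
        case True
        have "\<forall>p\<in>set L. length (snd p) \<le> n" using L(1) by (simp add: vdeg_def)
        then show ?thesis
          unfolding g(1) using bl[OF True] st(1)[of j] g(2) wL L(2) by (intro \<Lambda>(4)[rule_format]) blast
      next
        case False
        then have sj: "s j \<le> s k" using smono[of j k] by simp
        show ?thesis
        proof (rule pair_delta_determined[of _ _ "bwords (s k)"])
          show "t \<in> wfuns" using t by simp
          show "wcomb L" by (rule wL)
          show "finite (bwords (s k))" by simp
          show "pair (delta x) L = \<zero>" if "x \<in> bwords (s k)" for x using L(2) that by blast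
          show "snd p \<in> bwords (s k)" if "t (snd p) \<noteq> \<zero>" for p
          proof -
            have "length (u @ snd p @ v) = s j" "set (u @ snd p @ v) \<subseteq> {0, 1}"
              using wfuns_lenD(2,3)[OF gs] that g(1) by blast+
            then show ?thesis using sj by (auto simp: bwords_def)
          qed
        qed
      qed
    qed
    also have "card ?\<Lambda> \<le> card (bwords (s k)) + card \<Lambda>"
      using card_Un_le[of "delta ` bwords (s k)" \<Lambda>] card_image_le[OF finite_bwords, of delta "s k"] by linarith
    finally have "growth F quot gspace n \<le> \<omega> n" using growth_eq[OF noid] \<Lambda>(3) by simp
    then show ?thesis using n(1) by blast
  qed
  have lower: "f (s (Suc k)) \<le> growth F quot gspace (s (Suc k))" for k
  proof -
    obtain W g where W: "dual (E (Suc k)) W g" "f (s (Suc k)) \<le> card W"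
      using step[of k] by (auto simp: stage_step_def)
    \<comment> \<open>With empty contexts \<open>E (Suc k)\<close> lies inside \<open>T\<close>, so
      its biorthogonal words remain independent in the quotient.\<close>
    have "dual T W g" using W(1) TE unfolding dual_def by blast
    then have "card W \<le> vectorspace.dim F (uhull\<lparr>carrier := filt (s (Suc k))\<rparr>)"
      using dual_length(1)[OF st(2) W(1)] st(1) by (intro dim_filt_ge) auto
    then show ?thesis using W(2) growth_eq[OF noid] by simp
  qed
  have "infinite {n. n \<ge> 1 \<and> growth F quot gspace n \<le> \<omega> n}"
    unfolding infinite_nat_iff_unbounded
  proof
    fix k
    obtain n where "n \<ge> s (Suc k)" "growth F quot gspace n \<le> \<omega> n" using upper by blast
    then show "\<exists>n>k. n \<in> {n. n \<ge> 1 \<and> growth F quot gspace n \<le> \<omega> n}"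
      using sk[of "Suc k"] by (intro exI[of _ n]) auto
  qed
  moreover have "infinite {n. n \<ge> 1 \<and> growth F quot gspace n \<ge> f n}"
    unfolding infinite_nat_iff_unbounded
  proof
    fix k
    show "\<exists>n>k. n \<in> {n. n \<ge> 1 \<and> growth F quot gspace n \<ge> f n}"
      using lower[of k] sk[of "Suc k"] by (intro exI[of _ "s (Suc k)"]) auto
  qed
  ultimately show ?thesis
    using quot_algebra finitely_generated_quot nil generating_gspace
    by (intro exI[of _ quot] exI[of _ gspace]) blast
qed

end

theorem theoremB2:
  fixes F :: "('f, 'm) ring_scheme" and f \<omega> :: "nat \<Rightarrow> nat"
  assumes "field F"
    and "subexponential f"
    and "\<omega> ` {1..} \<subseteq> {1..}" and "mono_on {1..} \<omega>" and "super_polynomial \<omega>"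
  shows "\<exists>(R :: ('f, 'f free_coset) module) V.
           nonunital_algebra F R \<and> finitely_generated F R \<and> nil_algebra R \<and>
           generating_subspace F R V \<and>
           infinite {n. n \<ge> 1 \<and> growth F R V n \<le> \<omega> n} \<and>
           infinite {n. n \<ge> 1 \<and> growth F R V n \<ge> f n}"
proof -
  interpret word_field F using assms(1) by (simp add: word_field_def)
  show ?thesis by (rule oscillating_nil_algebra[OF assms(2,5)])
qed

end
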